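(* Assume (Lip) and (DM) below. Let $v:(\mathcal H^T)^d\to(\mathcal H^T)^d$ be the operator defined in the context and let $\alpha^*\in(\mathcal H^T)^d$ be the unique control solving the mean field game of controls. Let $\alpha_1\in(\mathcal H^T)^d$ be arbitrary, let $\gamma>0$ satisfy $\gamma\le \frac1{\|v\|_{Lip}}$, and define for $n\ge1$ $$\alpha_{n+\frac12}=\alpha_n-\gamma v(\alpha_n),\qquad \alpha_{n+1}=\alpha_n-\gamma v(\alpha_{n+\frac12}),\qquad \bar\alpha_n=\frac1n\sum_{i=1}^n\alpha_{i+\frac12}.$$ Then $$\forall n\ge1,\qquad \|\alpha^*-\bar\alpha_n\|_T^2\le\frac{\|\alpha^*-\alpha_1\|_T^2}{2\gamma c_L n}.$$
   Context: Fix $T>0$, $d\ge1$, a constant $\sigma\ge0$ and a complete probability space $(\Omega,\mathcal F,\mathbb P)$ with a $d$-dimensional Brownian motion $(B_t)_{t\in[0,T]}$. $\mathcal H=L^2(\Omega,\mathbb R)$; on $\mathcal H^k$ write $\langle X,Y\rangle=\mathbb E[X\cdot Y]$, $\|X\|=\sqrt{\langle X,X\rangle}$. $X_0\in\mathcal H^d$ is a fixed initial condition independent of $B$, and $(\mathcal F_t)$ is the augmented filtration generated by $X_0$ and $B$. $(\mathcal H^T)^d$ is the Hilbert space of square integrable adapted $\mathbb R^d$-valued processes on $[0,T]$, with $\langle\alpha,\beta\rangle^T=\mathbb E\int_0^T\alpha_t\cdot\beta_t\,dt$ and $\|\alpha\|_T=\sqrt{\langle\alpha,\alpha\rangle^T}$.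 $\mathcal L(\cdot)$ denotes the law; $\mathcal P_2(\mathbb R^k)$ is the set of probability measures with finite second moment, with the Wasserstein-2 distance $\mathcal W_2$. Data: $g:\mathbb R^d\times\mathcal P_2(\mathbb R^d)\to\mathbb R$, $(x,\mu)\mapsto g(x,\mu)$, and $L:\mathbb R^d\times\mathbb R^d\times\mathcal P_2(\mathbb R^{2d})\to\mathbb R$, $(x,a,m)\mapsto L(x,a,m)$ ($\nabla_\alpha L$ is the gradient in $a$). (Lip): $\nabla_xg,\nabla_xL,\nabla_\alpha L$ are well defined and continuous in all arguments; $\nabla_x g$ and $\nabla_xL$ are Lipschitz in all arguments; $(x,m)\mapsto\nabla_\alpha L(x,a,m)$ is Lipschitz uniformly in $a\in\mathbb R^d$. (DM): there is $c_L>0$ such that for all $X,Y,\alpha,\alpha'\in\mathcal H^d$, $\langle\nabla_xg(X,\mathcal L(X))-\nabla_xg(Y,\mathcal L(Y)),X-Y\rangle\ge0$ and $\langle\nabla_xL(X,\alpha,\mathcal L(X,\alpha))-\nabla_xL(Y,\alpha',\mathcal L(Y,\alpha')),X-Y\rangle+\langle\nabla_\alpha L(X,\alpha,\mathcal L(X,\alpha))-\nabla_\alpha L(Y,\alpha',\mathcal L(Y,\alpha')),\alpha-\alpha'\rangle\ge c_L\|\alpha-\alpha'\|^2$. For $\alpha\in(\mathcal H^T)^d$ let $X^\alpha_t=X_0-\int_0^t\alpha_sds+\sqrt{2\sigma}B_t$. For a flow $(m_t)_{t\in[0,T]}$ in $\mathcal P_2(\mathbb R^{2d})$ let $J(\alpha,(m_t))=\mathbb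 E\big[g(X^\alpha_T,\mu_T)+\int_0^TL(X^\alpha_t,\alpha_t,m_t)dt\big]$, $\mu_T$ being the marginal of $m_T$ on the first $d$ variables. A control $\alpha^*\in(\mathcal H^T)^d$ solves the mean field game of controls if $\alpha^*$ minimizes $\alpha\mapsto J\big(\alpha,(\mathcal L(X^{\alpha^*}_t,\alpha^*_t))_{t\in[0,T]}\big)$ over $(\mathcal H^T)^d$ (here $\mu_T=\mathcal L(X_T^{\alpha^*})$). Under (Lip) and (DM) such a control exists and is unique. For $\alpha\in(\mathcal H^T)^d$, $(U^\alpha,Z^\alpha)$ is the unique adapted solution of $U^\alpha_t=\nabla_xg(X^\alpha_T,\mathcal L(X^\alpha_T))+\int_t^T\nabla_xL(X^\alpha_s,\alpha_s,\mathcal L(X^\alpha_s,\alpha_s))ds-\int_t^TZ^\alpha_sdB_s$. The operator $v$ is $v(\alpha)_t=\nabla_\alpha L(X^\alpha_t,\alpha_t,\mathcal L(X^\alpha_t,\alpha_t))-U^\alpha_t$, understood as a well-defined map from $(\mathcal H^T)^d$ to itself (in particular $\nabla_\alpha L(X,\alpha,\mathcal L(X,\alpha))\in\mathcal H^d$ for $X,\alpha\in\mathcal H^d$), and $\|v\|_{Lip}=\sup_{\alpha\ne\alpha'}\|v(\alpha)-v(\alpha')\|_T/\|\alpha-\alpha'\|_T$ (finite, since $\gamma>0$ with $\gamma\le1/\|v\|_{Lip}$ is assumed). *)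

theory Defs
  imports "HOL-Probability.Probability"
begin

section \<open>Square integrable random variables and the Wasserstein space\<close>

definition L2 :: "'w measure \<Rightarrow> ('w \<Rightarrow> 'a::euclidean_space) set" where
  "L2 M = {X \<in> borel_measurable M. integrable M (\<lambda>\<omega>. (norm (X \<omega>))\<^sup>2)}"

definition L2_inner :: "'w measure \<Rightarrow> ('w \<Rightarrow> 'a::euclidean_space) \<Rightarrow> ('w \<Rightarrow> 'a) \<Rightarrow> real" where
  "L2_inner M X Y = (\<integral>\<omega>. X \<omega> \<bullet> Y \<omega> \<partial>M)"

definition L2_norm :: "'w measure \<Rightarrow> ('w \<Rightarrow> 'a::euclidean_space) \<Rightarrow> real" where
  "L2_norm M X = sqrt (L2_inner M X X)"

abbreviation law :: "'w measure \<Rightarrow> ('w \<Rightarrow> 'a::topological_space) \<Rightarrow> 'a measure" where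
  "law M X \<equiv> distr M borel X"

definition P2 :: "'a::euclidean_space measure set" where
  "P2 = {\<mu>. sets \<mu> = sets borel \<and> prob_space \<mu> \<and> integrable \<mu> (\<lambda>x. (norm x)\<^sup>2)}"

definition couplings :: "'a::euclidean_space measure \<Rightarrow> 'a measure \<Rightarrow> ('a \<times> 'a) measure set" where
  "couplings \<mu> \<nu> = {\<pi>. sets \<pi> = sets borel \<and> distr \<pi> borel fst = \<mu> \<and> distr \<pi> borel snd = \<nu>}"

definition W2 :: "'a::euclidean_space measure \<Rightarrow> 'a measure \<Rightarrow> real" where
  "W2 \<mu> \<nu> =
     sqrt (enn2real (INF \<pi>\<in>couplings \<mu> \<nu>. \<integral>\<^sup>+ z. ennreal ((dist (fst z) (snd z))\<^sup>2) \<partial>\<pi>))"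

text \<open>
  Measures are a single type; the second argument of the functions below only matters on
  \<^const>\<open>P2\<close>, so continuity and Lipschitz continuity with respect to the measure
  are spelled out relative to that set and to \<^const>\<open>W2\<close>.
\<close>

definition W2_continuous ::
  "('a::metric_space \<Rightarrow> 'p::euclidean_space measure \<Rightarrow> 'b::metric_space) \<Rightarrow> bool" where
  "W2_continuous F \<longleftrightarrow>
     (\<forall>x. \<forall>\<mu>\<in>P2. \<forall>\<epsilon>>0. \<exists>\<delta>>0. \<forall>y. \<forall>\<nu>\<in>P2.
        dist x y < \<delta> \<and> W2 \<mu> \<nu> < \<delta> \<longrightarrow> dist (F x \<mu>) (F y \<nu>) < \<epsilon>)"

definition W2_lipschitz ::
  "real \<Rightarrow> ('a::metric_space \<Rightarrow> 'p::euclidean_space measure \<Rightarrow> 'b::metric_space) \<Rightarrow> bool" where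
  "W2_lipschitz K F \<longleftrightarrow>
     (\<forall>x y. \<forall>\<mu>\<in>P2. \<forall>\<nu>\<in>P2. dist (F x \<mu>) (F y \<nu>) \<le> K * (dist x y + W2 \<mu> \<nu>))"


section \<open>Gradients of the data and the standing assumptions\<close>

definition grad :: "('a::euclidean_space \<Rightarrow> real) \<Rightarrow> 'a \<Rightarrow> 'a" where
  "grad f x = (THE D. GDERIV f x :> D)"

definition has_grad :: "('a::euclidean_space \<Rightarrow> real) \<Rightarrow> 'a \<Rightarrow> bool" where
  "has_grad f x \<longleftrightarrow> (\<exists>D. GDERIV f x :> D)"

definition grad_x_g ::
  "('a::euclidean_space \<Rightarrow> 'a measure \<Rightarrow> real) \<Rightarrow> 'a \<Rightarrow> 'a measure \<Rightarrow> 'a" where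
  "grad_x_g g x \<mu> = grad (\<lambda>y. g y \<mu>) x"

definition grad_x_L ::
  "('a::euclidean_space \<Rightarrow> 'a \<Rightarrow> ('a \<times> 'a) measure \<Rightarrow> real) \<Rightarrow> 'a \<Rightarrow> 'a \<Rightarrow> ('a \<times> 'a) measure \<Rightarrow> 'a" where
  "grad_x_L L x a m = grad (\<lambda>y. L y a m) x"

definition grad_a_L ::
  "('a::euclidean_space \<Rightarrow> 'a \<Rightarrow> ('a \<times> 'a) measure \<Rightarrow> real) \<Rightarrow> 'a \<Rightarrow> 'a \<Rightarrow> ('a \<times> 'a) measure \<Rightarrow> 'a" where
  "grad_a_L L x a m = grad (\<lambda>b. L x b m) a"

definition assm_Lip ::
  "('a::euclidean_space \<Rightarrow> 'a measure \<Rightarrow> real) \<Rightarrow> ('a \<Rightarrow> 'a \<Rightarrow> ('a \<times> 'a) measure \<Rightarrow> real) \<Rightarrow> bool" where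
  "assm_Lip g L \<longleftrightarrow>
     (\<forall>x. \<forall>\<mu>\<in>P2. has_grad (\<lambda>y. g y \<mu>) x) \<and>
     (\<forall>x a. \<forall>m\<in>P2. has_grad (\<lambda>y. L y a m) x \<and> has_grad (\<lambda>b. L x b m) a) \<and>
     W2_continuous (grad_x_g g) \<and>
     W2_continuous (\<lambda>(x, a). grad_x_L L x a) \<and>
     W2_continuous (\<lambda>(x, a). grad_a_L L x a) \<and>
     (\<exists>K. W2_lipschitz K (grad_x_g g)) \<and>
     (\<exists>K. W2_lipschitz K (\<lambda>(x, a). grad_x_L L x a)) \<and>
     (\<exists>K. \<forall>a. W2_lipschitz K (\<lambda>x m. grad_a_L L x a m))"

text \<open>The random variables $\nabla_x L(X,\alpha,\mathcal{L}(X,\alpha))$ etc.\<close>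

definition Gxg ::
  "'w measure \<Rightarrow> ('a::euclidean_space \<Rightarrow> 'a measure \<Rightarrow> real) \<Rightarrow> ('w \<Rightarrow> 'a) \<Rightarrow> 'w \<Rightarrow> 'a" where
  "Gxg M g X = (\<lambda>\<omega>. grad_x_g g (X \<omega>) (law M X))"

definition GxL ::
  "'w measure \<Rightarrow> ('a::euclidean_space \<Rightarrow> 'a \<Rightarrow> ('a \<times> 'a) measure \<Rightarrow> real) \<Rightarrow>
   ('w \<Rightarrow> 'a) \<Rightarrow> ('w \<Rightarrow> 'a) \<Rightarrow> 'w \<Rightarrow> 'a" where
  "GxL M L X A = (\<lambda>\<omega>. grad_x_L L (X \<omega>) (A \<omega>) (law M (\<lambda>\<omega>. (X \<omega>, A \<omega>))))"

definition GaL ::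
  "'w measure \<Rightarrow> ('a::euclidean_space \<Rightarrow> 'a \<Rightarrow> ('a \<times> 'a) measure \<Rightarrow> real) \<Rightarrow>
   ('w \<Rightarrow> 'a) \<Rightarrow> ('w \<Rightarrow> 'a) \<Rightarrow> 'w \<Rightarrow> 'a" where
  "GaL M L X A = (\<lambda>\<omega>. grad_a_L L (X \<omega>) (A \<omega>) (law M (\<lambda>\<omega>. (X \<omega>, A \<omega>))))"

definition assm_DM ::
  "'w measure \<Rightarrow> real \<Rightarrow> ('a::euclidean_space \<Rightarrow> 'a measure \<Rightarrow> real) \<Rightarrow>
   ('a \<Rightarrow> 'a \<Rightarrow> ('a \<times> 'a) measure \<Rightarrow> real) \<Rightarrow> bool" where
  "assm_DM M cL g L \<longleftrightarrow>
     (\<forall>X\<in>L2 M. \<forall>Y\<in>L2 M. 0 \<le> L2_inner M (\<lambda>\<omega>. Gxg M g X \<omega> - Gxg M g Y \<omega>) (\<lambda>\<omega>. X \<omega> - Y \<omega>)) \<and>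
     (\<forall>X\<in>L2 M. \<forall>Y\<in>L2 M. \<forall>A\<in>L2 M. \<forall>A'\<in>L2 M.
        cL * (L2_norm M (\<lambda>\<omega>. A \<omega> - A' \<omega>))\<^sup>2
        \<le> L2_inner M (\<lambda>\<omega>. GxL M L X A \<omega> - GxL M L Y A' \<omega>) (\<lambda>\<omega>. X \<omega> - Y \<omega>)
          + L2_inner M (\<lambda>\<omega>. GaL M L X A \<omega> - GaL M L Y A' \<omega>) (\<lambda>\<omega>. A \<omega> - A' \<omega>))"


section \<open>Brownian motion, filtration, adapted processes\<close>

definition generated :: "'w measure \<Rightarrow> ('w \<Rightarrow> 'a::topological_space) set \<Rightarrow> 'w set set" where
  "generated M \<F> = {f -` A \<inter> space M | f A. f \<in> \<F> \<and> A \<in> sets borel}"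

definition brownian_motion :: "'w measure \<Rightarrow> real \<Rightarrow> (real \<Rightarrow> 'w \<Rightarrow> real ^ 'd) \<Rightarrow> bool" where
  "brownian_motion M T B \<longleftrightarrow>
     (\<forall>t\<in>{0..T}. B t \<in> borel_measurable M) \<and>
     (AE \<omega> in M. B 0 \<omega> = 0) \<and>
     (AE \<omega> in M. continuous_on {0..T} (\<lambda>t. B t \<omega>)) \<and>
     (\<forall>s t. 0 \<le> s \<and> s < t \<and> t \<le> T \<longrightarrow>
        prob_space.indep_vars M (\<lambda>_. borel) (\<lambda>i \<omega>. (B t \<omega> - B s \<omega>) $ i) UNIV \<and>
        (\<forall>i. distributed M lborel (\<lambda>\<omega>. (B t \<omega> - B s \<omega>) $ i)
               (\<lambda>x. ennreal (normal_density 0 (sqrt (t - s)) x))) \<and>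
        prob_space.indep_set M
          (sigma_sets (space M) (generated M (B ` {0..s})))
          (sigma_sets (space M) (generated M {\<lambda>\<omega>. B t \<omega> - B s \<omega>})))"

definition aug_filtration ::
  "'w measure \<Rightarrow> ('w \<Rightarrow> real ^ 'd) \<Rightarrow> (real \<Rightarrow> 'w \<Rightarrow> real ^ 'd) \<Rightarrow> real \<Rightarrow> 'w measure" where
  "aug_filtration M X0 B t = sigma (space M) (generated M (insert X0 (B ` {0..t})) \<union> null_sets M)"

definition time_prod :: "'w measure \<Rightarrow> real \<Rightarrow> (real \<times> 'w) measure" where
  "time_prod M T = restrict_space lborel {0..T} \<Otimes>\<^sub>M M"

text \<open>
  Representatives of the elements of the Hilbert space of square integrable adapted processes:
  processes are not identified when they agree almost everywhere, and statements about elements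
  of the quotient are formulated through \<open>normT\<close> or \<open>AE\<close>.
\<close>

definition HT ::
  "'w measure \<Rightarrow> real \<Rightarrow> (real \<Rightarrow> 'w measure) \<Rightarrow> (real \<Rightarrow> 'w \<Rightarrow> 'v::euclidean_space) set" where
  "HT M T F = {\<alpha>.
     (\<forall>t\<in>{0..T}. \<alpha> t \<in> borel_measurable (F t)) \<and>
     case_prod \<alpha> \<in> borel_measurable (time_prod M T) \<and>
     integrable (time_prod M T) (\<lambda>(t, \<omega>). (norm (\<alpha> t \<omega>))\<^sup>2)}"

definition innerT ::
  "'w measure \<Rightarrow> real \<Rightarrow> (real \<Rightarrow> 'w \<Rightarrow> 'v::euclidean_space) \<Rightarrow> (real \<Rightarrow> 'w \<Rightarrow> 'v) \<Rightarrow> real" where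
  "innerT M T \<alpha> \<beta> = (\<integral>\<omega>. (LINT t:{0..T}|lebesgue. \<alpha> t \<omega> \<bullet> \<beta> t \<omega>) \<partial>M)"

definition normT :: "'w measure \<Rightarrow> real \<Rightarrow> (real \<Rightarrow> 'w \<Rightarrow> 'v::euclidean_space) \<Rightarrow> real" where
  "normT M T \<alpha> = sqrt (innerT M T \<alpha> \<alpha>)"


section \<open>Ito integral\<close>

text \<open>
  Simple integrands $\sum_{i<n} \xi_i 1_{(\tau_i,\tau_{i+1}]}$ with bounded
  $\mathcal{F}_{\tau_i}$-measurable matrix-valued $\xi_i$.
\<close>

definition simple_integrand ::
  "real \<Rightarrow> (real \<Rightarrow> 'w measure) \<Rightarrow> nat \<Rightarrow> (nat \<Rightarrow> real) \<Rightarrow> (nat \<Rightarrow> 'w \<Rightarrow> real ^ 'd ^ 'd) \<Rightarrow> bool" where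
  "simple_integrand T F n \<tau> \<xi> \<longleftrightarrow>
     mono \<tau> \<and> (\<forall>i. \<tau> i \<in> {0..T}) \<and>
     (\<forall>i<n. \<xi> i \<in> borel_measurable (F (\<tau> i)) \<and> bounded (range (\<xi> i)))"

definition simple_process ::
  "nat \<Rightarrow> (nat \<Rightarrow> real) \<Rightarrow> (nat \<Rightarrow> 'w \<Rightarrow> real ^ 'd ^ 'd) \<Rightarrow> real \<Rightarrow> 'w \<Rightarrow> real ^ 'd ^ 'd" where
  "simple_process n \<tau> \<xi> t \<omega> = (\<Sum>i<n. indicat_real {\<tau> i<..\<tau> (Suc i)} t *\<^sub>R \<xi> i \<omega>)"

definition simple_ito ::
  "(real \<Rightarrow> 'w \<Rightarrow> real ^ 'd) \<Rightarrow> nat \<Rightarrow> (nat \<Rightarrow> real) \<Rightarrow> (nat \<Rightarrow> 'w \<Rightarrow> real ^ 'd ^ 'd) \<Rightarrow>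
   real \<Rightarrow> 'w \<Rightarrow> real ^ 'd" where
  "simple_ito B n \<tau> \<xi> t \<omega> = (\<Sum>i<n. \<xi> i \<omega> *v (B (min t (\<tau> (Suc i))) \<omega> - B (min t (\<tau> i)) \<omega>))"

text \<open>\<open>is_ito_integral M T F B Z I\<close>: for every \<open>t \<in> [0,T]\<close>, \<open>I t\<close> is a version of $\int_0^t Z_s\,dB_s$.\<close>

definition is_ito_integral ::
  "'w measure \<Rightarrow> real \<Rightarrow> (real \<Rightarrow> 'w measure) \<Rightarrow> (real \<Rightarrow> 'w \<Rightarrow> real ^ 'd) \<Rightarrow>
   (real \<Rightarrow> 'w \<Rightarrow> real ^ 'd ^ 'd) \<Rightarrow> (real \<Rightarrow> 'w \<Rightarrow> real ^ 'd) \<Rightarrow> bool" where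
  "is_ito_integral M T F B Z I \<longleftrightarrow>
     (\<forall>t\<in>{0..T}. I t \<in> borel_measurable M) \<and>
     (\<exists>n \<tau> \<xi>.
        (\<forall>k. simple_integrand T F (n k) (\<tau> k) (\<xi> k)) \<and>
        (\<lambda>k. \<integral>\<^sup>+ (t, \<omega>). ennreal ((norm (simple_process (n k) (\<tau> k) (\<xi> k) t \<omega> - Z t \<omega>))\<^sup>2)
               \<partial>time_prod M T) \<longlonglongrightarrow> 0 \<and>
        (\<forall>t\<in>{0..T}.
           (\<lambda>k. \<integral>\<^sup>+ \<omega>. ennreal ((norm (simple_ito B (n k) (\<tau> k) (\<xi> k) t \<omega> - I t \<omega>))\<^sup>2) \<partial>M)
             \<longlonglongrightarrow> 0))"


section \<open>The mean field game of controls\<close>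

text \<open>
  Time integrals are taken with respect to the complete measure \<^const>\<open>lebesgue\<close>: for a
  control \<open>\<alpha>\<close>, the joint law of state and control lies in \<^const>\<open>P2\<close> only for almost every
  time, and what happens at the exceptional times must not matter.
\<close>

definition state ::
  "real \<Rightarrow> ('w \<Rightarrow> real ^ 'd) \<Rightarrow> (real \<Rightarrow> 'w \<Rightarrow> real ^ 'd) \<Rightarrow> (real \<Rightarrow> 'w \<Rightarrow> real ^ 'd) \<Rightarrow>
   real \<Rightarrow> 'w \<Rightarrow> real ^ 'd" where
  "state \<sigma> X0 B \<alpha> t \<omega> =
     X0 \<omega> - (LINT s:{0..t}|lebesgue. \<alpha> s \<omega>) + sqrt (2 * \<sigma>) *\<^sub>R B t \<omega>"

definition cost ::
  "'w measure \<Rightarrow> real \<Rightarrow> real \<Rightarrow> ('w \<Rightarrow> real ^ 'd) \<Rightarrow> (real \<Rightarrow> 'w \<Rightarrow> real ^ 'd) \<Rightarrow>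
   (real ^ 'd \<Rightarrow> (real ^ 'd) measure \<Rightarrow> real) \<Rightarrow>
   (real ^ 'd \<Rightarrow> real ^ 'd \<Rightarrow> ((real ^ 'd) \<times> (real ^ 'd)) measure \<Rightarrow> real) \<Rightarrow>
   (real \<Rightarrow> 'w \<Rightarrow> real ^ 'd) \<Rightarrow> (real \<Rightarrow> ((real ^ 'd) \<times> (real ^ 'd)) measure) \<Rightarrow> real" where
  "cost M T \<sigma> X0 B g L \<alpha> m =
     (\<integral>\<omega>. g (state \<sigma> X0 B \<alpha> T \<omega>) (distr (m T) borel fst)
           + (LINT t:{0..T}|lebesgue. L (state \<sigma> X0 B \<alpha> t \<omega>) (\<alpha> t \<omega>) (m t)) \<partial>M)"

text \<open>
  The Bochner integral is 0 by convention for non-integrable functions, so existence of the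
  integrals in \<^const>\<open>cost\<close> is tracked separately; a control without well-defined
  cost is treated as having cost \<open>+\<infinity>\<close>.
\<close>

definition cost_defined ::
  "'w measure \<Rightarrow> real \<Rightarrow> real \<Rightarrow> ('w \<Rightarrow> real ^ 'd) \<Rightarrow> (real \<Rightarrow> 'w \<Rightarrow> real ^ 'd) \<Rightarrow>
   (real ^ 'd \<Rightarrow> (real ^ 'd) measure \<Rightarrow> real) \<Rightarrow>
   (real ^ 'd \<Rightarrow> real ^ 'd \<Rightarrow> ((real ^ 'd) \<times> (real ^ 'd)) measure \<Rightarrow> real) \<Rightarrow>
   (real \<Rightarrow> 'w \<Rightarrow> real ^ 'd) \<Rightarrow> (real \<Rightarrow> ((real ^ 'd) \<times> (real ^ 'd)) measure) \<Rightarrow> bool" where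
  "cost_defined M T \<sigma> X0 B g L \<alpha> m \<longleftrightarrow>
     integrable M (\<lambda>\<omega>. g (state \<sigma> X0 B \<alpha> T \<omega>) (distr (m T) borel fst)) \<and>
     integrable (completion (time_prod M T)) (\<lambda>(t, \<omega>). L (state \<sigma> X0 B \<alpha> t \<omega>) (\<alpha> t \<omega>) (m t))"

definition law_flow ::
  "'w measure \<Rightarrow> real \<Rightarrow> ('w \<Rightarrow> real ^ 'd) \<Rightarrow> (real \<Rightarrow> 'w \<Rightarrow> real ^ 'd) \<Rightarrow>
   (real \<Rightarrow> 'w \<Rightarrow> real ^ 'd) \<Rightarrow> real \<Rightarrow> ((real ^ 'd) \<times> (real ^ 'd)) measure" where
  "law_flow M \<sigma> X0 B \<alpha> t = law M (\<lambda>\<omega>. (state \<sigma> X0 B \<alpha> t \<omega>, \<alpha> t \<omega>))"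

definition solves_mfg ::
  "'w measure \<Rightarrow> real \<Rightarrow> real \<Rightarrow> ('w \<Rightarrow> real ^ 'd) \<Rightarrow> (real \<Rightarrow> 'w \<Rightarrow> real ^ 'd) \<Rightarrow>
   (real ^ 'd \<Rightarrow> (real ^ 'd) measure \<Rightarrow> real) \<Rightarrow>
   (real ^ 'd \<Rightarrow> real ^ 'd \<Rightarrow> ((real ^ 'd) \<times> (real ^ 'd)) measure \<Rightarrow> real) \<Rightarrow>
   (real \<Rightarrow> 'w \<Rightarrow> real ^ 'd) \<Rightarrow> bool" where
  "solves_mfg M T \<sigma> X0 B g L \<alpha>s \<longleftrightarrow>
     \<alpha>s \<in> HT M T (aug_filtration M X0 B) \<and>
     cost_defined M T \<sigma> X0 B g L \<alpha>s (law_flow M \<sigma> X0 B \<alpha>s) \<and>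
     (\<forall>\<alpha>\<in>HT M T (aug_filtration M X0 B).
        cost_defined M T \<sigma> X0 B g L \<alpha> (law_flow M \<sigma> X0 B \<alpha>s) \<longrightarrow>
        cost M T \<sigma> X0 B g L \<alpha>s (law_flow M \<sigma> X0 B \<alpha>s)
          \<le> cost M T \<sigma> X0 B g L \<alpha> (law_flow M \<sigma> X0 B \<alpha>s))"


section \<open>The backward equation and the operator\<close>

definition solves_bsde ::
  "'w measure \<Rightarrow> real \<Rightarrow> real \<Rightarrow> ('w \<Rightarrow> real ^ 'd) \<Rightarrow> (real \<Rightarrow> 'w \<Rightarrow> real ^ 'd) \<Rightarrow>
   (real ^ 'd \<Rightarrow> (real ^ 'd) measure \<Rightarrow> real) \<Rightarrow>
   (real ^ 'd \<Rightarrow> real ^ 'd \<Rightarrow> ((real ^ 'd) \<times> (real ^ 'd)) measure \<Rightarrow> real) \<Rightarrow>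
   (real \<Rightarrow> 'w \<Rightarrow> real ^ 'd) \<Rightarrow>
   (real \<Rightarrow> 'w \<Rightarrow> real ^ 'd) \<Rightarrow> (real \<Rightarrow> 'w \<Rightarrow> real ^ 'd ^ 'd) \<Rightarrow> bool" where
  "solves_bsde M T \<sigma> X0 B g L \<alpha> U Z \<longleftrightarrow>
     U \<in> HT M T (aug_filtration M X0 B) \<and>
     Z \<in> HT M T (aug_filtration M X0 B) \<and>
     (\<exists>I. is_ito_integral M T (aug_filtration M X0 B) B Z I \<and>
        (\<forall>t\<in>{0..T}. AE \<omega> in M.
           U t \<omega> = Gxg M g (state \<sigma> X0 B \<alpha> T) \<omega>
                   + (LINT s:{t..T}|lebesgue. GxL M L (state \<sigma> X0 B \<alpha> s) (\<alpha> s) \<omega>)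
                   - (I T \<omega> - I t \<omega>)))"

text \<open>
  \<open>v\<close> is the operator $v(\alpha)_t = \nabla_\alpha L(X^\alpha_t,\alpha_t,\mathcal{L}(X^\alpha_t,\alpha_t)) - U^\alpha_t$,
  a well-defined map of the space of controls to itself. It is given as a map on representatives,
  determined up to almost everywhere equality.
\<close>

definition is_mfg_operator ::
  "'w measure \<Rightarrow> real \<Rightarrow> real \<Rightarrow> ('w \<Rightarrow> real ^ 'd) \<Rightarrow> (real \<Rightarrow> 'w \<Rightarrow> real ^ 'd) \<Rightarrow>
   (real ^ 'd \<Rightarrow> (real ^ 'd) measure \<Rightarrow> real) \<Rightarrow>
   (real ^ 'd \<Rightarrow> real ^ 'd \<Rightarrow> ((real ^ 'd) \<times> (real ^ 'd)) measure \<Rightarrow> real) \<Rightarrow>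
   ((real \<Rightarrow> 'w \<Rightarrow> real ^ 'd) \<Rightarrow> (real \<Rightarrow> 'w \<Rightarrow> real ^ 'd)) \<Rightarrow> bool" where
  "is_mfg_operator M T \<sigma> X0 B g L v \<longleftrightarrow>
     (\<forall>\<alpha>\<in>HT M T (aug_filtration M X0 B).
        v \<alpha> \<in> HT M T (aug_filtration M X0 B) \<and>
        (\<exists>U Z. solves_bsde M T \<sigma> X0 B g L \<alpha> U Z \<and>
           (AE (t, \<omega>) in time_prod M T.
              v \<alpha> t \<omega> = GaL M L (state \<sigma> X0 B \<alpha> t) (\<alpha> t) \<omega> - U t \<omega>)))"

text \<open>Valued in \<open>[0,\<infinity>]\<close>; note \<open>1 / \<infinity> = 0\<close> and \<open>1 / 0 = \<infinity>\<close> there.\<close>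

definition lip_norm ::
  "'w measure \<Rightarrow> real \<Rightarrow> (real \<Rightarrow> 'w measure) \<Rightarrow>
   ((real \<Rightarrow> 'w \<Rightarrow> 'v::euclidean_space) \<Rightarrow> (real \<Rightarrow> 'w \<Rightarrow> 'v)) \<Rightarrow> ennreal" where
  "lip_norm M T F v =
     (SUP (\<alpha>, \<beta>) \<in> {(\<alpha>, \<beta>). \<alpha> \<in> HT M T F \<and> \<beta> \<in> HT M T F \<and> normT M T (\<lambda>t \<omega>. \<alpha> t \<omega> - \<beta> t \<omega>) \<noteq> 0}.
        ennreal (normT M T (\<lambda>t \<omega>. v \<alpha> t \<omega> - v \<beta> t \<omega>) / normT M T (\<lambda>t \<omega>. \<alpha> t \<omega> - \<beta> t \<omega>)))"

end

theory Submission
  imports Defs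
begin

text \<open>
The operator \<open>v\<close> is a Lipschitz, strongly monotone map on the Hilbert space of controls, and the
equilibrium control \<open>\<alpha>\<^sup>*\<close> satisfies \<open>\<langle>v(\<alpha>\<^sup>*), \<beta>\<rangle> \<ge> 0\<close> in every direction \<open>\<beta>\<close>. For such an operator
the averages of the extragradient half steps converge at rate \<open>1/n\<close>.

The link between \<open>v\<close> and the assumptions is a duality formula (\<open>operator_duality\<close>). Pair \<open>U\<close> with
an adapted \<open>\<beta>\<close>: the stochastic integral drops out, because its increment after time \<open>t\<close> is
orthogonal to every square integrable \<open>\<F>\<^sub>t\<close>-measurable variable, and exchanging the two time
integrals moves the integral over \<open>[t,T]\<close> from the data onto \<open>\<beta>\<close>. With \<open>Y\<^sub>t = - \<integral>\<^sub>0\<^sup>t \<beta>\<^sub>s ds\<close> this gives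
\[ \langle v(\alpha), \beta \rangle^T =
   \mathbb E \int_0^T \big( \nabla_\alpha L \cdot \beta_t + \nabla_x L \cdot Y_t \big) dt
   + \mathbb E [ \nabla_x g \cdot Y_T ], \]
the gradients being evaluated along \<open>\<alpha>\<close>. The formula is read in two ways.

\<^item> Take the difference of the formulas for two controls, with \<open>\<beta>\<close> their difference. The
  Brownian terms of the two states cancel, so \<open>Y\<close> is the difference of the states, and the
  displacement monotonicity at almost every time gives
  \<open>\<langle>v(\<alpha>) - v(\<alpha>'), \<alpha> - \<alpha>'\<rangle> \<ge> c\<^sub>L \<parallel>\<alpha> - \<alpha>'\<parallel>\<^sup>2\<close> (\<open>operator_strongly_monotone\<close>).
\<^item> \<open>Y\<close> is the derivative of the state in direction \<open>\<beta>\<close>, so the right-hand side is the derivative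
  of the cost at \<open>\<alpha>\<close> in direction \<open>\<beta>\<close> when the flow of laws is frozen at that of \<open>\<alpha>\<close>. At the minimiser
  it is nonnegative (\<open>first_order_condition\<close>). Differentiation under the integral needs a
  dominating function, while the regularity assumption makes \<open>\<nabla>\<^sub>\<alpha> L\<close> merely continuous in the control,
  with no explicit growth bound; the derivative is therefore taken in bounded
  directions that vanish where \<open>\<alpha>\<^sup>*\<close> is large, and these are dense.

Both readings integrate \<open>\<nabla>L(X\<^sub>t, \<alpha>\<^sub>t, \<L>(X\<^sub>t, \<alpha>\<^sub>t))\<close> over time and paths, so it has to be jointly measurable
although its third argument is a measure that varies with \<open>t\<close>. The curve
\<open>t \<mapsto> (X\<^sub>t, \<alpha>\<^sub>t)\<close> has separable range in \<open>L\<^sup>2\<close>, since a product \<open>\<sigma>\<close>-algebra is generated by rectangles.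
Hence it is a limit of curves with countably many values, for which measurability is immediate, and
continuity in \<open>W\<^sub>2\<close> passes to the limit (\<open>measurable_along_law_flow\<close>).

In one extragradient step, expanding the squares and using \<open>\<gamma> \<parallel>v(\<alpha>\<^sub>n\<^sub>+\<^sub>1\<^sub>/\<^sub>2) - v(\<alpha>\<^sub>n)\<parallel> \<le> \<parallel>\<alpha>\<^sub>n\<^sub>+\<^sub>1\<^sub>/\<^sub>2 - \<alpha>\<^sub>n\<parallel>\<close> gives
\[ \|\alpha_{n+1} - \alpha^*\|^2 \le \|\alpha_n - \alpha^*\|^2
   - 2 \gamma c_L \|\alpha_{n+1/2} - \alpha^*\|^2 \]
(\<open>extragradient_step\<close>). The sum over \<open>n\<close> telescopes, and convexity of the squared norm bounds the
distance from \<open>\<alpha>\<^sup>*\<close> to the average.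
\<close>

section \<open>Square integrable functions and the Wasserstein distance\<close>

lemma L2_D: "X \<in> L2 N \<Longrightarrow> X \<in> borel_measurable N" "X \<in> L2 N \<Longrightarrow> integrable N (\<lambda>x. (norm (X x))\<^sup>2)"
  by (auto simp: L2_def)

lemma L2_dominated:
  fixes X :: "'w \<Rightarrow> 'a::euclidean_space"
  assumes "X \<in> borel_measurable N" "integrable N w" "AE x in N. (norm (X x))\<^sup>2 \<le> w x"
  shows "X \<in> L2 N"
proof -
  have "integrable N (\<lambda>x. (norm (X x))\<^sup>2)"
    using assms by (intro Bochner_Integration.integrable_bound[OF assms(2)]) auto
  thus ?thesis using assms by (simp add: L2_def)
qed

lemma L2_cong_AE:
  fixes X :: "'w \<Rightarrow> 'a::euclidean_space"
  assumes "X \<in> L2 N" "Y \<in> borel_measurable N" "AE x in N. X x = Y x"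
  shows "Y \<in> L2 N"
  using assms by (intro L2_dominated[where w="\<lambda>x. (norm (X x))\<^sup>2"]) (auto simp: L2_D)

lemma L2_add:
  fixes X :: "'w \<Rightarrow> 'a::euclidean_space"
  assumes "X \<in> L2 N" "Y \<in> L2 N" shows "(\<lambda>x. X x + Y x) \<in> L2 N"
proof (rule L2_dominated)
  show "(\<lambda>x. X x + Y x) \<in> borel_measurable N" using assms[THEN L2_D(1)] by simp
  show "integrable N (\<lambda>x. 2 * (norm (X x))\<^sup>2 + 2 * (norm (Y x))\<^sup>2)" using assms by (auto simp: L2_D)
  show "AE x in N. (norm (X x + Y x))\<^sup>2 \<le> 2 * (norm (X x))\<^sup>2 + 2 * (norm (Y x))\<^sup>2"
  proof (intro AE_I2)
    fix x
    have "(norm (X x + Y x))\<^sup>2 \<le> (norm (X x) + norm (Y x))\<^sup>2"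
      by (intro power_mono norm_triangle_ineq) auto
    also have "\<dots> \<le> 2 * (norm (X x))\<^sup>2 + 2 * (norm (Y x))\<^sup>2"
      using sum_squares_bound[of "norm (X x)" "norm (Y x)"] by (simp add: power2_sum)
    finally show "(norm (X x + Y x))\<^sup>2 \<le> 2 * (norm (X x))\<^sup>2 + 2 * (norm (Y x))\<^sup>2" .
  qed
qed

lemma L2_scaleR: 
  fixes X :: "'w \<Rightarrow> 'a::euclidean_space"
  assumes "X \<in> L2 N" shows "(\<lambda>x. c *\<^sub>R X x) \<in> L2 N"
  using assms by (auto simp: L2_def power_mult_distrib)

lemma L2_minus: 
  fixes X :: "'w \<Rightarrow> 'a::euclidean_space"
  assumes "X \<in> L2 N" shows "(\<lambda>x. - X x) \<in> L2 N"
  using assms by (auto simp: L2_def)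

lemma L2_diff:
  fixes X :: "'w \<Rightarrow> 'a::euclidean_space"
  assumes "X \<in> L2 N" "Y \<in> L2 N" shows "(\<lambda>x. X x - Y x) \<in> L2 N"
  using L2_add[OF assms(1) L2_minus[OF assms(2)]] by simp

lemma L2_zero: "(\<lambda>x. 0) \<in> L2 N" by (simp add: L2_def)

lemma L2_sum:
  fixes X :: "'i \<Rightarrow> 'w \<Rightarrow> 'a::euclidean_space"
  assumes "\<And>i. i \<in> I \<Longrightarrow> X i \<in> L2 N" shows "(\<lambda>x. \<Sum>i\<in>I. X i x) \<in> L2 N"
  using assms by (induction I rule: infinite_finite_induct) (auto intro: L2_zero L2_add)

lemma (in finite_measure) L2_bounded:
  fixes X :: "'a \<Rightarrow> 'b::euclidean_space"
  assumes "X \<in> borel_measurable M" "AE x in M. norm (X x) \<le> c" shows "X \<in> L2 M"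
  by (rule L2_dominated[OF assms(1), where w="\<lambda>_. c\<^sup>2"])
     (use assms(2) in \<open>auto elim!: eventually_mono intro: power_mono\<close>)

lemma L2_norm_bound:
  fixes X :: "'w \<Rightarrow> 'a::euclidean_space" and Y :: "'w \<Rightarrow> 'b::euclidean_space"
  assumes "Y \<in> L2 N" "X \<in> borel_measurable N" "\<And>x. norm (X x) \<le> norm (Y x)"
  shows "X \<in> L2 N"
  by (rule L2_dominated[OF assms(2) L2_D(2)[OF assms(1)]]) (auto intro!: power_mono assms)

lemma L2_Pair:
  fixes X :: "'w \<Rightarrow> 'a::euclidean_space" and Y :: "'w \<Rightarrow> 'b::euclidean_space"
  assumes "X \<in> L2 N" "Y \<in> L2 N" shows "(\<lambda>x. (X x, Y x)) \<in> L2 N"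
  by (rule L2_dominated[where w="\<lambda>x. (norm (X x))\<^sup>2 + (norm (Y x))\<^sup>2"])
     (use assms in \<open>auto simp: L2_D norm_Pair intro!: borel_measurable_Pair\<close>)

lemma L2_integrable_inner:
  fixes X :: "'w \<Rightarrow> 'a::euclidean_space"
  assumes "X \<in> L2 N" "Y \<in> L2 N" shows "integrable N (\<lambda>x. X x \<bullet> Y x)"
proof (rule Bochner_Integration.integrable_bound)
  show "integrable N (\<lambda>x. (norm (X x))\<^sup>2 + (norm (Y x))\<^sup>2)" using assms by (auto simp: L2_D)
  show "(\<lambda>x. X x \<bullet> Y x) \<in> borel_measurable N" using assms[THEN L2_D(1)] by simp
  show "AE x in N. norm (X x \<bullet> Y x) \<le> norm ((norm (X x))\<^sup>2 + (norm (Y x))\<^sup>2)"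
  proof (intro AE_I2)
    fix x
    have "\<bar>X x \<bullet> Y x\<bar> \<le> norm (X x) * norm (Y x)" by (rule Cauchy_Schwarz_ineq2)
    also have "\<dots> \<le> (norm (X x))\<^sup>2 + (norm (Y x))\<^sup>2"
      using sum_squares_bound[of "norm (X x)" "norm (Y x)"] 
        mult_nonneg_nonneg[OF norm_ge_zero[of "X x"] norm_ge_zero[of "Y x"]] by linarith
    finally show "norm (X x \<bullet> Y x) \<le> norm ((norm (X x))\<^sup>2 + (norm (Y x))\<^sup>2)" by simp
  qed
qed

lemma (in finite_measure) L2_integrable_norm:
  fixes X :: "'a \<Rightarrow> 'b::euclidean_space"
  assumes "X \<in> L2 M" shows "integrable M (\<lambda>x. norm (X x))"
  using L2_D[OF assms] square_integrable_imp_integrable[of "\<lambda>x. norm (X x)"] by simp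

lemma (in finite_measure) L2_integrable:
  fixes X :: "'a \<Rightarrow> 'b::euclidean_space"
  assumes "X \<in> L2 M" shows "integrable M X"
  using L2_integrable_norm[OF assms] L2_D[OF assms] integrable_norm_iff by blast

lemma L2_norm_sq: "(L2_norm N X)\<^sup>2 = (\<integral>x. (norm (X x))\<^sup>2 \<partial>N)"
  unfolding L2_norm_def L2_inner_def by (simp add: dot_square_norm)

lemma L2_norm_nonneg [simp]: "0 \<le> L2_norm N X"
  unfolding L2_norm_def L2_inner_def by (simp add: dot_square_norm)

lemma L2_inner_simps:
  fixes X :: "'w \<Rightarrow> 'a::euclidean_space"
  assumes "X \<in> L2 N" "Y \<in> L2 N" "Z \<in> L2 N"
  shows "L2_inner N (\<lambda>x. X x + Y x) Z = L2_inner N X Z + L2_inner N Y Z"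
    "L2_inner N (\<lambda>x. X x - Y x) Z = L2_inner N X Z - L2_inner N Y Z"
    "L2_inner N Z (\<lambda>x. X x + Y x) = L2_inner N Z X + L2_inner N Z Y"
    "L2_inner N Z (\<lambda>x. X x - Y x) = L2_inner N Z X - L2_inner N Z Y"
  using assms unfolding L2_inner_def
  by (simp_all add: inner_add_left inner_diff_left inner_add_right inner_diff_right L2_integrable_inner)

lemma L2_inner_scaleR:
  "L2_inner N (\<lambda>x. c *\<^sub>R X x) Z = c * L2_inner N X Z"
  "L2_inner N Z (\<lambda>x. c *\<^sub>R X x) = c * L2_inner N Z X"
  unfolding L2_inner_def by simp_all

lemma L2_inner_commute: "L2_inner N X Y = L2_inner N Y X"
  unfolding L2_inner_def by (simp add: inner_commute)

lemma L2_Cauchy_Schwarz: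
  fixes X :: "'w \<Rightarrow> 'a::euclidean_space"
  assumes "X \<in> L2 N" "Y \<in> L2 N"
  shows "\<bar>L2_inner N X Y\<bar> \<le> L2_norm N X * L2_norm N Y"
proof -
  define a b c where "a = L2_inner N X X" and "b = L2_inner N X Y" and "c = L2_inner N Y Y"
  have c0: "0 \<le> c" and a0: "0 \<le> a" unfolding c_def a_def L2_inner_def by auto
  have quad: "0 \<le> a - 2 * s * b + s\<^sup>2 * c" for s
  proof -
    let ?Z = "\<lambda>x. X x - s *\<^sub>R Y x"
    have Z: "?Z \<in> L2 N" "(\<lambda>x. s *\<^sub>R Y x) \<in> L2 N" by (intro L2_diff L2_scaleR assms)+
    have "0 \<le> L2_inner N ?Z ?Z" unfolding L2_inner_def by auto
    also have "\<dots> = a - 2 * s * b + s\<^sup>2 * c"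
      using L2_inner_commute[of N Y X]
      by (simp add: L2_inner_simps L2_inner_scaleR assms Z a_def b_def c_def algebra_simps power2_eq_square)
    finally show ?thesis .
  qed
  have "b\<^sup>2 \<le> a * c"
  proof (cases "c = 0")
    case True
    have "b = 0"
    proof (rule ccontr)
      assume "b \<noteq> 0"
      with quad[of "(a + 1) / (2 * b)"] True show False by simp
    qed
    thus ?thesis using True by simp
  next
    case False
    have "0 \<le> a - b\<^sup>2 / c"
      using quad[of "b / c"] False by (simp add: power2_eq_square)
    thus ?thesis using False c0 by (simp add: field_simps)
  qed
  hence "sqrt (b\<^sup>2) \<le> sqrt (a * c)" by (rule real_sqrt_le_mono)
  thus ?thesis unfolding L2_norm_def by (simp add: a_def b_def c_def real_sqrt_mult)
qed

lemma L2_norm_triangle: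
  fixes X :: "'w \<Rightarrow> 'a::euclidean_space"
  assumes "X \<in> L2 N" "Y \<in> L2 N"
  shows "L2_norm N (\<lambda>x. X x + Y x) \<le> L2_norm N X + L2_norm N Y"
proof (rule power2_le_imp_le)
  have sq: "(L2_norm N Z)\<^sup>2 = L2_inner N Z Z" for Z :: "'w \<Rightarrow> 'a"
    unfolding L2_norm_def by (simp add: L2_inner_def)
  have "(L2_norm N (\<lambda>x. X x + Y x))\<^sup>2 = L2_inner N X X + 2 * L2_inner N X Y + L2_inner N Y Y"
    unfolding sq using L2_inner_commute[of N Y X] by (simp add: L2_inner_simps L2_add assms)
  also have "\<dots> \<le> (L2_norm N X + L2_norm N Y)\<^sup>2"
    using L2_Cauchy_Schwarz[OF assms] by (simp add: sq[symmetric] power2_sum)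
  finally show "(L2_norm N (\<lambda>x. X x + Y x))\<^sup>2 \<le> (L2_norm N X + L2_norm N Y)\<^sup>2" .
qed simp

lemma L2_norm_minus_commute: 
  fixes X :: "'w \<Rightarrow> 'a::euclidean_space"
  shows "L2_norm N (\<lambda>x. X x - Y x) = L2_norm N (\<lambda>x. Y x - X x)"
  by (simp add: L2_norm_def L2_inner_def inner_diff_left inner_diff_right algebra_simps inner_commute)

lemma L2_norm_triangle_via:
  fixes X :: "'w \<Rightarrow> 'a::euclidean_space"
  assumes "X \<in> L2 N" "Y \<in> L2 N" "Z \<in> L2 N"
  shows "L2_norm N (\<lambda>x. X x - Z x) \<le> L2_norm N (\<lambda>x. X x - Y x) + L2_norm N (\<lambda>x. Y x - Z x)"
  using L2_norm_triangle[OF L2_diff[OF assms(1,2)] L2_diff[OF assms(2,3)]] by simp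

lemma L2_norm_scaleR:
  fixes X :: "'w \<Rightarrow> 'a::euclidean_space"
  shows "L2_norm N (\<lambda>x. c *\<^sub>R X x) = \<bar>c\<bar> * L2_norm N X"
  by (simp add: L2_norm_def L2_inner_scaleR real_sqrt_mult flip: mult.assoc power2_eq_square)

lemma L2_norm_tendsto_zero:
  fixes X :: "nat \<Rightarrow> 'w \<Rightarrow> 'a::euclidean_space"
  assumes X: "\<And>n. X n \<in> borel_measurable N" and w: "integrable N w"
    and dom: "\<And>n. AE x in N. (norm (X n x))\<^sup>2 \<le> w x"
    and lim: "AE x in N. (\<lambda>n. X n x) \<longlonglongrightarrow> 0"
  shows "(\<lambda>n. L2_norm N (X n)) \<longlonglongrightarrow> 0"
proof -
  have "(\<lambda>n. \<integral>x. (norm (X n x))\<^sup>2 \<partial>N) \<longlonglongrightarrow> (\<integral>x. 0 \<partial>N)"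
  proof (rule integral_dominated_convergence[where w=w])
    show "AE x in N. (\<lambda>n. (norm (X n x))\<^sup>2) \<longlonglongrightarrow> 0"
      using lim by eventually_elim (auto intro!: tendsto_eq_intros)
  qed (use X w dom in auto)
  hence "(\<lambda>n. sqrt ((L2_norm N (X n))\<^sup>2)) \<longlonglongrightarrow> sqrt 0"
    unfolding L2_norm_sq by (intro tendsto_real_sqrt) simp
  thus ?thesis by simp
qed

lemma L2_inner_cong_AE:
  fixes X :: "'w \<Rightarrow> 'a::euclidean_space"
  assumes "X \<in> borel_measurable N" "X' \<in> borel_measurable N" "Y \<in> borel_measurable N" "Y' \<in> borel_measurable N"
    "AE x in N. X x = X' x" "AE x in N. Y x = Y' x"
  shows "L2_inner N X Y = L2_inner N X' Y'"
  unfolding L2_inner_def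
  by (rule integral_cong_AE) (use assms in auto)

lemma (in prob_space) law_in_P2:
  fixes X :: "'a \<Rightarrow> 'b::euclidean_space"
  assumes "X \<in> L2 M" shows "law M X \<in> P2"
  using L2_D[OF assms] prob_space_distr[of X borel] by (simp add: P2_def integrable_distr_eq)

text \<open>
The joint law of \<open>X\<close> and \<open>Y\<close> is one of the couplings over which the infimum is taken.
\<close>

lemma (in prob_space) W2_law_le:
  fixes X Y :: "'a \<Rightarrow> 'b::euclidean_space"
  assumes "X \<in> L2 M" "Y \<in> L2 M"
  shows "W2 (law M X) (law M Y) \<le> L2_norm M (\<lambda>x. X x - Y x)"
proof -
  note [measurable] = L2_D(1)[OF assms(1)] L2_D(1)[OF assms(2)]
  let ?p = "distr M borel (\<lambda>x. (X x, Y x))"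
  have m: "(\<lambda>x. (X x, Y x)) \<in> borel_measurable M" by (simp add: borel_prod[symmetric])
  have f: "(fst :: 'b \<times> 'b \<Rightarrow> 'b) \<in> borel_measurable borel" "(snd :: 'b \<times> 'b \<Rightarrow> 'b) \<in> borel_measurable borel" 
    by (simp_all add: borel_prod[symmetric])
  have c: "?p \<in> couplings (law M X) (law M Y)"
    using m f by (simp add: couplings_def distr_distr comp_def)
  have "(INF \<pi>\<in>couplings (law M X) (law M Y). \<integral>\<^sup>+ z. ennreal ((dist (fst z) (snd z))\<^sup>2) \<partial>\<pi>)
      \<le> (\<integral>\<^sup>+ z. ennreal ((dist (fst z) (snd z))\<^sup>2) \<partial>?p)" by (rule INF_lower[OF c])
  also have "\<dots> = (\<integral>\<^sup>+ x. ennreal ((norm (X x - Y x))\<^sup>2) \<partial>M)"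
    using m f by (subst nn_integral_distr) (auto simp: dist_norm)
  also have "\<dots> = ennreal ((L2_norm M (\<lambda>x. X x - Y x))\<^sup>2)"
    unfolding L2_norm_sq using L2_D(2)[OF L2_diff[OF assms]]
    by (intro nn_integral_eq_integral) auto
  finally have "enn2real (INF \<pi>\<in>couplings (law M X) (law M Y). \<integral>\<^sup>+ z. ennreal ((dist (fst z) (snd z))\<^sup>2) \<partial>\<pi>)
     \<le> enn2real (ennreal ((L2_norm M (\<lambda>x. X x - Y x))\<^sup>2))"
    by (intro enn2real_mono) auto
  hence "W2 (law M X) (law M Y) \<le> sqrt (enn2real (ennreal ((L2_norm M (\<lambda>x. X x - Y x))\<^sup>2)))"
    unfolding W2_def by (rule real_sqrt_le_mono)
  thus ?thesis by simp
qed

lemma W2_nonneg: "0 \<le> W2 \<mu> \<nu>" by (simp add: W2_def)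

lemma W2_refl:
  fixes \<mu> :: "'b::euclidean_space measure"
  assumes "\<mu> \<in> P2" shows "W2 \<mu> \<mu> = 0"
proof -
  interpret prob_space \<mu> using assms by (simp add: P2_def)
  have s: "sets \<mu> = sets borel" using assms by (simp add: P2_def)
  have id: "(\<lambda>x. x) \<in> borel_measurable \<mu>" using s by (simp add: measurable_def sets_eq_imp_space_eq[OF s])
  have "(\<lambda>x. x) \<in> L2 \<mu>" using assms id by (simp add: L2_def P2_def)
  moreover have "law \<mu> (\<lambda>x. x) = \<mu>" using s by (simp add: distr_id2)
  ultimately have "W2 \<mu> \<mu> \<le> L2_norm \<mu> (\<lambda>x. x - x :: 'b)" using W2_law_le[of "\<lambda>x. x" "\<lambda>x. x"] by simp
  thus ?thesis using W2_nonneg[of \<mu> \<mu>] by (simp add: L2_norm_def L2_inner_def)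
qed

section \<open>Measurability along a flow of laws\<close>

text \<open>
Separability of the range is phrased by a countable approximating set inside \<^const>\<open>L2\<close> itself:
only the range of the curve \<open>Y\<close> is separable, the whole space over \<open>M\<close> need not be.
\<close>

definition L2_separable :: "'w measure \<Rightarrow> ('t \<Rightarrow> 'w \<Rightarrow> 'a::euclidean_space) \<Rightarrow> 't set \<Rightarrow> bool" where
  "L2_separable M Y G \<longleftrightarrow>
     (\<exists>D. countable D \<and> D \<subseteq> L2 M \<and> (\<forall>t\<in>G. \<forall>e>0. \<exists>X\<in>D. L2_norm M (\<lambda>\<omega>. Y t \<omega> - X \<omega>) < e))"

lemma L2_separableE:
  assumes "L2_separable M Y G"
  obtains D where "countable D" "D \<subseteq> L2 M"
    "\<And>t e. t \<in> G \<Longrightarrow> e > 0 \<Longrightarrow> \<exists>X\<in>D. L2_norm M (\<lambda>\<omega>. Y t \<omega> - X \<omega>) < e"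
  using assms unfolding L2_separable_def by meson

lemma L2_separable_const:
  fixes X :: "'w \<Rightarrow> 'a::euclidean_space"
  assumes "X \<in> L2 M" shows "L2_separable M (\<lambda>t. X) G"
  unfolding L2_separable_def using assms
  by (intro exI[of _ "{X}"]) (auto simp: L2_norm_def L2_inner_def)

lemma L2_separable_limit:
  fixes Y :: "'t \<Rightarrow> 'w \<Rightarrow> 'a::euclidean_space"
  assumes sep: "\<And>n. L2_separable M (Z n) G"
    and Y: "\<And>t. t \<in> G \<Longrightarrow> Y t \<in> L2 M" and Z: "\<And>n t. t \<in> G \<Longrightarrow> Z n t \<in> L2 M"
    and lim: "\<And>t. t \<in> G \<Longrightarrow> (\<lambda>n. L2_norm M (\<lambda>\<omega>. Y t \<omega> - Z n t \<omega>)) \<longlonglongrightarrow> 0"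
  shows "L2_separable M Y G"
proof -
  obtain D where D: "\<And>n. countable (D n)" "\<And>n. D n \<subseteq> L2 M"
    "\<And>n t e. t \<in> G \<Longrightarrow> e > 0 \<Longrightarrow> \<exists>X\<in>D n. L2_norm M (\<lambda>\<omega>. Z n t \<omega> - X \<omega>) < e"
    using sep unfolding L2_separable_def by metis
  have "\<exists>X\<in>(\<Union>n. D n). L2_norm M (\<lambda>\<omega>. Y t \<omega> - X \<omega>) < e" if t: "t \<in> G" and e: "e > 0" for t e
  proof -
    have "\<forall>\<^sub>F n in sequentially. L2_norm M (\<lambda>\<omega>. Y t \<omega> - Z n t \<omega>) < e / 2"
      using order_tendstoD(2)[OF lim[OF t], of "e/2"] e by simp
    then obtain n where n: "L2_norm M (\<lambda>\<omega>. Y t \<omega> - Z n t \<omega>) < e / 2"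
      by (auto simp: eventually_sequentially)
    obtain X where X: "X \<in> D n" "L2_norm M (\<lambda>\<omega>. Z n t \<omega> - X \<omega>) < e / 2"
      using D(3)[OF t, of "e/2" n] e by auto
    have "L2_norm M (\<lambda>\<omega>. Y t \<omega> - X \<omega>) < e"
      using L2_norm_triangle_via[OF Y[OF t] Z[OF t, of n], of X] X(2) subsetD[OF D(2) X(1)] n by fastforce
    thus ?thesis using X by auto
  qed
  moreover have "countable (\<Union>n. D n)" "(\<Union>n. D n) \<subseteq> L2 M" using D(1,2) by auto
  ultimately show ?thesis unfolding L2_separable_def
    by (intro exI[of _ "\<Union>n. D n"]) blast
qed

lemma L2_separable_add:
  fixes Y Z :: "'t \<Rightarrow> 'w \<Rightarrow> 'a::euclidean_space"
  assumes "L2_separable M Y G" "L2_separable M Z G"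
    and Y: "\<And>t. t \<in> G \<Longrightarrow> Y t \<in> L2 M" and Z: "\<And>t. t \<in> G \<Longrightarrow> Z t \<in> L2 M"
  shows "L2_separable M (\<lambda>t \<omega>. Y t \<omega> + Z t \<omega>) G"
proof -
  obtain D where D: "countable D" "D \<subseteq> L2 M" "\<And>t e. t \<in> G \<Longrightarrow> e > 0 \<Longrightarrow> \<exists>X\<in>D. L2_norm M (\<lambda>\<omega>. Y t \<omega> - X \<omega>) < e"
    using assms(1) by (rule L2_separableE) blast
  obtain E where E: "countable E" "E \<subseteq> L2 M" "\<And>t e. t \<in> G \<Longrightarrow> e > 0 \<Longrightarrow> \<exists>X\<in>E. L2_norm M (\<lambda>\<omega>. Z t \<omega> - X \<omega>) < e"
    using assms(2) by (rule L2_separableE) blast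
  let ?S = "(\<lambda>(X, X') \<omega>. X \<omega> + X' \<omega>) ` (D \<times> E)"
  have "\<exists>X\<in>?S. L2_norm M (\<lambda>\<omega>. Y t \<omega> + Z t \<omega> - X \<omega>) < e" if t: "t \<in> G" and e: "e > 0" for t e
  proof -
    obtain X X' where X: "X \<in> D" "L2_norm M (\<lambda>\<omega>. Y t \<omega> - X \<omega>) < e / 2"
      and X': "X' \<in> E" "L2_norm M (\<lambda>\<omega>. Z t \<omega> - X' \<omega>) < e / 2"
      using D(3)[OF t, of "e/2"] E(3)[OF t, of "e/2"] e by auto
    have m: "X \<in> L2 M" "X' \<in> L2 M" using X X' D E by auto
    have "L2_norm M (\<lambda>\<omega>. (Y t \<omega> - X \<omega>) + (Z t \<omega> - X' \<omega>)) < e"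
      using L2_norm_triangle[OF L2_diff[OF Y[OF t] m(1)] L2_diff[OF Z[OF t] m(2)]] X X' by linarith
    hence "L2_norm M (\<lambda>\<omega>. Y t \<omega> + Z t \<omega> - (\<lambda>\<omega>. X \<omega> + X' \<omega>) \<omega>) < e" by (simp add: algebra_simps)
    thus ?thesis using X(1) X'(1) by (intro bexI[of _ "\<lambda>\<omega>. X \<omega> + X' \<omega>"]) auto
  qed
  thus ?thesis unfolding L2_separable_def using D E
    by (intro exI[of _ ?S]) (auto intro!: L2_add)
qed

lemma L2_separable_scaleR:
  fixes Y :: "'t \<Rightarrow> 'w \<Rightarrow> real" and c :: "'a::euclidean_space"
  assumes "L2_separable M Y G"
  shows "L2_separable M (\<lambda>t \<omega>. Y t \<omega> *\<^sub>R c) G"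
proof -
  obtain D where D: "countable D" "D \<subseteq> L2 M" "\<And>t e. t \<in> G \<Longrightarrow> e > 0 \<Longrightarrow> \<exists>X\<in>D. L2_norm M (\<lambda>\<omega>. Y t \<omega> - X \<omega>) < e"
    using assms(1) by (rule L2_separableE) blast
  let ?S = "(\<lambda>X \<omega>. X \<omega> *\<^sub>R c) ` D"
  have S: "?S \<subseteq> L2 M"
    using D(2) by (auto simp: L2_def power_mult_distrib)
  have nrm: "L2_norm M (\<lambda>\<omega>. Y t \<omega> *\<^sub>R c - X \<omega> *\<^sub>R c) = L2_norm M (\<lambda>\<omega>. Y t \<omega> - X \<omega>) * norm c" for t X
    by (simp add: L2_norm_def L2_inner_def real_sqrt_mult norm_eq_sqrt_inner flip: scaleR_diff_left mult.assoc)
  have "\<exists>X\<in>?S. L2_norm M (\<lambda>\<omega>. Y t \<omega> *\<^sub>R c - X \<omega>) < e" if t: "t \<in> G" and e: "e > 0" for t e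
  proof -
    have p: "1 + norm c > 0" by (simp add: add_pos_nonneg)
    then obtain X where X: "X \<in> D" "L2_norm M (\<lambda>\<omega>. Y t \<omega> - X \<omega>) < e / (1 + norm c)"
      using D(3)[OF t, of "e / (1 + norm c)"] e by auto
    have "L2_norm M (\<lambda>\<omega>. Y t \<omega> - X \<omega>) * norm c \<le> L2_norm M (\<lambda>\<omega>. Y t \<omega> - X \<omega>) * (1 + norm c)"
      by (intro mult_left_mono) auto
    also have "\<dots> < e" using X(2) p by (simp add: field_simps)
    finally show ?thesis using X(1) nrm by auto
  qed
  thus ?thesis unfolding L2_separable_def using D(1) S
    by (intro exI[of _ ?S]) auto
qed

lemma L2_separable_sum:
  fixes Y :: "'i \<Rightarrow> 't \<Rightarrow> 'w \<Rightarrow> 'a::euclidean_space"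
  assumes "\<And>i. i \<in> I \<Longrightarrow> L2_separable M (Y i) G"
    and Y: "\<And>i t. i \<in> I \<Longrightarrow> t \<in> G \<Longrightarrow> Y i t \<in> L2 M"
  shows "L2_separable M (\<lambda>t \<omega>. \<Sum>i\<in>I. Y i t \<omega>) G"
  using assms
  by (induction I rule: infinite_finite_induct)
     (auto intro!: L2_separable_const L2_zero L2_separable_add L2_sum)

text \<open>
For a rectangle the sections take two values only. The property survives complements and countable
disjoint unions, so it holds on the product \<open>\<sigma>\<close>-algebra by Dynkin's theorem.
\<close>

lemma (in prob_space) L2_separable_indicator:
  assumes "A \<in> sets (N \<Otimes>\<^sub>M M)"
  shows "L2_separable M (\<lambda>t \<omega>. indicat_real A (t, \<omega>)) (space N)"
proof -
  have L2ind: "(\<lambda>\<omega>. indicat_real A (t, \<omega>)) \<in> L2 M" if "A \<in> sets (N \<Otimes>\<^sub>M M)" "t \<in> space N" for A t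
    using that by (intro L2_bounded[where c=1]) auto
  have "A \<in> sigma_sets (space N \<times> space M) {a \<times> b |a b. a \<in> sets N \<and> b \<in> sets M}"
    using assms by (simp add: sets_pair_measure)
  from Int_stable_pair_measure_generator pair_measure_closed this show ?thesis
  proof (induction rule: sigma_sets_induct_disjoint)
    case (basic A)
    then obtain a b where A: "A = a \<times> b" and ab: "a \<in> sets N" "b \<in> sets M" by auto
    let ?D = "{(\<lambda>\<omega>. 0), indicat_real b}"
    have "\<exists>X\<in>?D. L2_norm M (\<lambda>\<omega>. indicat_real A (t, \<omega>) - X \<omega>) < e" if "e > 0" for t e
    proof -
      have eq: "indicat_real A (t, \<omega>) = (if t \<in> a then indicat_real b \<omega> else 0)" for \<omega>
        by (simp add: A indicator_def)
      show ?thesis using that unfolding eq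
        by (cases "t \<in> a") (auto simp: L2_norm_def L2_inner_def)
    qed
    moreover have "?D \<subseteq> L2 M" using ab by (auto intro!: L2_zero L2_bounded[where c=1])
    ultimately show ?case unfolding L2_separable_def by (intro exI[of _ ?D]) auto
  next
    case empty
    show ?case by (auto intro: L2_separable_const L2_zero)
  next
    case (compl A)
    have A: "A \<in> sets (N \<Otimes>\<^sub>M M)" using compl by (simp add: sets_pair_measure)
    have "L2_separable M (\<lambda>t \<omega>. indicat_real (space N \<times> space M) (t, \<omega>) + indicat_real A (t, \<omega>) *\<^sub>R (-1)) (space N)"
    proof (rule L2_separable_add)
      have "L2_separable M (\<lambda>t. indicat_real (space M)) (space N)"
        by (intro L2_separable_const L2_bounded[where c=1]) auto
      thus "L2_separable M (\<lambda>t \<omega>. indicat_real (space N \<times> space M) (t, \<omega>)) (space N)"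
        unfolding L2_separable_def by (simp add: indicator_times)
      show "L2_separable M (\<lambda>t \<omega>. indicat_real A (t, \<omega>) *\<^sub>R - 1) (space N)"
        by (rule L2_separable_scaleR[OF compl.IH])
    qed (use L2ind[OF A] L2_minus[OF L2ind[OF A]] L2ind[OF sets.top] in \<open>auto simp: space_pair_measure\<close>)
    moreover have "indicat_real (space N \<times> space M) x + indicat_real A x *\<^sub>R (-1) = indicat_real (space N \<times> space M - A) x" for x
      using sets.sets_into_space[OF A] by (auto simp: indicator_def space_pair_measure)
    ultimately show ?case by simp
  next
    case (union A)
    have A: "A i \<in> sets (N \<Otimes>\<^sub>M M)" for i using union.hyps(2) by (auto simp: sets_pair_measure)
    have U: "(\<Union>i. A i) \<in> sets (N \<Otimes>\<^sub>M M)" using A by auto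
    show ?case
    proof (rule L2_separable_limit[where Z="\<lambda>n t \<omega>. \<Sum>i<n. indicat_real (A i) (t, \<omega>)"])
      show "L2_separable M (\<lambda>t \<omega>. \<Sum>i<n. indicat_real (A i) (t, \<omega>)) (space N)" for n
        using union.IH L2ind[OF A] by (intro L2_separable_sum) auto
      show "(\<lambda>\<omega>. indicat_real (\<Union>i. A i) (t, \<omega>)) \<in> L2 M" if "t \<in> space N" for t
        by (intro L2ind[OF U] that)
      show Zn: "(\<lambda>\<omega>. \<Sum>i<n. indicat_real (A i) (t, \<omega>)) \<in> L2 M" if "t \<in> space N" for n t
        by (intro L2_sum L2ind[OF A] that)
      show "(\<lambda>n. L2_norm M (\<lambda>\<omega>. indicat_real (\<Union>i. A i) (t, \<omega>) - (\<Sum>i<n. indicat_real (A i) (t, \<omega>)))) \<longlonglongrightarrow> 0"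
        if t: "t \<in> space N" for t
      proof (rule L2_norm_tendsto_zero[where w="\<lambda>_. 1"])
        have eq: "indicat_real (\<Union>i. A i) x - (\<Sum>i<n. indicat_real (A i) x) = indicat_real ((\<Union>i. A i) - (\<Union>i<n. A i)) x" for n x
        proof -
          have "(\<Sum>i<n. indicat_real (A i) x) = indicat_real (\<Union>i<n. A i) x"
            using union.hyps(1) by (intro indicator_UN_disjoint[symmetric])
              (auto simp: disjoint_family_on_def)
          thus ?thesis by (auto simp: indicator_def)
        qed
        show "AE x in M. (norm (indicat_real (\<Union>i. A i) (t, x) - (\<Sum>i<n. indicat_real (A i) (t, x))))\<^sup>2 \<le> 1" for n
          unfolding eq by (auto simp: indicator_def)
        show "(\<lambda>\<omega>. indicat_real (\<Union>i. A i) (t, \<omega>) - (\<Sum>i<n. indicat_real (A i) (t, \<omega>))) \<in> borel_measurable M" for n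
          by (intro L2_D(1) L2_diff L2ind[OF U] Zn t)
        have "(\<lambda>n. indicat_real (\<Union>i. A i) (t, x) - (\<Sum>i<n. indicat_real (A i) (t, x))) \<longlonglongrightarrow> 0" for x
        proof -
          have "\<forall>\<^sub>F n in sequentially. indicat_real ((\<Union>i. A i) - (\<Union>i<n. A i)) (t, x) = 0"
          proof (cases "\<exists>i. (t, x) \<in> A i")
            case True
            then obtain i where "(t, x) \<in> A i" by auto
            thus ?thesis
              by (intro eventually_sequentiallyI[of "Suc i"]) (auto simp: indicator_def)
          qed (auto simp: indicator_def)
          thus ?thesis unfolding eq by (rule tendsto_eventually)
        qed
        thus "AE x in M. (\<lambda>n. indicat_real (\<Union>i. A i) (t, x) - (\<Sum>i<n. indicat_real (A i) (t, x))) \<longlonglongrightarrow> 0"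
          by auto
      qed auto
    qed
  qed
qed

lemma L2_separable_subset: "L2_separable M Y G \<Longrightarrow> G' \<subseteq> G \<Longrightarrow> L2_separable M Y G'"
  unfolding L2_separable_def by (meson subsetD)

text \<open>
Simple functions inherit separability from indicators, and a measurable process is a limit of simple
functions that are dominated by it at each time.
\<close>

lemma (in prob_space) L2_separable_process:
  fixes Y :: "'t \<Rightarrow> 'a \<Rightarrow> 'b::euclidean_space"
  assumes Y: "case_prod Y \<in> borel_measurable (N \<Otimes>\<^sub>M M)" and G: "G \<subseteq> space N"
    and L2: "\<And>t. t \<in> G \<Longrightarrow> Y t \<in> L2 M"
  shows "L2_separable M Y G"
proof -
  obtain s where s: "\<And>i. simple_function (N \<Otimes>\<^sub>M M) (s i)"
    and lim: "\<And>x. x \<in> space (N \<Otimes>\<^sub>M M) \<Longrightarrow> (\<lambda>i. s i x) \<longlonglongrightarrow> case_prod Y x"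
    and bd: "\<And>i x. x \<in> space (N \<Otimes>\<^sub>M M) \<Longrightarrow> dist (s i x) 0 \<le> 2 * dist (case_prod Y x) 0"
    using borel_measurable_implies_sequence_metric[OF Y, of 0] by blast
  have sm: "s i \<in> borel_measurable (N \<Otimes>\<^sub>M M)" for i using s borel_measurable_simple_function by blast
  have sL2: "(\<lambda>\<omega>. s n (t, \<omega>)) \<in> L2 M" if "t \<in> G" for n t
  proof (rule L2_dominated[where w="\<lambda>\<omega>. 4 * (norm (Y t \<omega>))\<^sup>2"])
    show "(\<lambda>\<omega>. s n (t, \<omega>)) \<in> borel_measurable M" using sm[of n] that G by (intro measurable_Pair2) auto
    show "AE \<omega> in M. (norm (s n (t, \<omega>)))\<^sup>2 \<le> 4 * (norm (Y t \<omega>))\<^sup>2"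
    proof (rule AE_I2)
      fix \<omega> assume "\<omega> \<in> space M"
      hence "(norm (s n (t, \<omega>)))\<^sup>2 \<le> (2 * norm (Y t \<omega>))\<^sup>2"
        using bd[of "(t, \<omega>)" n] that G by (intro power_mono) (auto simp: space_pair_measure)
      thus "(norm (s n (t, \<omega>)))\<^sup>2 \<le> 4 * (norm (Y t \<omega>))\<^sup>2" by (simp add: power_mult_distrib)
    qed
  qed (use L2_D(2)[OF L2[OF that]] in auto)
  show ?thesis
  proof (rule L2_separable_limit[where Z="\<lambda>n t \<omega>. s n (t, \<omega>)"])
    fix n
    let ?P = "N \<Otimes>\<^sub>M M" and ?c = "\<lambda>y. s n -` {y} \<inter> space (N \<Otimes>\<^sub>M M)"
    have cm: "?c y \<in> sets ?P" for y using simple_functionD(2)[OF s] .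
    have "L2_separable M (\<lambda>t \<omega>. \<Sum>y\<in>s n ` space ?P. indicat_real (?c y) (t, \<omega>) *\<^sub>R y) G"
    proof (rule L2_separable_sum)
      fix y
      show "L2_separable M (\<lambda>t \<omega>. indicat_real (?c y) (t, \<omega>) *\<^sub>R y) G"
        by (rule L2_separable_scaleR[OF L2_separable_subset[OF L2_separable_indicator[OF cm] G]])
      show "(\<lambda>\<omega>. indicat_real (?c y) (t, \<omega>) *\<^sub>R y) \<in> L2 M" if "t \<in> G" for t
        using that G measurable_Pair2[OF borel_measurable_indicator[OF cm[of y]], of t]
        by (intro L2_bounded[where c="norm y"] borel_measurable_scaleR) (auto simp: indicator_def)
    qed
    then obtain D where D: "countable D" "D \<subseteq> L2 M"
      "\<And>t e. t \<in> G \<Longrightarrow> e > 0 \<Longrightarrow> \<exists>X\<in>D. L2_norm M (\<lambda>\<omega>. (\<Sum>y\<in>s n ` space ?P. indicat_real (?c y) (t, \<omega>) *\<^sub>R y) - X \<omega>) < e"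
      by (rule L2_separableE) blast
    have eq: "(\<Sum>y\<in>s n ` space ?P. indicat_real (?c y) (t, \<omega>) *\<^sub>R y) = s n (t, \<omega>)" if "t \<in> G" "\<omega> \<in> space M" for t \<omega>
    proof -
      have x: "(t, \<omega>) \<in> space ?P" using that G by (auto simp: space_pair_measure)
      have "(\<Sum>y\<in>s n ` space ?P. indicat_real (?c y) (t, \<omega>) *\<^sub>R y) = (\<Sum>y\<in>{s n (t, \<omega>)}. indicat_real (?c y) (t, \<omega>) *\<^sub>R y)"
        using x simple_functionD(1)[OF s] by (intro sum.mono_neutral_right) (auto simp: indicator_def)
      thus ?thesis using x by simp
    qed
    have "L2_norm M (\<lambda>\<omega>. (\<Sum>y\<in>s n ` space ?P. indicat_real (?c y) (t, \<omega>) *\<^sub>R y) - X \<omega>) 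
        = L2_norm M (\<lambda>\<omega>. s n (t, \<omega>) - X \<omega>)" if "t \<in> G" for t X
      unfolding L2_norm_def L2_inner_def
      by (intro arg_cong[where f=sqrt] Bochner_Integration.integral_cong) (simp_all add: eq[OF that])
    thus "L2_separable M (\<lambda>t \<omega>. s n (t, \<omega>)) G"
      unfolding L2_separable_def using D by (intro exI[of _ D]) auto
  next
    fix t assume t: "t \<in> G"
    show "(\<lambda>n. L2_norm M (\<lambda>\<omega>. Y t \<omega> - s n (t, \<omega>))) \<longlonglongrightarrow> 0"
    proof (rule L2_norm_tendsto_zero[where w="\<lambda>\<omega>. 9 * (norm (Y t \<omega>))\<^sup>2"])
      show "(\<lambda>\<omega>. Y t \<omega> - s n (t, \<omega>)) \<in> borel_measurable M" for n
        by (intro L2_D(1) L2_diff L2 sL2 t)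
      show "AE x in M. (norm (Y t x - s n (t, x)))\<^sup>2 \<le> 9 * (norm (Y t x))\<^sup>2" for n
      proof (rule AE_I2)
        fix \<omega> assume "\<omega> \<in> space M"
        hence "norm (s n (t, \<omega>)) \<le> 2 * norm (Y t \<omega>)"
          using bd[of "(t, \<omega>)" n] t G by (auto simp: space_pair_measure)
        hence "norm (Y t \<omega> - s n (t, \<omega>)) \<le> 3 * norm (Y t \<omega>)"
          using norm_triangle_ineq4[of "Y t \<omega>" "s n (t, \<omega>)"] by linarith
        hence "(norm (Y t \<omega> - s n (t, \<omega>)))\<^sup>2 \<le> (3 * norm (Y t \<omega>))\<^sup>2" by (intro power_mono) auto
        thus "(norm (Y t \<omega> - s n (t, \<omega>)))\<^sup>2 \<le> 9 * (norm (Y t \<omega>))\<^sup>2" by (simp add: power_mult_distrib)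
      qed
      show "AE x in M. (\<lambda>n. Y t x - s n (t, x)) \<longlonglongrightarrow> 0"
      proof (rule AE_I2)
        fix \<omega> assume "\<omega> \<in> space M"
        hence "(\<lambda>i. s i (t, \<omega>)) \<longlonglongrightarrow> Y t \<omega>"
          using lim[of "(t, \<omega>)"] t G by (auto simp: space_pair_measure)
        from tendsto_diff[OF tendsto_const this, of "Y t \<omega>"]
        show "(\<lambda>n. Y t \<omega> - s n (t, \<omega>)) \<longlonglongrightarrow> 0" by simp
      qed
    qed (use L2_D(2)[OF L2[OF t]] in auto)
  qed (use L2 sL2 in auto)
qed

text \<open>
Two classical facts are combined: a function measurable in \<open>z\<close> and continuous in \<open>m\<close> is jointly
measurable, and the law of \<open>Y\<^sub>t\<close> is a \<open>W\<^sub>2\<close>-limit of laws that take countably many values as \<open>t\<close> varies.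
Measurable selection is not an issue, because the least index of a good enough approximation is a
measurable function of \<open>t\<close> by Fubini's theorem.
\<close>

lemma (in prob_space) measurable_along_law_flow:
  fixes F :: "'c::euclidean_space \<Rightarrow> 'b::euclidean_space measure \<Rightarrow> 'e::euclidean_space"
  assumes Y: "case_prod Y \<in> borel_measurable (N \<Otimes>\<^sub>M M)" and G: "G \<in> sets N"
    and L2: "\<And>t. t \<in> G \<Longrightarrow> Y t \<in> L2 M"
    and Z: "Z \<in> borel_measurable (N \<Otimes>\<^sub>M M)"
    and Fm: "\<And>m. m \<in> P2 \<Longrightarrow> (\<lambda>z. F z m) \<in> borel_measurable borel"
    and Fc: "\<And>z m e. m \<in> P2 \<Longrightarrow> e > 0 \<Longrightarrow> \<exists>d>0. \<forall>m'\<in>P2. W2 m m' < d \<longrightarrow> dist (F z m) (F z m') < e"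
  shows "(\<lambda>(t, \<omega>). if t \<in> G then F (Z (t, \<omega>)) (law M (Y t)) else 0) \<in> borel_measurable (N \<Otimes>\<^sub>M M)"
proof -
  note [measurable] = G Z Y
  have "L2_separable M Y G" using L2_separable_process[OF Y sets.sets_into_space[OF G] L2] by blast
  then obtain D where D: "countable D" "D \<subseteq> L2 M"
    "\<And>t e. t \<in> G \<Longrightarrow> e > 0 \<Longrightarrow> \<exists>X\<in>D. L2_norm M (\<lambda>\<omega>. Y t \<omega> - X \<omega>) < e"
    by (rule L2_separableE) blast
  \<comment> \<open>only a nonempty set can be enumerated, and \<open>D\<close> may be empty when \<open>G\<close> is\<close>
  define \<xi> where "\<xi> = from_nat_into (insert (\<lambda>_. 0) D)"
  have rng: "range \<xi> = insert (\<lambda>_. 0) D" unfolding \<xi>_def using D(1) by (intro range_from_nat_into) auto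
  have \<xi>: "\<xi> i \<in> L2 M" for i using rng D(2) L2_zero[of M] by (metis insertE rangeI subsetD)
  have [measurable]: "\<xi> i \<in> borel_measurable M" for i by (rule L2_D(1)[OF \<xi>])
  define j where "j k t = (LEAST i. L2_norm M (\<lambda>\<omega>. Y t \<omega> - \<xi> i \<omega>) < 1 / real (Suc k))" for k t
  have [measurable]: "(\<lambda>t. L2_norm M (\<lambda>\<omega>. Y t \<omega> - \<xi> i \<omega>)) \<in> borel_measurable N" for i
    unfolding L2_norm_def L2_inner_def by measurable
  have [measurable]: "j k \<in> measurable N (count_space UNIV)" for k
    unfolding j_def by measurable
  have j: "L2_norm M (\<lambda>\<omega>. Y t \<omega> - \<xi> (j k t) \<omega>) < 1 / real (Suc k)" if tG: "t \<in> G" for t k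
  proof -
    obtain X where "X \<in> D" "L2_norm M (\<lambda>\<omega>. Y t \<omega> - X \<omega>) < 1 / real (Suc k)"
      using D(3)[OF tG, of "1 / real (Suc k)"] by auto
    moreover then have "X \<in> range \<xi>" using rng by auto
    then obtain i where "X = \<xi> i" by auto
    ultimately have "L2_norm M (\<lambda>\<omega>. Y t \<omega> - \<xi> i \<omega>) < 1 / real (Suc k)" by simp
    thus ?thesis unfolding j_def by (rule LeastI)
  qed
  let ?u = "\<lambda>k (t, \<omega>). if t \<in> G then F (Z (t, \<omega>)) (law M (\<xi> (j k t))) else 0"
  have Fi: "(\<lambda>x. F (Z x) (law M (\<xi> i))) \<in> borel_measurable (N \<Otimes>\<^sub>M M)" for i
    using measurable_compose[OF Z Fm[OF law_in_P2[OF \<xi>[of i]]]] .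
  have u: "?u k \<in> borel_measurable (N \<Otimes>\<^sub>M M)" for k
  proof -
    have "(\<lambda>x. F (Z x) (law M (\<xi> (j k (fst x))))) \<in> borel_measurable (N \<Otimes>\<^sub>M M)"
      by (rule measurable_compose_countable[OF Fi]) measurable
    hence "(\<lambda>x. if fst x \<in> G then F (Z x) (law M (\<xi> (j k (fst x)))) else 0) \<in> borel_measurable (N \<Otimes>\<^sub>M M)"
      by measurable
    thus ?thesis by (rule measurable_cong[THEN iffD1, rotated]) auto
  qed
  show ?thesis
  proof (rule borel_measurable_LIMSEQ_metric[OF u])
    fix x assume "x \<in> space (N \<Otimes>\<^sub>M M)"
    obtain t \<omega> where x: "x = (t, \<omega>)" by (cases x)
    show "(\<lambda>k. ?u k x) \<longlonglongrightarrow> (case x of (t, \<omega>) \<Rightarrow> if t \<in> G then F (Z (t, \<omega>)) (law M (Y t)) else 0)"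
    proof (cases "t \<in> G")
      case True
      have "(\<lambda>k. F (Z (t, \<omega>)) (law M (\<xi> (j k t)))) \<longlonglongrightarrow> F (Z (t, \<omega>)) (law M (Y t))"
      proof (rule metric_LIMSEQ_I)
        fix e :: real assume "e > 0"
        then obtain d where d: "d > 0" "\<And>m'. m' \<in> P2 \<Longrightarrow> W2 (law M (Y t)) m' < d \<Longrightarrow>
            dist (F (Z (t, \<omega>)) (law M (Y t))) (F (Z (t, \<omega>)) m') < e"
          using Fc[OF law_in_P2[OF L2[OF True]], of e] by metis
        obtain n where n: "1 / real (Suc n) < d" using d(1) by (metis nat_approx_posE)
        have "dist (F (Z (t, \<omega>)) (law M (\<xi> (j k t)))) (F (Z (t, \<omega>)) (law M (Y t))) < e" if "k \<ge> n" for k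
        proof -
          have "1 / real (Suc k) \<le> 1 / real (Suc n)" using that by (simp add: frac_le)
          hence "W2 (law M (Y t)) (law M (\<xi> (j k t))) < d"
            using W2_law_le[OF L2[OF True] \<xi>[of "j k t"]] j[OF True, of k] n by linarith
          thus ?thesis using d(2)[OF law_in_P2[OF \<xi>]] by (simp add: dist_commute)
        qed
        thus "\<exists>no. \<forall>k\<ge>no. dist (F (Z (t, \<omega>)) (law M (\<xi> (j k t)))) (F (Z (t, \<omega>)) (law M (Y t))) < e" by blast
      qed
      thus ?thesis using True by (simp add: x)
    qed (simp add: x)
  qed
qed

section \<open>Brownian increments and the Ito integral\<close>

lemma generated_subset_sets:
  "\<F> \<subseteq> borel_measurable M \<Longrightarrow> generated M \<F> \<subseteq> sets M"
  by (auto simp: generated_def dest: measurable_sets)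

lemma generated_mono: "\<F> \<subseteq> \<G> \<Longrightarrow> generated M \<F> \<subseteq> generated M \<G>"
  by (auto simp: generated_def)

lemma generated_Pow: "generated M \<F> \<subseteq> Pow (space M)"
  by (auto simp: generated_def)

lemma generated_measurable:
  assumes "f \<in> \<F>" "sigma_sets (space M) (generated M \<F>) \<subseteq> sets N" "space N = space M"
  shows "f \<in> borel_measurable N"
proof (rule measurableI)
  fix A :: "'b set" assume "A \<in> sets borel"
  hence "f -` A \<inter> space M \<in> generated M \<F>" using assms(1) by (auto simp: generated_def)
  thus "f -` A \<inter> space N \<in> sets N" using assms(2,3) by auto
qed simp

lemma borel_measurable_vec_nth_comp:
  fixes f :: "'w \<Rightarrow> ('b::euclidean_space) ^ 'n"
  assumes "f \<in> borel_measurable N" shows "(\<lambda>x. f x $ i) \<in> borel_measurable N"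
  using assms by (rule borel_measurable_continuous_on[rotated]) (intro continuous_intros)

lemma norm_vec_sq: "(norm (x :: real ^ 'n))\<^sup>2 = (\<Sum>i\<in>UNIV. (x $ i)\<^sup>2)"
  by (simp add: norm_vec_def L2_set_def sum_nonneg)

lemma borel_measurable_matrix_vector_mult:
  fixes A :: "'w \<Rightarrow> real ^ 'n ^ 'm"
  assumes "A \<in> borel_measurable N" "x \<in> borel_measurable N"
  shows "(\<lambda>\<omega>. A \<omega> *v x \<omega>) \<in> borel_measurable N"
  using assms
  by (rule borel_measurable_continuous_Pair)
     (auto simp: matrix_vector_mult_def intro!: continuous_intros)

lemma norm_matrix_vector_mult_le:
  fixes A :: "real ^ 'n ^ 'm"
  shows "norm (A *v x) \<le> norm A * norm x * real CARD('m)"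
proof -
  have "norm (A *v x) \<le> (\<Sum>k\<in>UNIV. \<bar>(A *v x) $ k\<bar>)" by (rule norm_le_l1_cart)
  also have "\<dots> \<le> (\<Sum>k\<in>(UNIV :: 'm set). norm A * norm x)"
  proof (rule sum_mono)
    fix k
    have "\<bar>(A *v x) $ k\<bar> \<le> norm (A $ k) * norm x"
      unfolding matrix_vector_mul_component by (rule Cauchy_Schwarz_ineq2)
    also have "\<dots> \<le> norm A * norm x"
      by (intro mult_right_mono Finite_Cartesian_Product.norm_nth_le) auto
    finally show "\<bar>(A *v x) $ k\<bar> \<le> norm A * norm x" .
  qed
  finally show ?thesis by (simp add: mult.commute)
qed

locale brownian_setting = prob_space M for M :: "'w measure" +
  fixes T :: real and X0 :: "'w \<Rightarrow> real ^ 'd" and B :: "real \<Rightarrow> 'w \<Rightarrow> real ^ 'd"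
  assumes T_pos: "0 < T" and compl: "complete_measure M"
    and BM: "brownian_motion M T B" and X0: "X0 \<in> L2 M"
    and X0_indep: "indep_set (sigma_sets (space M) (generated M {X0}))
           (sigma_sets (space M) (generated M (B ` {0..T})))"
begin

abbreviation "\<FF> \<equiv> aug_filtration M X0 B"

lemma B_measurable: "t \<in> {0..T} \<Longrightarrow> B t \<in> borel_measurable M"
  using BM by (simp add: brownian_motion_def)

lemma sets_aug: "sets (\<FF> s) = sigma_sets (space M) (generated M (insert X0 (B ` {0..s})) \<union> null_sets M)"
  unfolding aug_filtration_def
  by (rule sets_measure_of) (use generated_Pow sets.sets_into_space[of _ M] in \<open>fastforce dest!: null_setsD2\<close>)

lemma space_aug [simp]: "space (\<FF> s) = space M"
  unfolding aug_filtration_def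
  by (rule space_measure_of) (use generated_Pow sets.sets_into_space[of _ M] in \<open>fastforce dest!: null_setsD2\<close>)

lemma sets_aug_subset: "s \<le> T \<Longrightarrow> sets (\<FF> s) \<subseteq> sets M"
  unfolding sets_aug
  using B_measurable L2_D(1)[OF X0]
  by (intro sets.sigma_sets_subset Un_least generated_subset_sets) auto

lemma sets_aug_mono: "s \<le> t \<Longrightarrow> sets (\<FF> s) \<subseteq> sets (\<FF> t)"
  unfolding sets_aug
  by (intro sigma_sets_mono' Un_mono generated_mono insert_mono image_mono order_refl) auto

lemma measurable_aug: "s \<le> T \<Longrightarrow> f \<in> borel_measurable (\<FF> s) \<Longrightarrow> f \<in> borel_measurable M"
  using sets_aug_subset[of s] by (auto simp: measurable_def)

lemma measurable_aug_mono: "s \<le> t \<Longrightarrow> f \<in> borel_measurable (\<FF> s) \<Longrightarrow> f \<in> borel_measurable (\<FF> t)"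
  using sets_aug_mono[of s t] by (auto simp: measurable_def)

text \<open>
The events \<open>A \<inter> C\<close> with \<open>A\<close> generated by \<open>X0\<close> and \<open>C\<close> by the path up to \<open>s\<close> form a generator stable under
intersection, on which independence of the increment is checked by factoring out \<open>A\<close> first:
both \<open>C\<close> and the increment belong to the \<open>\<sigma>\<close>-algebra of the whole path, which is independent of \<open>X0\<close>.
The augmentation by null sets changes no probability.
\<close>

lemma indep_increment:
  assumes s: "0 \<le> s" "s < b" "b \<le> T"
  shows "indep_set (sets (\<FF> s)) (sigma_sets (space M) (generated M {\<lambda>\<omega>. B b \<omega> - B s \<omega>}))"
proof -
  define D where "D = (\<lambda>\<omega>. B b \<omega> - B s \<omega>)"
  define K where "K = sigma_sets (space M) (generated M {D})"
  define H where "H = sigma_sets (space M) (generated M (B ` {0..s}))"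
  define X where "X = sigma_sets (space M) (generated M {X0})"
  define S where "S = sigma_sets (space M) (generated M (B ` {0..T}))"
  define Q where "Q = {A \<inter> C | A C. A \<in> X \<and> C \<in> H}"
  have HK: "indep_set H K"
    using BM s unfolding brownian_motion_def H_def K_def D_def by auto
  have XS: "indep_set X S" using X0_indep by (simp add: X_def S_def)
  interpret X: sigma_algebra "space M" X unfolding X_def by (rule sigma_algebra_sigma_sets[OF generated_Pow])
  interpret H: sigma_algebra "space M" H unfolding H_def by (rule sigma_algebra_sigma_sets[OF generated_Pow])
  interpret K: sigma_algebra "space M" K unfolding K_def by (rule sigma_algebra_sigma_sets[OF generated_Pow])
  interpret S: sigma_algebra "space M" S unfolding S_def by (rule sigma_algebra_sigma_sets[OF generated_Pow])
  have HS: "H \<subseteq> S" unfolding H_def S_def using s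
    by (intro sigma_sets_mono' generated_mono) auto
  have KS: "K \<subseteq> S"
  proof -
    let ?N = "sigma (space M) (generated M (B ` {0..T}))"
    have N: "sets ?N = S" "space ?N = space M"
      unfolding S_def by (intro sets_measure_of space_measure_of generated_Pow)+
    have "B b \<in> borel_measurable ?N" "B s \<in> borel_measurable ?N"
      using s N by (auto intro!: generated_measurable[of _ "B ` {0..T}"] simp: S_def)
    hence Dm: "D \<in> borel_measurable ?N" unfolding D_def by (rule borel_measurable_diff)
    have "generated M {D} \<subseteq> S"
    proof
      fix a assume "a \<in> generated M {D}"
      then obtain A where "a = D -` A \<inter> space M" "A \<in> sets borel" by (auto simp: generated_def)
      thus "a \<in> S" using measurable_sets[OF Dm, of A] unfolding N by simp
    qed
    thus ?thesis unfolding K_def using S.sigma_sets_subset by blast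
  qed
  have evs: "X \<subseteq> events" "H \<subseteq> events" "K \<subseteq> events" "S \<subseteq> events"
    using indep_setD_ev1[OF HK] indep_setD_ev2[OF HK] indep_setD_ev1[OF XS] indep_setD_ev2[OF XS] by auto
  have Qev: "Q \<subseteq> events" using evs unfolding Q_def by auto
  have "indep_set Q K"
  proof (rule indep_setI)
    fix a c assume "a \<in> Q" and c: "c \<in> K"
    then obtain A C where a: "a = A \<inter> C" and A: "A \<in> X" and C: "C \<in> H" by (auto simp: Q_def)
    have "prob (a \<inter> c) = prob (A \<inter> (C \<inter> c))" by (simp add: a Int_assoc)
    also have "\<dots> = prob A * prob (C \<inter> c)"
      using HS KS C c by (intro indep_setD[OF XS A]) auto
    also have "prob (C \<inter> c) = prob C * prob c" by (rule indep_setD[OF HK C c])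
    also have "prob A * (prob C * prob c) = (prob A * prob C) * prob c" by simp
    also have "prob A * prob C = prob a"
      unfolding a using HS C by (intro indep_setD[OF XS A, symmetric]) auto
    finally show "prob (a \<inter> c) = prob a * prob c" .
  qed (use Qev evs in auto)
  moreover have "Int_stable Q"
  proof (rule Int_stableI)
    fix a b assume "a \<in> Q" "b \<in> Q"
    then obtain A C A' C' where "a = A \<inter> C" "A \<in> X" "C \<in> H" "b = A' \<inter> C'" "A' \<in> X" "C' \<in> H"
      by (auto simp: Q_def)
    thus "a \<inter> b \<in> Q" unfolding Q_def
      by (intro CollectI exI[of _ "A \<inter> A'"] exI[of _ "C \<inter> C'"]) auto
  qed
  moreover have "Int_stable K" by (intro Int_stableI) auto
  ultimately have "indep_set (sigma_sets (space M) Q) (sigma_sets (space M) K)"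
    by (rule indep_set_sigma_sets)
  hence QK: "indep_set (sigma_sets (space M) Q) K" by (simp add: K.sigma_sets_eq)
  have gen: "generated M (insert X0 (B ` {0..s})) \<subseteq> Q"
  proof
    fix a assume "a \<in> generated M (insert X0 (B ` {0..s}))"
    then consider "a \<in> generated M {X0}" | "a \<in> generated M (B ` {0..s})"
      by (auto simp: generated_def)
    thus "a \<in> Q"
    proof cases
      case 1
      hence "a \<in> X" "a \<subseteq> space M" using generated_Pow[of M "{X0}"] by (auto simp: X_def)
      thus ?thesis unfolding Q_def by (intro CollectI exI[of _ a] exI[of _ "space M"]) auto
    next
      case 2
      hence "a \<in> H" "a \<subseteq> space M" using generated_Pow[of M "B ` {0..s}"] by (auto simp: H_def)
      thus ?thesis unfolding Q_def by (intro CollectI exI[of _ "space M"] exI[of _ a]) auto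
    qed
  qed
  interpret G: sigma_algebra "space M" "sigma_sets (space M) Q"
    using Qev sets.sets_into_space by (intro sigma_algebra_sigma_sets) auto
  \<comment> \<open>every event of the augmented filtration agrees almost surely with one generated by \<open>X0\<close> and the path\<close>
  have approx: "A \<in> events \<and> (\<exists>A'\<in>sigma_sets (space M) Q. AE \<omega> in M. \<omega> \<in> A \<longleftrightarrow> \<omega> \<in> A')"
    if "A \<in> sets (\<FF> s)" for A
    using that unfolding sets_aug
  proof (induction rule: sigma_sets.induct)
    case (Basic a)
    show ?case
    proof (cases "a \<in> null_sets M")
      case True
      hence "AE \<omega> in M. \<omega> \<in> a \<longleftrightarrow> \<omega> \<in> {}" using AE_not_in by fastforce
      thus ?thesis using True by (auto intro: bexI[of _ "{}"])
    next
      case False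
      thus ?thesis using Basic gen Qev by (auto intro!: bexI[of _ a])
    qed
  next
    case Empty
    show ?case by (auto intro: bexI[of _ "{}"])
  next
    case (Compl a)
    then obtain A' where A': "A' \<in> sigma_sets (space M) Q" "AE \<omega> in M. \<omega> \<in> a \<longleftrightarrow> \<omega> \<in> A'" by auto
    have "AE \<omega> in M. \<omega> \<in> space M - a \<longleftrightarrow> \<omega> \<in> space M - A'" using A'(2) by eventually_elim auto
    thus ?case using Compl A'(1) by (auto intro!: bexI[of _ "space M - A'"])
  next
    case (Union a)
    then obtain A' where A': "\<And>i. A' i \<in> sigma_sets (space M) Q" "\<And>i. AE \<omega> in M. \<omega> \<in> a i \<longleftrightarrow> \<omega> \<in> A' i" by metis
    have "AE \<omega> in M. \<forall>i. \<omega> \<in> a i \<longleftrightarrow> \<omega> \<in> A' i" using A'(2) by (subst AE_all_countable) auto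
    hence "AE \<omega> in M. \<omega> \<in> (\<Union>i. a i) \<longleftrightarrow> \<omega> \<in> (\<Union>i. A' i)" by eventually_elim auto
    thus ?case using Union A'(1) by (intro conjI bexI[of _ "\<Union>i. A' i"]) auto
  qed
  have "indep_set (sets (\<FF> s)) K"
  proof (rule indep_setI)
    fix a c assume a: "a \<in> sets (\<FF> s)" and c: "c \<in> K"
    obtain a' where a': "a' \<in> sigma_sets (space M) Q" "AE \<omega> in M. \<omega> \<in> a \<longleftrightarrow> \<omega> \<in> a'"
      using approx[OF a] by auto
    have ev: "a \<in> events" "a' \<in> events" "c \<in> events"
      using approx[OF a] a'(1) c evs(3) indep_setD_ev1[OF QK] by auto
    have "prob (a \<inter> c) = prob (a' \<inter> c)"
      using a'(2) ev by (intro finite_measure_eq_AE) auto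
    also have "\<dots> = prob a' * prob c" by (rule indep_setD[OF QK a'(1) c])
    also have "prob a' = prob a" using a'(2) ev by (intro finite_measure_eq_AE) auto
    finally show "prob (a \<inter> c) = prob a * prob c" .
  qed (use approx evs in auto)
  thus ?thesis by (simp add: K_def D_def)
qed

lemma increment_moments:
  assumes s: "0 \<le> s" "s < b" "b \<le> T"
  shows "integrable M (\<lambda>\<omega>. ((B b \<omega> - B s \<omega>) $ i)\<^sup>2)"
    "expectation (\<lambda>\<omega>. ((B b \<omega> - B s \<omega>) $ i)\<^sup>2) = b - s"
    "expectation (\<lambda>\<omega>. (B b \<omega> - B s \<omega>) $ i) = 0"
proof -
  let ?D = "\<lambda>\<omega>. (B b \<omega> - B s \<omega>) $ i" and ?f = "normal_density 0 (sqrt (b - s))"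
  have d: "distributed M lborel ?D (\<lambda>x. ennreal (?f x))"
    using BM s unfolding brownian_motion_def by blast
  have p: "0 < sqrt (b - s)" using s by simp
  have m: "has_bochner_integral lborel (\<lambda>x. ?f x * x\<^sup>2) (b - s)"
    using normal_moment_even[OF p, of 0 1] s by (simp add: fact_numeral diff_divide_distrib)
  have m1: "has_bochner_integral lborel (\<lambda>x. ?f x * x) 0"
    using normal_moment_odd[OF p, of 0 0] by simp
  show "integrable M (\<lambda>\<omega>. (?D \<omega>)\<^sup>2)"
    using distributed_integrable[OF d, of "\<lambda>x. x\<^sup>2"] integrable.intros[OF m] by simp
  show "expectation (\<lambda>\<omega>. (?D \<omega>)\<^sup>2) = b - s"
    using distributed_integral[OF d, of "\<lambda>x. x\<^sup>2"] has_bochner_integral_integral_eq[OF m] by simp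
  show "expectation ?D = 0"
    using distributed_integral[OF d, of "\<lambda>x. x"] has_bochner_integral_integral_eq[OF m1] by simp
qed

lemma increment_L2:
  assumes s: "0 \<le> s" "s \<le> b" "b \<le> T"
  shows "(\<lambda>\<omega>. B b \<omega> - B s \<omega>) \<in> L2 M"
proof (cases "s = b")
  case False
  show ?thesis unfolding L2_def norm_vec_sq
    using s False increment_moments(1)[of s b] B_measurable[of s] B_measurable[of b] by auto
qed (simp add: L2_zero)

lemma B_L2: 
  assumes t: "t \<in> {0..T}" shows "B t \<in> L2 M" "expectation (\<lambda>\<omega>. (norm (B t \<omega>))\<^sup>2) \<le> real CARD('d) * T"
proof -
  have z: "AE \<omega> in M. B 0 \<omega> = 0" using BM by (simp add: brownian_motion_def)
  have ae: "AE \<omega> in M. B t \<omega> - B 0 \<omega> = B t \<omega>" using z by eventually_elim simp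
  show 1: "B t \<in> L2 M"
    using t by (intro L2_cong_AE[OF increment_L2[of 0 t] B_measurable ae]) auto
  have bm: "B t \<in> borel_measurable M" "B 0 \<in> borel_measurable M" using t T_pos B_measurable by auto
  have "expectation (\<lambda>\<omega>. (norm (B t \<omega>))\<^sup>2) = expectation (\<lambda>\<omega>. (norm (B t \<omega> - B 0 \<omega>))\<^sup>2)"
    using z bm by (intro integral_cong_AE) auto
  also have "\<dots> \<le> real CARD('d) * T"
  proof (cases "t = 0")
    case False
    hence "expectation (\<lambda>\<omega>. (norm (B t \<omega> - B 0 \<omega>))\<^sup>2) = (\<Sum>i\<in>(UNIV::'d set). t - 0)"
      unfolding norm_vec_sq using t increment_moments[of 0 t] by (subst Bochner_Integration.integral_sum) auto
    thus ?thesis using t by simp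
  qed (use T_pos in simp)
  finally show "expectation (\<lambda>\<omega>. (norm (B t \<omega>))\<^sup>2) \<le> real CARD('d) * T" .
qed

lemma martingale_increment:
  fixes f :: "'w \<Rightarrow> real"
  assumes s: "0 \<le> s" "s \<le> b" "b \<le> T" and f: "f \<in> borel_measurable (\<FF> s)" "f \<in> L2 M"
  shows "expectation (\<lambda>\<omega>. f \<omega> * (B b \<omega> - B s \<omega>) $ i) = 0"
proof (cases "s = b")
  case False
  let ?D = "\<lambda>\<omega>. B b \<omega> - B s \<omega>"
  have sb: "s < b" using s False by simp
  have Dm: "?D \<in> borel_measurable M" using L2_D(1)[OF increment_L2[OF s]] .
  have fm: "f \<in> borel_measurable M" using measurable_aug[OF _ f(1)] s by simp
  have "indep_var borel f borel (\<lambda>\<omega>. ?D \<omega> $ i)"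
    unfolding indep_var_eq
  proof (intro conjI)
    let ?K = "sigma_sets (space M) (generated M {?D})"
    interpret K: sigma_algebra "space M" ?K by (rule sigma_algebra_sigma_sets[OF generated_Pow])
    have "{f -` A \<inter> space M |A. A \<in> sets borel} \<subseteq> sets (\<FF> s)"
      using measurable_sets[OF f(1)] by auto
    from sets.sigma_sets_subset[OF this]
    have f1: "sigma_sets (space M) {f -` A \<inter> space M |A. A \<in> sets borel} \<subseteq> sets (\<FF> s)" by simp
    have D1: "sigma_sets (space M) {(\<lambda>\<omega>. ?D \<omega> $ i) -` A \<inter> space M |A. A \<in> sets borel} \<subseteq> ?K"
    proof (rule K.sigma_sets_subset, safe)
      fix A :: "real set" assume "A \<in> sets borel"
      hence "(\<lambda>x :: real ^ 'd. x $ i) -` A \<in> sets borel"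
        using measurable_sets[of "\<lambda>x :: real ^ 'd. x $ i" borel borel A] by simp
      moreover have "(\<lambda>\<omega>. ?D \<omega> $ i) -` A \<inter> space M = ?D -` ((\<lambda>x. x $ i) -` A) \<inter> space M" by auto
      ultimately have "(\<lambda>\<omega>. ?D \<omega> $ i) -` A \<inter> space M \<in> generated M {?D}"
        unfolding generated_def by blast
      thus "(\<lambda>\<omega>. ?D \<omega> $ i) -` A \<inter> space M \<in> ?K" by auto
    qed
    have ind: "indep_set (sets (\<FF> s)) ?K" by (rule indep_increment[OF s(1) sb s(3)])
    show "indep_set (sigma_sets (space M) {f -` A \<inter> space M |A. A \<in> sets borel})
      (sigma_sets (space M) {(\<lambda>\<omega>. ?D \<omega> $ i) -` A \<inter> space M |A. A \<in> sets borel})"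
      by (intro indep_setI order_trans[OF f1 indep_setD_ev1[OF ind]] order_trans[OF D1 indep_setD_ev2[OF ind]]
          indep_setD[OF ind] subsetD[OF f1] subsetD[OF D1])
  qed (use borel_measurable_vec_nth_comp[OF Dm] fm in \<open>simp_all only:\<close>)
  moreover have "integrable M f" by (rule L2_integrable[OF f(2)])
  moreover have "integrable M (\<lambda>\<omega>. ?D \<omega> $ i)"
    by (rule integrable_bounded_linear[OF bounded_linear_vec_nth L2_integrable[OF increment_L2[OF s]]])
  ultimately show ?thesis
    using indep_var_lebesgue_integral[of f "\<lambda>\<omega>. ?D \<omega> $ i"] increment_moments(3)[OF s(1) sb s(3)] by simp
qed simp

lemma simple_ito_L2:
  assumes "simple_integrand T \<FF> n \<tau> \<xi>" "t \<in> {0..T}"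
  shows "simple_ito B n \<tau> \<xi> t \<in> L2 M"
proof -
  have "(\<lambda>\<omega>. \<xi> i \<omega> *v (B (min t (\<tau> (Suc i))) \<omega> - B (min t (\<tau> i)) \<omega>)) \<in> L2 M" if i: "i < n" for i
  proof -
    have \<tau>: "\<tau> i \<in> {0..T}" "\<tau> (Suc i) \<in> {0..T}" "\<tau> i \<le> \<tau> (Suc i)"
      using assms by (auto simp: simple_integrand_def mono_def)
    have "\<xi> i \<in> borel_measurable (\<FF> (\<tau> i))" and bd: "bounded (range (\<xi> i))"
      using assms i by (auto simp: simple_integrand_def)
    hence \<xi>m: "\<xi> i \<in> borel_measurable M" using measurable_aug[of "\<tau> i"] \<tau> by auto
    obtain c where c: "\<And>\<omega>. norm (\<xi> i \<omega>) \<le> c" using bd by (auto simp: bounded_iff)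
    let ?D = "\<lambda>\<omega>. B (min t (\<tau> (Suc i))) \<omega> - B (min t (\<tau> i)) \<omega>"
    have D: "?D \<in> L2 M" using assms(2) \<tau> by (intro increment_L2) auto
    define K where "K = real CARD('d)"
    have K: "\<And>(A :: real ^ 'd ^ 'd) x. norm (A *v x) \<le> norm A * norm x * K" "K > 0"
      unfolding K_def by (rule norm_matrix_vector_mult_le) simp
    show ?thesis
    proof (rule L2_norm_bound[OF L2_scaleR[OF D, of "c * K"]])
      show "(\<lambda>\<omega>. \<xi> i \<omega> *v ?D \<omega>) \<in> borel_measurable M"
        using \<xi>m L2_D(1)[OF D] by (rule borel_measurable_matrix_vector_mult)
      fix \<omega>
      have "norm (\<xi> i \<omega> *v ?D \<omega>) \<le> norm (\<xi> i \<omega>) * norm (?D \<omega>) * K" by (rule K(1))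
      also have "\<dots> \<le> c * norm (?D \<omega>) * K" using c K(2) by (intro mult_right_mono) auto
      also have "\<dots> = c * K * norm (?D \<omega>)" by simp
      also have "\<dots> \<le> \<bar>c * K\<bar> * norm (?D \<omega>)" by (intro mult_right_mono) auto
      finally show "norm (\<xi> i \<omega> *v ?D \<omega>) \<le> norm ((c * K) *\<^sub>R ?D \<omega>)" by simp
    qed
  qed
  hence "(\<lambda>\<omega>. \<Sum>i<n. \<xi> i \<omega> *v (B (min t (\<tau> (Suc i))) \<omega> - B (min t (\<tau> i)) \<omega>)) \<in> L2 M"
    by (intro L2_sum) auto
  thus ?thesis by (simp add: simple_ito_def[abs_def])
qed

text \<open>
Subtracting the integral up to \<open>t\<close> leaves, for each step, an increment that starts at \<open>max t \<tau>\<^sub>i\<close>.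
At that time both the integrand and \<open>\<eta>\<close> are known, so the expectation vanishes componentwise.
\<close>

lemma simple_ito_orthogonal:
  assumes S: "simple_integrand T \<FF> n \<tau> \<xi>" and t: "t \<in> {0..T}"
    and \<eta>: "\<eta> \<in> borel_measurable (\<FF> t)" "\<eta> \<in> L2 M"
  shows "L2_inner M \<eta> (\<lambda>\<omega>. simple_ito B n \<tau> \<xi> T \<omega> - simple_ito B n \<tau> \<xi> t \<omega>) = 0"
proof -
  have comp: "integrable M (\<lambda>\<omega>. (\<eta> \<omega> $ k * \<xi> i \<omega> $ k $ l) * (B b \<omega> - B s \<omega>) $ l) \<and>
      expectation (\<lambda>\<omega>. (\<eta> \<omega> $ k * \<xi> i \<omega> $ k $ l) * (B b \<omega> - B s \<omega>) $ l) = 0"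
    if i: "i < n" and s: "t \<le> s" "\<tau> i \<le> s" "s \<le> b" "b \<le> T" for i k l s b
  proof -
    have \<tau>: "\<tau> i \<in> {0..T}" using S by (auto simp: simple_integrand_def)
    have "\<xi> i \<in> borel_measurable (\<FF> (\<tau> i))" and bd: "bounded (range (\<xi> i))"
      using S i by (auto simp: simple_integrand_def)
    hence \<xi>s: "\<xi> i \<in> borel_measurable (\<FF> s)" using measurable_aug_mono s by blast
    have \<eta>s: "\<eta> \<in> borel_measurable (\<FF> s)" using measurable_aug_mono s \<eta> by blast
    obtain c where c: "\<And>\<omega>. norm (\<xi> i \<omega>) \<le> c" using bd by (auto simp: bounded_iff)
    let ?f = "\<lambda>\<omega>. \<eta> \<omega> $ k * \<xi> i \<omega> $ k $ l"
    have f: "?f \<in> borel_measurable (\<FF> s)" by (intro borel_measurable_times borel_measurable_vec_nth_comp \<xi>s \<eta>s)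
    have fL2: "?f \<in> L2 M"
    proof (rule L2_norm_bound[OF L2_scaleR[OF \<eta>(2), of c]])
      show "?f \<in> borel_measurable M" using measurable_aug[OF _ f] s by simp
      fix \<omega>
      have "norm (?f \<omega>) \<le> norm (\<eta> \<omega>) * norm (\<xi> i \<omega>)"
        unfolding norm_mult
        by (intro mult_mono order_trans[OF Finite_Cartesian_Product.norm_nth_le Finite_Cartesian_Product.norm_nth_le] Finite_Cartesian_Product.norm_nth_le) auto
      also have "\<dots> \<le> norm (\<eta> \<omega>) * c" using c by (intro mult_left_mono) auto
      also have "\<dots> \<le> norm (\<eta> \<omega>) * \<bar>c\<bar>" by (intro mult_left_mono) auto
      finally show "norm (?f \<omega>) \<le> norm (c *\<^sub>R \<eta> \<omega>)" by (simp add: mult.commute)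
    qed
    have s0: "0 \<le> s" using s \<tau> by auto
    have DL2: "(\<lambda>\<omega>. (B b \<omega> - B s \<omega>) $ l) \<in> L2 M"
      by (intro L2_norm_bound[OF increment_L2[OF s0 s(3,4)]] Finite_Cartesian_Product.norm_nth_le
          borel_measurable_vec_nth_comp L2_D(1)[OF increment_L2[OF s0 s(3,4)]])
    show ?thesis
      using L2_integrable_inner[OF fL2 DL2] martingale_increment[OF s0 s(3,4) f fL2] by simp
  qed
  have term0: "integrable M (\<lambda>\<omega>. \<eta> \<omega> \<bullet> (\<xi> i \<omega> *v (B b \<omega> - B s \<omega>))) \<and>
      expectation (\<lambda>\<omega>. \<eta> \<omega> \<bullet> (\<xi> i \<omega> *v (B b \<omega> - B s \<omega>))) = 0"
    if "i < n" "t \<le> s" "\<tau> i \<le> s" "s \<le> b" "b \<le> T" for i s b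
  proof -
    have eq: "\<eta> \<omega> \<bullet> (\<xi> i \<omega> *v (B b \<omega> - B s \<omega>)) =
       (\<Sum>k\<in>UNIV. \<Sum>l\<in>UNIV. (\<eta> \<omega> $ k * \<xi> i \<omega> $ k $ l) * (B b \<omega> - B s \<omega>) $ l)" for \<omega>
      by (simp add: inner_vec_def matrix_vector_mult_def sum_distrib_left mult.assoc)
    show ?thesis unfolding eq using comp[OF that] by (simp add: Bochner_Integration.integral_sum)
  qed
  let ?d = "\<lambda>i \<omega>. (B (min T (\<tau> (Suc i))) \<omega> - B (min T (\<tau> i)) \<omega>) - (B (min t (\<tau> (Suc i))) \<omega> - B (min t (\<tau> i)) \<omega>)"
  have key: "integrable M (\<lambda>\<omega>. \<eta> \<omega> \<bullet> (\<xi> i \<omega> *v ?d i \<omega>)) \<and> expectation (\<lambda>\<omega>. \<eta> \<omega> \<bullet> (\<xi> i \<omega> *v ?d i \<omega>)) = 0"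
    if i: "i < n" for i
  proof -
    have \<tau>: "\<tau> i \<in> {0..T}" "\<tau> (Suc i) \<in> {0..T}" "\<tau> i \<le> \<tau> (Suc i)"
      using S by (auto simp: simple_integrand_def mono_def)
    have m: "min T (\<tau> (Suc i)) = \<tau> (Suc i)" "min T (\<tau> i) = \<tau> i" using \<tau> by auto
    consider "\<tau> (Suc i) \<le> t" | "t \<le> \<tau> i" | "\<tau> i < t" "t < \<tau> (Suc i)" by linarith
    thus ?thesis
    proof cases
      case 1
      hence "?d i = (\<lambda>\<omega>. 0)" using \<tau> m by (auto simp: min_def fun_eq_iff)
      thus ?thesis by (simp add: fun_eq_iff)
    next
      case 2
      hence "?d i = (\<lambda>\<omega>. B (\<tau> (Suc i)) \<omega> - B (\<tau> i) \<omega>)" using \<tau> m by (auto simp: min_def fun_eq_iff)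
      thus ?thesis using term0[OF i 2 order_refl \<tau>(3)] \<tau> by (simp add: fun_eq_iff)
    next
      case 3
      hence "?d i = (\<lambda>\<omega>. B (\<tau> (Suc i)) \<omega> - B t \<omega>)" using \<tau> m by (auto simp: min_def fun_eq_iff)
      thus ?thesis using term0[OF i order_refl, of "\<tau> (Suc i)"] 3 \<tau> by (simp add: fun_eq_iff)
    qed
  qed
  have "simple_ito B n \<tau> \<xi> T \<omega> - simple_ito B n \<tau> \<xi> t \<omega> = (\<Sum>i<n. \<xi> i \<omega> *v ?d i \<omega>)" for \<omega>
    unfolding simple_ito_def by (simp add: sum_subtractf matrix_vector_mult_diff_distrib)
  thus ?thesis unfolding L2_inner_def
    using key by (simp add: inner_sum_right Bochner_Integration.integral_sum)
qed

text \<open>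
The approximating simple integrals are square integrable, and one of them is at finite \<open>L\<^sup>2\<close> distance
from \<open>I t\<close>.
\<close>

lemma ito_integral_L2:
  assumes ito: "is_ito_integral M T \<FF> B Z I" and t: "t \<in> {0..T}"
  shows "I t \<in> L2 M"
proof -
  obtain n \<tau> \<xi> where S: "\<And>k. simple_integrand T \<FF> (n k) (\<tau> k) (\<xi> k)"
    and lim: "(\<lambda>k. \<integral>\<^sup>+ \<omega>. ennreal ((norm (simple_ito B (n k) (\<tau> k) (\<xi> k) t \<omega> - I t \<omega>))\<^sup>2) \<partial>M) \<longlonglongrightarrow> 0"
    using ito t unfolding is_ito_integral_def by blast
  have Im: "I t \<in> borel_measurable M" using ito t by (simp add: is_ito_integral_def)
  have "\<forall>\<^sub>F k in sequentially. (\<integral>\<^sup>+ \<omega>. ennreal ((norm (simple_ito B (n k) (\<tau> k) (\<xi> k) t \<omega> - I t \<omega>))\<^sup>2) \<partial>M) < 1"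
    using order_tendstoD(2)[OF lim, of 1] by simp
  then obtain k where k: "(\<integral>\<^sup>+ \<omega>. ennreal ((norm (simple_ito B (n k) (\<tau> k) (\<xi> k) t \<omega> - I t \<omega>))\<^sup>2) \<partial>M) < 1"
    by (auto simp: eventually_sequentially)
  let ?S = "simple_ito B (n k) (\<tau> k) (\<xi> k) t"
  have Sm: "?S \<in> L2 M" using simple_ito_L2[OF S t] .
  have fin: "(\<integral>\<^sup>+ \<omega>. ennreal ((norm (?S \<omega> - I t \<omega>))\<^sup>2) \<partial>M) < \<infinity>"
    using order.strict_trans[OF k, of \<infinity>] by simp
  have "(\<lambda>\<omega>. ?S \<omega> - I t \<omega>) \<in> L2 M"
    unfolding L2_def using L2_D(1)[OF Sm] Im fin
    by (auto intro!: integrableI_bounded)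
  from L2_diff[OF Sm this] show ?thesis by simp
qed

lemma ito_increment_orthogonal:
  assumes ito: "is_ito_integral M T \<FF> B Z I" and t: "t \<in> {0..T}"
    and \<eta>: "\<eta> \<in> borel_measurable (\<FF> t)" "\<eta> \<in> L2 M"
  shows "L2_inner M \<eta> (\<lambda>\<omega>. I T \<omega> - I t \<omega>) = 0"
proof -
  obtain n \<tau> \<xi> where S: "\<And>k. simple_integrand T \<FF> (n k) (\<tau> k) (\<xi> k)"
    and lim: "\<And>t. t \<in> {0..T} \<Longrightarrow> (\<lambda>k. \<integral>\<^sup>+ \<omega>. ennreal ((norm (simple_ito B (n k) (\<tau> k) (\<xi> k) t \<omega> - I t \<omega>))\<^sup>2) \<partial>M) \<longlonglongrightarrow> 0"
    using ito unfolding is_ito_integral_def by blast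
  define Y where "Y k r = simple_ito B (n k) (\<tau> k) (\<xi> k) r" for k r
  have TT: "T \<in> {0..T}" using T_pos by simp
  have Y: "Y k r \<in> L2 M" if "r \<in> {0..T}" for k r using simple_ito_L2[OF S that] by (simp add: Y_def)
  note I = ito_integral_L2[OF ito]
  have nrm: "(\<lambda>k. L2_norm M (\<lambda>\<omega>. Y k r \<omega> - I r \<omega>)) \<longlonglongrightarrow> 0" if r: "r \<in> {0..T}" for r
  proof -
    have "(\<integral>\<^sup>+ \<omega>. ennreal ((norm (Y k r \<omega> - I r \<omega>))\<^sup>2) \<partial>M) = ennreal ((L2_norm M (\<lambda>\<omega>. Y k r \<omega> - I r \<omega>))\<^sup>2)" for k
      unfolding L2_norm_sq using L2_D(2)[OF L2_diff[OF Y[OF r] I[OF r]]] by (intro nn_integral_eq_integral) auto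
    hence "(\<lambda>k. ennreal ((L2_norm M (\<lambda>\<omega>. Y k r \<omega> - I r \<omega>))\<^sup>2)) \<longlonglongrightarrow> ennreal 0"
      using lim[OF r] by (simp add: Y_def)
    hence "(\<lambda>k. (L2_norm M (\<lambda>\<omega>. Y k r \<omega> - I r \<omega>))\<^sup>2) \<longlonglongrightarrow> 0"
      by (subst (asm) tendsto_ennreal_iff) auto
    hence "(\<lambda>k. sqrt ((L2_norm M (\<lambda>\<omega>. Y k r \<omega> - I r \<omega>))\<^sup>2)) \<longlonglongrightarrow> sqrt 0" by (rule tendsto_real_sqrt)
    thus ?thesis by simp
  qed
  have bound: "\<bar>L2_inner M \<eta> (\<lambda>\<omega>. I T \<omega> - I t \<omega>)\<bar> \<le> L2_norm M \<eta> * (L2_norm M (\<lambda>\<omega>. Y k T \<omega> - I T \<omega>) + L2_norm M (\<lambda>\<omega>. Y k t \<omega> - I t \<omega>))" for k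
  proof -
    note YI = Y[OF TT, of k] Y[OF t, of k] I[OF TT] I[OF t]
    have "L2_inner M \<eta> (\<lambda>\<omega>. Y k T \<omega> - Y k t \<omega>) = 0"
      unfolding Y_def by (rule simple_ito_orthogonal[OF S t \<eta>])
    hence "L2_inner M \<eta> (\<lambda>\<omega>. I T \<omega> - I t \<omega>) =
       L2_inner M \<eta> (\<lambda>\<omega>. Y k t \<omega> - I t \<omega>) - L2_inner M \<eta> (\<lambda>\<omega>. Y k T \<omega> - I T \<omega>)"
      using YI \<eta>(2) by (simp add: L2_inner_simps)
    also have "\<bar>\<dots>\<bar> \<le> L2_norm M \<eta> * L2_norm M (\<lambda>\<omega>. Y k t \<omega> - I t \<omega>) + L2_norm M \<eta> * L2_norm M (\<lambda>\<omega>. Y k T \<omega> - I T \<omega>)"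
      using L2_Cauchy_Schwarz[OF \<eta>(2) L2_diff[OF YI(2,4)]] L2_Cauchy_Schwarz[OF \<eta>(2) L2_diff[OF YI(1,3)]] by linarith
    finally show ?thesis by (simp add: algebra_simps)
  qed
  have "(\<lambda>k. L2_norm M \<eta> * (L2_norm M (\<lambda>\<omega>. Y k T \<omega> - I T \<omega>) + L2_norm M (\<lambda>\<omega>. Y k t \<omega> - I t \<omega>))) \<longlonglongrightarrow> L2_norm M \<eta> * (0 + 0)"
    by (intro tendsto_intros nrm TT t)
  hence "\<bar>L2_inner M \<eta> (\<lambda>\<omega>. I T \<omega> - I t \<omega>)\<bar> \<le> 0"
    using bound by (intro LIMSEQ_le_const[of _ 0]) auto
  thus ?thesis by simp
qed

text \<open>
A Brownian motion is a family of random variables whose paths are continuous outside a null set only,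
so it need not be jointly measurable. The limit of the processes that are constant on the intervals of a
regular grid is, and it agrees with \<open>B\<close> along every continuous path.
\<close>

lemma B_jointly_measurable:
  obtains B' where "case_prod B' \<in> borel_measurable (time_prod M T)"
    "AE \<omega> in M. \<forall>t\<in>{0..T}. B' t \<omega> = B t \<omega>"
proof -
  \<comment> \<open>grid times, truncated so that they stay in \<open>[0,T]\<close> for every index\<close>
  define h where "h n i = T * min (real i) (real (Suc n)) / real (Suc n)" for n i :: nat
  define j where "j n t = nat \<lfloor>t * real (Suc n) / T\<rfloor>" for n :: nat and t :: real
  have h: "h n i \<in> {0..T}" for n i
  proof -
    have "T * (min (real i) (real (Suc n)) / real (Suc n)) \<le> T * 1"
      using T_pos by (intro mult_left_mono) auto
    thus ?thesis using T_pos by (simp add: h_def)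
  qed
  have hj: "\<bar>h n (j n t) - t\<bar> \<le> T / real (Suc n)" if t: "t \<in> {0..T}" for n t
  proof -
    let ?x = "t * real (Suc n) / T"
    have x0: "0 \<le> ?x" "?x \<le> real (Suc n)"
      using t T_pos mult_right_mono[of t T "real (Suc n)"] by (auto simp: pos_divide_le_eq mult.commute)
    have fl: "real (j n t) = of_int \<lfloor>?x\<rfloor>" unfolding j_def using x0 by simp
    hence "real (j n t) \<le> ?x" "?x < real (j n t) + 1" by linarith+
    hence "h n (j n t) = T * real (j n t) / real (Suc n)" using x0 by (simp add: h_def min_def)
    moreover have "t = ?x * (T / real (Suc n))" using T_pos by simp
    ultimately have "t - h n (j n t) = (?x - real (j n t)) * (T / real (Suc n))"
      by (simp only: left_diff_distrib) (simp add: mult.commute)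
    moreover have "0 \<le> (?x - real (j n t)) * (T / real (Suc n))"
      using \<open>real (j n t) \<le> ?x\<close> T_pos by simp
    moreover have "(?x - real (j n t)) * (T / real (Suc n)) \<le> 1 * (T / real (Suc n))"
      using \<open>?x < real (j n t) + 1\<close> T_pos by (intro mult_right_mono) auto
    ultimately show ?thesis by simp
  qed
  define u where "u n x = B (h n (j n (fst x))) (snd x)" for n and x :: "real \<times> 'w"
  have [measurable]: "j n \<in> measurable (restrict_space lborel {0..T}) (count_space UNIV)" for n
    unfolding j_def by (rule measurable_restrict_space1) measurable
  have um: "u n \<in> borel_measurable (time_prod M T)" for n
    unfolding u_def time_prod_def
  proof (rule measurable_compose_countable[where f="\<lambda>i x. B (h n i) (snd x)"])
    show "(\<lambda>x. B (h n i) (snd x)) \<in> borel_measurable (restrict_space lborel {0..T} \<Otimes>\<^sub>M M)" for i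
      using measurable_compose[OF measurable_snd B_measurable[OF h]] .
  qed measurable
  define B' where "B' t \<omega> = lim (\<lambda>n. u n (t, \<omega>))" for t \<omega>
  have "(\<lambda>x. lim (\<lambda>n. u n x)) \<in> borel_measurable (time_prod M T)"
    by (rule borel_measurable_lim_metric[OF um])
  moreover have "case_prod B' = (\<lambda>x. lim (\<lambda>n. u n x))" by (auto simp: B'_def)
  ultimately have 1: "case_prod B' \<in> borel_measurable (time_prod M T)" by simp
  have "AE \<omega> in M. continuous_on {0..T} (\<lambda>t. B t \<omega>)" using BM by (simp add: brownian_motion_def)
  hence "AE \<omega> in M. \<forall>t\<in>{0..T}. B' t \<omega> = B t \<omega>"
  proof eventually_elim
    case (elim \<omega>)
    show ?case
    proof
      fix t assume t: "t \<in> {0..T}"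
      have "(\<lambda>n. h n (j n t)) \<longlonglongrightarrow> t"
      proof (rule LIM_zero_cancel, rule Lim_null_comparison)
        show "\<forall>\<^sub>F n in sequentially. norm (h n (j n t) - t) \<le> T / real (Suc n)" using hj[OF t] by auto
        show "(\<lambda>n. T / real (Suc n)) \<longlonglongrightarrow> 0" by (rule LIMSEQ_Suc[OF lim_const_over_n])
      qed
      hence "(\<lambda>n. B (h n (j n t)) \<omega>) \<longlonglongrightarrow> B t \<omega>"
        using h by (intro continuous_on_tendsto_compose[OF elim _ t]) auto
      thus "B' t \<omega> = B t \<omega>" unfolding B'_def u_def by (simp add: limI)
    qed
  qed
  with 1 show thesis by (rule that)
qed

end

section \<open>Controls and states as processes on the time interval\<close>

lemma (in complete_measure) borel_measurable_cong_AE_complete: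
  fixes f g :: "'a \<Rightarrow> 'b::topological_space"
  assumes f: "f \<in> borel_measurable M" and ae: "AE x in M. f x = g x"
  shows "g \<in> borel_measurable M"
proof (rule measurableI)
  fix A :: "'b set" assume A: "A \<in> sets borel"
  show "g -` A \<inter> space M \<in> sets M"
  proof (rule in_sets_AE)
    show "f -` A \<inter> space M \<in> sets M" using measurable_sets[OF f A] .
    show "AE x in M. x \<in> f -` A \<inter> space M \<longleftrightarrow> x \<in> g -` A \<inter> space M"
      using ae by eventually_elim auto
  qed auto
qed simp

lemma HT_add:
  assumes "\<alpha> \<in> HT M T F" "\<beta> \<in> HT M T F"
  shows "(\<lambda>t \<omega>. \<alpha> t \<omega> + \<beta> t \<omega>) \<in> HT M T F"
proof -
  have "(\<lambda>x. case_prod \<alpha> x + case_prod \<beta> x) \<in> L2 (time_prod M T)"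
    using assms by (intro L2_add) (auto simp: HT_def L2_def case_prod_beta')
  thus ?thesis using assms by (auto simp: HT_def L2_def case_prod_beta' intro: borel_measurable_add)
qed

lemma HT_scaleR:
  assumes "\<alpha> \<in> HT M T F"
  shows "(\<lambda>t \<omega>. c *\<^sub>R \<alpha> t \<omega>) \<in> HT M T F"
proof -
  have "(\<lambda>x. c *\<^sub>R case_prod \<alpha> x) \<in> L2 (time_prod M T)"
    using assms by (intro L2_scaleR) (auto simp: HT_def L2_def case_prod_beta')
  thus ?thesis using assms by (auto simp: HT_def L2_def case_prod_beta' intro: borel_measurable_scaleR)
qed

lemma HT_diff:
  assumes "\<alpha> \<in> HT M T F" "\<beta> \<in> HT M T F"
  shows "(\<lambda>t \<omega>. \<alpha> t \<omega> - \<beta> t \<omega>) \<in> HT M T F"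
  using HT_add[OF assms(1) HT_scaleR[OF assms(2), of "-1"]] by simp

lemma HT_zero: "(\<lambda>t \<omega>. 0) \<in> HT M T F"
  by (auto simp: HT_def case_prod_beta')

lemma HT_sum:
  assumes "\<And>i. i \<in> I \<Longrightarrow> \<alpha> i \<in> HT M T F"
  shows "(\<lambda>t \<omega>. \<Sum>i\<in>I. \<alpha> i t \<omega>) \<in> HT M T F"
  using assms by (induction I rule: infinite_finite_induct) (auto intro: HT_zero HT_add)

lemma HT_L2: "\<alpha> \<in> HT M T F \<Longrightarrow> case_prod \<alpha> \<in> L2 (time_prod M T)"
  by (auto simp: HT_def L2_def case_prod_beta')

context brownian_setting
begin

abbreviation "TT \<equiv> restrict_space lborel {0..T}"
abbreviation "PP \<equiv> time_prod M T"

lemma PP_eq: "PP = TT \<Otimes>\<^sub>M M" by (simp add: time_prod_def)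

sublocale TT: finite_measure TT
  by (rule finite_measureI) (use T_pos in \<open>simp add: emeasure_restrict_space space_restrict_space\<close>)

sublocale pair_sigma_finite TT M ..

sublocale PP: finite_measure PP
  unfolding PP_eq by (rule finite_measure_pair_measure) unfold_locales

lemma space_TT: "space TT = {0..T}" by (simp add: space_restrict_space)

lemma space_PP: "space PP = {0..T} \<times> space M" by (simp add: PP_eq space_pair_measure space_TT)

lemma measure_TT: "measure TT (space TT) = T"
  using T_pos by (simp add: space_TT measure_restrict_space)

lemma AE_PP_fst: "AE x in PP. Q x \<Longrightarrow> AE t in TT. AE \<omega> in M. Q (t, \<omega>)"
  unfolding PP_eq by (rule AE_pair)

lemma AE_PP_snd: assumes "AE x in PP. Q x" shows "AE \<omega> in M. AE t in TT. Q (t, \<omega>)"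
proof -
  interpret S: pair_sigma_finite M TT ..
  from assms obtain N where N: "N \<in> null_sets PP" "{x \<in> space PP. \<not> Q x} \<subseteq> N"
    by (auto elim: AE_E3 simp: null_sets_def eventually_ae_filter)
  have Nm: "N \<in> sets PP" using N by auto
  have "AE x in PP. x \<notin> N" using N(1) by (rule AE_not_in)
  hence "AE t in TT. AE \<omega> in M. (t, \<omega>) \<notin> N" by (rule AE_PP_fst)
  moreover have "{x \<in> space (TT \<Otimes>\<^sub>M M). (fst x, snd x) \<notin> N} \<in> sets (TT \<Otimes>\<^sub>M M)"
    using Nm by (simp add: PP_eq)
  ultimately have "AE \<omega> in M. AE t in TT. (t, \<omega>) \<notin> N"
    using AE_commute[of "\<lambda>t \<omega>. (t, \<omega>) \<notin> N"] by simp
  with AE_space[of M] show ?thesis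
  proof eventually_elim
    case (elim \<omega>)
    from elim(2) AE_space[of TT] show ?case
    proof eventually_elim
      fix t assume "(t, \<omega>) \<notin> N" "t \<in> space TT"
      moreover from this have "(t, \<omega>) \<in> space PP" using elim(1) by (auto simp: space_PP space_TT)
      ultimately show "Q (t, \<omega>)" using N(2) by blast
    qed
  qed
qed

text \<open>
The exceptional null set may not depend on \<open>t\<close>: then no measurability of \<open>Q\<close> is required to pass to
the product measure.
\<close>

lemma AE_PP_of_paths:
  assumes G: "G \<in> sets TT" "AE t in TT. t \<in> G"
    and Q: "AE \<omega> in M. \<forall>t\<in>G. Q t \<omega>"
  shows "AE x in PP. Q (fst x) (snd x)"
proof -
  obtain N where N: "N \<in> null_sets M" "{\<omega> \<in> space M. \<not> (\<forall>t\<in>G. Q t \<omega>)} \<subseteq> N"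
    using Q by (auto simp: eventually_ae_filter)
  have "AE \<omega> in M. \<omega> \<notin> N" using N(1) by (rule AE_not_in)
  hence "AE t in TT. AE \<omega> in M. t \<in> G \<and> \<omega> \<notin> N" using G(2) by auto
  moreover have "{x \<in> space (TT \<Otimes>\<^sub>M M). fst x \<in> G \<and> snd x \<notin> N} \<in> sets (TT \<Otimes>\<^sub>M M)"
  proof -
    have [measurable]: "G \<in> sets TT" "N \<in> sets M" using G N by auto
    show ?thesis by measurable
  qed
  ultimately have "AE x in PP. fst x \<in> G \<and> snd x \<notin> N"
    unfolding PP_eq by (subst AE_pair_iff[symmetric]) auto
  moreover have "AE x in PP. x \<in> space PP" by (rule AE_space)
  ultimately show ?thesis
  proof eventually_elim
    case (elim x)
    hence "snd x \<in> space M" by (auto simp: space_PP)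
    hence "\<forall>t\<in>G. Q t (snd x)" using N(2) elim(1) by blast
    thus ?case using elim(1) by blast
  qed
qed

text \<open>
Time integrals over \<^const>\<open>lebesgue\<close> see only the almost everywhere class of the integrand. Any measurable
representative \<open>f'\<close> on \<open>[0,T]\<close> computes them, whatever \<open>f\<close> does on a null set or outside the interval.
\<close>

lemma lebesgue_integral_eq_TT:
  fixes f :: "real \<Rightarrow> 'v::euclidean_space"
  assumes ab: "0 \<le> a" "b \<le> T" and f': "f' \<in> borel_measurable TT" and ae: "AE s in TT. f s = f' s"
  shows "(LINT s:{a..b}|lebesgue. f s) = (\<integral>s. indicat_real {a..b} s *\<^sub>R f' s \<partial>TT)"
proof -
  have T: "{0..T} \<inter> space lborel \<in> sets lborel" by simp
  let ?h = "\<lambda>s. indicat_real {a..b} s *\<^sub>R f s" 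
  let ?h' = "\<lambda>s. indicat_real {a..b} s *\<^sub>R (indicat_real {0..T} s *\<^sub>R f' s)"
  have f'm: "(\<lambda>s. indicat_real {0..T} s *\<^sub>R f' s) \<in> borel_measurable lborel"
    using f' borel_measurable_restrict_space_iff[OF T] by blast
  have h'm: "?h' \<in> borel_measurable lborel"
    by (intro borel_measurable_scaleR f'm borel_measurable_indicator) auto
  have "AE s in lborel. s \<in> {0..T} \<longrightarrow> f s = f' s" using ae by (simp add: AE_restrict_space_iff)
  hence "AE s in lborel. ?h' s = ?h s"
    by eventually_elim (use ab in \<open>auto simp: indicator_def\<close>)
  hence ae': "AE s in lebesgue. ?h' s = ?h s" by (rule AE_completion)
  have "?h \<in> borel_measurable lebesgue"
    by (rule completion.borel_measurable_cong_AE_complete[OF measurable_completion[OF h'm] ae'])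
  moreover have "AE s in lebesgue. ?h s = ?h' s" using ae' by eventually_elim (rule sym)
  ultimately have "(\<integral>s. ?h s \<partial>lebesgue) = (\<integral>s. ?h' s \<partial>lebesgue)"
    by (rule integral_cong_AE[OF _ measurable_completion[OF h'm]])
  also have "\<dots> = (\<integral>s. ?h' s \<partial>lborel)" by (rule integral_completion[OF h'm])
  also have "\<dots> = (\<integral>s. indicat_real {a..b} s *\<^sub>R f' s \<partial>TT)"
    by (subst integral_restrict_space[OF T]) (simp add: mult.commute)
  finally show ?thesis by (simp add: set_lebesgue_integral_def)
qed

text \<open>
The integral \<open>\<integral>\<^sub>0\<^sup>t \<alpha>\<^sub>s ds\<close>, taken over the fixed interval \<open>[0,T]\<close> with an indicator, so that Fubini's theorem
yields joint measurability in \<open>(t, \<omega>)\<close>.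
\<close>

definition primitive :: "(real \<Rightarrow> 'w \<Rightarrow> 'v::euclidean_space) \<Rightarrow> real \<Rightarrow> 'w \<Rightarrow> 'v" where
  "primitive \<alpha> t \<omega> = (\<integral>s. indicat_real {0..t} s *\<^sub>R \<alpha> s \<omega> \<partial>TT)"

lemma PP_section_measurable:
  assumes "f \<in> borel_measurable PP"
  shows "\<omega> \<in> space M \<Longrightarrow> (\<lambda>t. f (t, \<omega>)) \<in> borel_measurable TT"
    and "t \<in> {0..T} \<Longrightarrow> (\<lambda>\<omega>. f (t, \<omega>)) \<in> borel_measurable M"
  using assms unfolding PP_eq
  by (auto intro: measurable_Pair1 measurable_Pair2[where x=t] simp: space_TT)

lemma lebesgue_integral_eq_primitive:
  assumes "case_prod \<alpha> \<in> borel_measurable PP" "\<omega> \<in> space M" "t \<in> {0..T}"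
  shows "(LINT s:{0..t}|lebesgue. \<alpha> s \<omega>) = primitive \<alpha> t \<omega>"
  unfolding primitive_def using assms PP_section_measurable(1)[OF assms(1,2)]
  by (intro lebesgue_integral_eq_TT) auto

lemma primitive_jointly_measurable:
  assumes "case_prod \<alpha> \<in> borel_measurable PP"
  shows "case_prod (primitive \<alpha>) \<in> borel_measurable PP"
proof -
  have *: "(\<lambda>x. case_prod \<alpha> (snd x, snd (fst x))) \<in> borel_measurable ((TT \<Otimes>\<^sub>M M) \<Otimes>\<^sub>M TT)"
    by (rule measurable_compose[OF _ assms[unfolded PP_eq]]) measurable
  have [measurable]: "(\<lambda>x. x) \<in> borel_measurable TT" by (rule measurable_restrict_space1) simp
  have r: "(\<lambda>x. fst (fst x)) \<in> borel_measurable ((TT \<Otimes>\<^sub>M M) \<Otimes>\<^sub>M TT)" "(\<lambda>x. snd x) \<in> borel_measurable ((TT \<Otimes>\<^sub>M M) \<Otimes>\<^sub>M TT)"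
    by measurable
  have "Measurable.pred ((TT \<Otimes>\<^sub>M M) \<Otimes>\<^sub>M TT) (\<lambda>x. 0 \<le> snd x \<and> snd x \<le> fst (fst x))"
    using r by measurable
  hence "(\<lambda>x. if 0 \<le> snd x \<and> snd x \<le> fst (fst x) then \<alpha> (snd x) (snd (fst x)) else 0) \<in> borel_measurable ((TT \<Otimes>\<^sub>M M) \<Otimes>\<^sub>M TT)"
    using * by (intro measurable_If) auto
  hence "(\<lambda>y. \<integral>s. (if 0 \<le> s \<and> s \<le> fst y then \<alpha> s (snd y) else 0) \<partial>TT) \<in> borel_measurable (TT \<Otimes>\<^sub>M M)"
    by (intro TT.borel_measurable_lebesgue_integral) (simp add: case_prod_beta')
  moreover have "primitive \<alpha> (fst y) (snd y) = (\<integral>s. (if 0 \<le> s \<and> s \<le> fst y then \<alpha> s (snd y) else 0) \<partial>TT)" for y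
    unfolding primitive_def by (intro Bochner_Integration.integral_cong) auto
  ultimately show ?thesis by (simp add: PP_eq case_prod_beta')
qed

lemma L2_PP_paths:
  fixes f :: "real \<times> 'w \<Rightarrow> 'v::euclidean_space"
  assumes "f \<in> L2 PP" shows "AE \<omega> in M. (\<lambda>t. f (t, \<omega>)) \<in> L2 TT"
proof -
  have "integrable (TT \<Otimes>\<^sub>M M) (\<lambda>(t, \<omega>). (norm (f (t, \<omega>)))\<^sup>2)"
    using L2_D(2)[OF assms] by (simp add: PP_eq case_prod_beta')
  from AE_integrable_snd[OF this] have "AE \<omega> in M. integrable TT (\<lambda>t. (norm (f (t, \<omega>)))\<^sup>2)" .
  with AE_space show ?thesis
    by eventually_elim (use PP_section_measurable(1)[OF L2_D(1)[OF assms]] in \<open>auto simp: L2_def\<close>)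
qed

lemma L2_PP_times:
  fixes f :: "real \<times> 'w \<Rightarrow> 'v::euclidean_space"
  assumes "f \<in> L2 PP" shows "AE t in TT. (\<lambda>\<omega>. f (t, \<omega>)) \<in> L2 M"
proof -
  have "integrable (TT \<Otimes>\<^sub>M M) (\<lambda>x. (norm (f x))\<^sup>2)"
    using L2_D(2)[OF assms] by (simp add: PP_eq)
  from AE_integrable_fst'[OF this] have "AE t in TT. integrable M (\<lambda>\<omega>. (norm (f (t, \<omega>)))\<^sup>2)" .
  with AE_space[of TT] show ?thesis
    by eventually_elim (use PP_section_measurable(2)[OF L2_D(1)[OF assms]] in \<open>auto simp: L2_def space_TT\<close>)
qed

lemma good_times:
  fixes f :: "real \<Rightarrow> 'w \<Rightarrow> 'v::euclidean_space"
  assumes "case_prod f \<in> L2 PP"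
  obtains G where "G \<in> sets TT" "AE t in TT. t \<in> G" "\<And>t. t \<in> G \<Longrightarrow> f t \<in> L2 M" "\<And>t. t \<in> G \<Longrightarrow> t \<in> {0..T}"
proof -
  obtain N where N: "N \<in> null_sets TT" "{t \<in> space TT. (\<lambda>\<omega>. case_prod f (t, \<omega>)) \<notin> L2 M} \<subseteq> N"
    using L2_PP_times[OF assms] by (auto simp: eventually_ae_filter)
  show thesis
  proof (rule that[of "space TT - N"])
    show "AE t in TT. t \<in> space TT - N" using AE_not_in[OF N(1)] AE_space[of TT] by eventually_elim auto
    show "space TT - N \<in> sets TT" using N(1) by (intro sets.compl_sets null_setsD2)
  qed (use N in \<open>auto simp: space_TT\<close>)
qed

lemma integral_PP_swap:
  fixes f :: "real \<times> 'w \<Rightarrow> 'v::euclidean_space"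
  assumes "integrable PP f"
  shows "(\<integral>\<omega>. (\<integral>t. f (t, \<omega>) \<partial>TT) \<partial>M) = integral\<^sup>L PP f" "(\<integral>t. (\<integral>\<omega>. f (t, \<omega>) \<partial>M) \<partial>TT) = integral\<^sup>L PP f"
    "integrable M (\<lambda>\<omega>. \<integral>t. f (t, \<omega>) \<partial>TT)" "integrable TT (\<lambda>t. \<integral>\<omega>. f (t, \<omega>) \<partial>M)"
  using integral_snd[of "\<lambda>t \<omega>. f (t, \<omega>)"] integral_fst'[of f] integrable_snd[of "\<lambda>t \<omega>. f (t, \<omega>)"] integrable_fst'[of f] assms
  by (simp_all add: PP_eq case_prod_beta')

lemma innerT_eq:
  assumes "case_prod \<alpha> \<in> L2 PP" "case_prod \<beta> \<in> L2 PP"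
  shows "innerT M T \<alpha> \<beta> = L2_inner PP (case_prod \<alpha>) (case_prod \<beta>)"
proof -
  let ?f = "\<lambda>x. case_prod \<alpha> x \<bullet> case_prod \<beta> x"
  have i: "integrable PP ?f" by (rule L2_integrable_inner[OF assms])
  have "(LINT t:{0..T}|lebesgue. \<alpha> t \<omega> \<bullet> \<beta> t \<omega>) = (\<integral>t. ?f (t, \<omega>) \<partial>TT)" if w: "\<omega> \<in> space M" for \<omega>
  proof -
    have "(LINT t:{0..T}|lebesgue. \<alpha> t \<omega> \<bullet> \<beta> t \<omega>) = (\<integral>t. indicat_real {0..T} t *\<^sub>R (\<alpha> t \<omega> \<bullet> \<beta> t \<omega>) \<partial>TT)"
      using PP_section_measurable(1)[OF borel_measurable_integrable[OF i] w]
      by (intro lebesgue_integral_eq_TT) auto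
    also have "\<dots> = (\<integral>t. ?f (t, \<omega>) \<partial>TT)"
      by (intro Bochner_Integration.integral_cong) (auto simp: space_TT)
    finally show ?thesis .
  qed
  hence "innerT M T \<alpha> \<beta> = (\<integral>\<omega>. (\<integral>t. ?f (t, \<omega>) \<partial>TT) \<partial>M)"
    unfolding innerT_def by (intro Bochner_Integration.integral_cong) auto
  thus ?thesis unfolding integral_PP_swap(1)[OF i] L2_inner_def .
qed

lemma normT_eq:
  assumes "case_prod \<alpha> \<in> L2 PP" shows "normT M T \<alpha> = L2_norm PP (case_prod \<alpha>)"
  by (simp add: normT_def L2_norm_def innerT_eq[OF assms assms])

text \<open>
Cauchy-Schwarz in time; the bound does not depend on \<open>t\<close>.
\<close>

lemma primitive_bound:
  assumes "(\<lambda>s. \<alpha> s \<omega>) \<in> L2 TT"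
  shows "(norm (primitive \<alpha> t \<omega>))\<^sup>2 \<le> T * (\<integral>s. (norm (\<alpha> s \<omega>))\<^sup>2 \<partial>TT)"
proof -
  have i: "integrable TT (\<lambda>s. norm (\<alpha> s \<omega>))" by (rule TT.L2_integrable_norm[OF assms])
  have 1: "(\<lambda>s. 1 :: real) \<in> L2 TT" by (rule TT.L2_bounded[where c=1]) auto
  have n: "(\<lambda>s. norm (\<alpha> s \<omega>)) \<in> L2 TT" using assms by (auto simp: L2_def)
  have "norm (primitive \<alpha> t \<omega>) \<le> (\<integral>s. norm (indicat_real {0..t} s *\<^sub>R \<alpha> s \<omega>) \<partial>TT)"
    unfolding primitive_def by (rule integral_norm_bound)
  also have "\<dots> \<le> (\<integral>s. norm (\<alpha> s \<omega>) \<partial>TT)"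
  proof (rule integral_mono'[OF i])
    show "norm (indicat_real {0..t} s *\<^sub>R \<alpha> s \<omega>) \<le> norm (\<alpha> s \<omega>)" for s by (auto simp: indicator_def)
  qed auto
  also have "\<dots> = L2_inner TT (\<lambda>s. 1) (\<lambda>s. norm (\<alpha> s \<omega>))" by (simp add: L2_inner_def)
  also have "\<dots> \<le> L2_norm TT (\<lambda>s. 1 :: real) * L2_norm TT (\<lambda>s. norm (\<alpha> s \<omega>))"
    using L2_Cauchy_Schwarz[OF 1 n] by linarith
  finally have "(norm (primitive \<alpha> t \<omega>))\<^sup>2 \<le> (L2_norm TT (\<lambda>s. 1 :: real) * L2_norm TT (\<lambda>s. norm (\<alpha> s \<omega>)))\<^sup>2"
    by (intro power_mono) auto
  thus ?thesis using measure_TT T_pos by (simp add: power_mult_distrib L2_norm_sq)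
qed

lemma integrable_const_in_time:
  fixes w :: "'w \<Rightarrow> 'v::euclidean_space"
  assumes "integrable M w" shows "integrable PP (\<lambda>x. w (snd x))"
  unfolding PP_eq
proof (rule Fubini_integrable)
  show "(\<lambda>x. w (snd x)) \<in> borel_measurable (TT \<Otimes>\<^sub>M M)"
    by (rule measurable_compose[OF measurable_snd borel_measurable_integrable[OF assms]])
qed (use assms in auto)

lemma primitive_L2:
  fixes \<alpha> :: "real \<Rightarrow> 'w \<Rightarrow> 'v::euclidean_space"
  assumes \<alpha>: "case_prod \<alpha> \<in> L2 PP"
  shows "t \<in> {0..T} \<Longrightarrow> primitive \<alpha> t \<in> L2 M" and "case_prod (primitive \<alpha>) \<in> L2 PP"
proof -
  let ?w = "\<lambda>\<omega>. T * (\<integral>s. (norm (\<alpha> s \<omega>))\<^sup>2 \<partial>TT)"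
  have wi: "integrable M ?w"
    using integral_PP_swap(3)[OF L2_D(2)[OF \<alpha>]] by simp
  have m: "case_prod (primitive \<alpha>) \<in> borel_measurable PP" by (rule primitive_jointly_measurable[OF L2_D(1)[OF \<alpha>]])
  have ae: "AE \<omega> in M. \<forall>t\<in>space TT. (norm (primitive \<alpha> t \<omega>))\<^sup>2 \<le> ?w \<omega>"
    using L2_PP_paths[OF \<alpha>] by eventually_elim (use primitive_bound in auto)
  show "primitive \<alpha> t \<in> L2 M" if t: "t \<in> {0..T}"
  proof (rule L2_dominated[OF _ wi])
    show "primitive \<alpha> t \<in> borel_measurable M" using PP_section_measurable(2)[OF m t] by simp
    show "AE \<omega> in M. (norm (primitive \<alpha> t \<omega>))\<^sup>2 \<le> ?w \<omega>" using ae by eventually_elim (use t space_TT in auto)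
  qed
  show "case_prod (primitive \<alpha>) \<in> L2 PP"
  proof (rule L2_dominated[OF m, where w="\<lambda>x. ?w (snd x)"])
    show "integrable PP (\<lambda>x. ?w (snd x))"
      by (rule integrable_const_in_time[OF wi])
    have "AE x in PP. (norm (primitive \<alpha> (fst x) (snd x)))\<^sup>2 \<le> ?w (snd x)"
      by (rule AE_PP_of_paths[OF sets.top AE_space ae])
    thus "AE x in PP. (norm (case_prod (primitive \<alpha>) x))\<^sup>2 \<le> ?w (snd x)" by (simp add: case_prod_beta')
  qed
qed

lemma L2_const_in_time:
  fixes X :: "'w \<Rightarrow> 'v::euclidean_space"
  assumes "X \<in> L2 M" shows "(\<lambda>x. X (snd x)) \<in> L2 PP"
  using integrable_const_in_time[OF L2_D(2)[OF assms]] measurable_compose[OF measurable_snd L2_D(1)[OF assms], of TT]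
  by (simp add: L2_def PP_eq)

lemma B_version:
  obtains B' where "case_prod B' \<in> L2 PP" "AE \<omega> in M. \<forall>t\<in>{0..T}. B' t \<omega> = B t \<omega>"
proof -
  obtain B' where B': "case_prod B' \<in> borel_measurable PP" and ae: "AE \<omega> in M. \<forall>t\<in>{0..T}. B' t \<omega> = B t \<omega>"
    by (rule B_jointly_measurable)
  have "case_prod B' \<in> L2 PP"
  proof -
    have "(\<integral>\<^sup>+ x. ennreal ((norm (case_prod B' x))\<^sup>2) \<partial>PP) = (\<integral>\<^sup>+ t. (\<integral>\<^sup>+ \<omega>. ennreal ((norm (B' t \<omega>))\<^sup>2) \<partial>M) \<partial>TT)"
    proof -
      have "(\<lambda>x. ennreal ((norm (case_prod B' x))\<^sup>2)) \<in> borel_measurable (TT \<Otimes>\<^sub>M M)"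
        using B' unfolding PP_eq by measurable
      moreover have "sigma_finite_measure M" by unfold_locales
      ultimately have "(\<integral>\<^sup>+ t. (\<integral>\<^sup>+ \<omega>. ennreal ((norm (case_prod B' (t, \<omega>)))\<^sup>2) \<partial>M) \<partial>TT) = (\<integral>\<^sup>+ x. ennreal ((norm (case_prod B' x))\<^sup>2) \<partial>(TT \<Otimes>\<^sub>M M))"
        by (intro sigma_finite_measure.nn_integral_fst)
      thus ?thesis unfolding PP_eq by simp
    qed
    also have "\<dots> \<le> (\<integral>\<^sup>+ t. ennreal (real CARD('d) * T) \<partial>TT)"
    proof (rule nn_integral_mono)
      fix t assume "t \<in> space TT"
      hence t: "t \<in> {0..T}" by (simp add: space_TT)
      have "(\<integral>\<^sup>+ \<omega>. ennreal ((norm (B' t \<omega>))\<^sup>2) \<partial>M) = (\<integral>\<^sup>+ \<omega>. ennreal ((norm (B t \<omega>))\<^sup>2) \<partial>M)"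
      proof (rule nn_integral_cong_AE)
        show "AE \<omega> in M. ennreal ((norm (B' t \<omega>))\<^sup>2) = ennreal ((norm (B t \<omega>))\<^sup>2)"
          using ae by eventually_elim (use t in auto)
      qed
      also have "\<dots> = ennreal (expectation (\<lambda>\<omega>. (norm (B t \<omega>))\<^sup>2))"
        by (intro nn_integral_eq_integral L2_D B_L2 t) auto
      also have "\<dots> \<le> ennreal (real CARD('d) * T)" by (intro ennreal_leI B_L2 t)
      finally show "(\<integral>\<^sup>+ \<omega>. ennreal ((norm (B' t \<omega>))\<^sup>2) \<partial>M) \<le> ennreal (real CARD('d) * T)" .
    qed
    also have "\<dots> < \<infinity>"
    proof -
      have "emeasure TT {0..T} < \<top>" unfolding less_top[symmetric] by (rule TT.emeasure_finite)
      thus ?thesis by (simp add: space_TT ennreal_mult_less_top)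
    qed
    finally have fin: "(\<integral>\<^sup>+ x. ennreal ((norm (case_prod B' x))\<^sup>2) \<partial>PP) < \<infinity>" .
    have "integrable PP (\<lambda>x. (norm (case_prod B' x))\<^sup>2)"
      by (rule integrableI_bounded) (use B' fin in auto)
    thus ?thesis using B' by (simp add: L2_def)
  qed
  thus thesis using ae by (rule that)
qed

text \<open>
The state inherits from \<open>B\<close> the lack of joint measurability, and is replaced by an indistinguishable
process whenever it is integrated in time.
\<close>

lemma state_version:
  assumes \<alpha>: "case_prod \<alpha> \<in> L2 PP"
  obtains X where "case_prod X \<in> L2 PP" "AE \<omega> in M. \<forall>t\<in>{0..T}. X t \<omega> = state \<sigma> X0 B \<alpha> t \<omega>"
proof -
  obtain B' where B': "case_prod B' \<in> L2 PP" and ae: "AE \<omega> in M. \<forall>t\<in>{0..T}. B' t \<omega> = B t \<omega>"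
    by (rule B_version)
  let ?X = "\<lambda>t \<omega>. X0 \<omega> - primitive \<alpha> t \<omega> + sqrt (2 * \<sigma>) *\<^sub>R B' t \<omega>"
  show thesis
  proof (rule that)
    have "(\<lambda>x. X0 (snd x) - case_prod (primitive \<alpha>) x + sqrt (2 * \<sigma>) *\<^sub>R case_prod B' x) \<in> L2 PP"
      by (intro L2_add L2_diff L2_scaleR L2_const_in_time X0 primitive_L2 \<alpha> B')
    thus "case_prod ?X \<in> L2 PP" by (simp add: case_prod_beta')
    show "AE \<omega> in M. \<forall>t\<in>{0..T}. ?X t \<omega> = state \<sigma> X0 B \<alpha> t \<omega>"
      using ae AE_space
      by eventually_elim (auto simp: state_def lebesgue_integral_eq_primitive[OF L2_D(1)[OF \<alpha>]])
  qed
qed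

lemma state_eq:
  assumes "case_prod \<alpha> \<in> L2 PP" "\<omega> \<in> space M" "t \<in> {0..T}"
  shows "state \<sigma> X0 B \<alpha> t \<omega> = X0 \<omega> - primitive \<alpha> t \<omega> + sqrt (2 * \<sigma>) *\<^sub>R B t \<omega>"
  by (simp add: state_def lebesgue_integral_eq_primitive[OF L2_D(1)[OF assms(1)] assms(2,3)])

lemma state_L2:
  assumes \<alpha>: "case_prod \<alpha> \<in> L2 PP" and t: "t \<in> {0..T}"
  shows "state \<sigma> X0 B \<alpha> t \<in> L2 M"
proof -
  have "(\<lambda>\<omega>. X0 \<omega> - primitive \<alpha> t \<omega> + sqrt (2 * \<sigma>) *\<^sub>R B t \<omega>) \<in> L2 M"
    by (intro L2_add L2_diff L2_scaleR X0 primitive_L2 \<alpha> B_L2 t)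
  moreover have "state \<sigma> X0 B \<alpha> t \<omega> = X0 \<omega> - primitive \<alpha> t \<omega> + sqrt (2 * \<sigma>) *\<^sub>R B t \<omega>" if "\<omega> \<in> space M" for \<omega>
    by (rule state_eq[OF \<alpha> that t])
  ultimately show ?thesis unfolding L2_def
    by (auto cong: measurable_cong Bochner_Integration.integrable_cong)
qed

lemma integrable_TT_indicator:
  fixes f :: "real \<Rightarrow> 'v::euclidean_space"
  assumes "f \<in> L2 TT" "S \<in> sets borel"
  shows "integrable TT (\<lambda>s. indicat_real S s *\<^sub>R f s)"
proof (rule Bochner_Integration.integrable_bound[OF TT.L2_integrable[OF assms(1)]])
  have "(\<lambda>x. x) \<in> borel_measurable TT" by (rule measurable_restrict_space1) simp
  hence "indicat_real S \<in> borel_measurable TT"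
    using measurable_compose[of "\<lambda>x. x" TT borel "indicat_real S" borel] assms(2) by simp
  thus "(\<lambda>s. indicat_real S s *\<^sub>R f s) \<in> borel_measurable TT"
    using L2_D(1)[OF assms(1)] by (rule borel_measurable_scaleR)
qed (auto simp: indicator_def)

lemma primitive_linear:
  fixes \<alpha> \<beta> :: "real \<Rightarrow> 'w \<Rightarrow> 'v::euclidean_space"
  assumes \<alpha>: "(\<lambda>s. \<alpha> s \<omega>) \<in> L2 TT" and \<beta>: "(\<lambda>s. \<beta> s \<omega>) \<in> L2 TT"
  shows "primitive (\<lambda>t \<omega>. \<alpha> t \<omega> + c *\<^sub>R \<beta> t \<omega>) t \<omega> = primitive \<alpha> t \<omega> + c *\<^sub>R primitive \<beta> t \<omega>"
proof -
  note i = integrable_TT_indicator[where S="{0..t}", OF _ atLeastAtMost_borel]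
  have "indicat_real {0..t} s *\<^sub>R (\<alpha> s \<omega> + c *\<^sub>R \<beta> s \<omega>)
      = indicat_real {0..t} s *\<^sub>R \<alpha> s \<omega> + c *\<^sub>R (indicat_real {0..t} s *\<^sub>R \<beta> s \<omega>)" for s
    by (simp add: scaleR_add_right mult.commute)
  thus ?thesis unfolding primitive_def
    using i[OF \<alpha>] i[OF \<beta>] by (simp only: Bochner_Integration.integral_add integrable_scaleR_right integral_scaleR_right)
qed

lemma state_perturb:
  assumes \<alpha>: "case_prod \<alpha> \<in> L2 PP" and \<beta>: "case_prod \<beta> \<in> L2 PP"
  shows "AE \<omega> in M. \<forall>t\<in>{0..T}. state \<sigma> X0 B (\<lambda>t \<omega>. \<alpha> t \<omega> + c *\<^sub>R \<beta> t \<omega>) t \<omega> = state \<sigma> X0 B \<alpha> t \<omega> - c *\<^sub>R primitive \<beta> t \<omega>"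
proof -
  have s: "case_prod (\<lambda>t \<omega>. \<alpha> t \<omega> + c *\<^sub>R \<beta> t \<omega>) \<in> L2 PP"
    using L2_add[OF \<alpha> L2_scaleR[OF \<beta>, of c]] by (simp add: case_prod_beta')
  from L2_PP_paths[OF \<alpha>] L2_PP_paths[OF \<beta>] AE_space show ?thesis
    by eventually_elim (auto simp: state_eq[OF \<alpha>] state_eq[OF s] primitive_linear)
qed

end

section \<open>Lipschitz fields along a process\<close>

lemma W2_lipschitz_nonneg:
  assumes "W2_lipschitz K F" shows "W2_lipschitz \<bar>K\<bar> F"
  unfolding W2_lipschitz_def
proof (intro allI ballI)
  fix x y :: 'a and \<mu> \<nu> :: "'b measure" assume "\<mu> \<in> P2" "\<nu> \<in> P2"
  hence "dist (F x \<mu>) (F y \<nu>) \<le> K * (dist x y + W2 \<mu> \<nu>)" using assms by (auto simp: W2_lipschitz_def)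
  also have "\<dots> \<le> \<bar>K\<bar> * (dist x y + W2 \<mu> \<nu>)" by (intro mult_right_mono add_nonneg_nonneg W2_nonneg) auto
  finally show "dist (F x \<mu>) (F y \<nu>) \<le> \<bar>K\<bar> * (dist x y + W2 \<mu> \<nu>)" .
qed

lemma W2_lipschitz_D:
  assumes "W2_lipschitz K F" "\<mu> \<in> P2" "\<nu> \<in> P2"
  shows "dist (F x \<mu>) (F y \<nu>) \<le> K * (dist x y + W2 \<mu> \<nu>)"
  using assms by (auto simp: W2_lipschitz_def)

lemma W2_lipschitz_measurable:
  fixes F :: "'c::euclidean_space \<Rightarrow> 'b::euclidean_space measure \<Rightarrow> 'e::euclidean_space"
  assumes F: "W2_lipschitz K F" and m: "m \<in> P2"
  shows "(\<lambda>z. F z m) \<in> borel_measurable borel"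
proof (rule borel_measurable_continuous_onI)
  have "\<bar>K\<bar>-lipschitz_on UNIV (\<lambda>z. F z m)"
    using W2_lipschitz_D[OF W2_lipschitz_nonneg[OF F] m m] by (intro lipschitz_onI) (auto simp: W2_refl[OF m])
  thus "continuous_on UNIV (\<lambda>z. F z m)" by (rule lipschitz_on_continuous_on)
qed

context prob_space
begin

text \<open>
Linear growth in the position and in the second moment of the law: compare with the value at the origin
and the Dirac mass there.
\<close>

lemma lipschitz_law_bound:
  fixes F :: "'c::euclidean_space \<Rightarrow> 'b::euclidean_space measure \<Rightarrow> 'e::euclidean_space"
  assumes F: "W2_lipschitz K F" and Y: "Y \<in> L2 M"
  shows "norm (F z (law M Y)) \<le> norm (F 0 (law M (\<lambda>_. 0))) + \<bar>K\<bar> * (norm z + L2_norm M Y)"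
proof -
  have "dist (F z (law M Y)) (F 0 (law M (\<lambda>_. 0))) \<le> \<bar>K\<bar> * (dist z 0 + W2 (law M Y) (law M (\<lambda>_. 0)))"
    by (intro W2_lipschitz_D[OF W2_lipschitz_nonneg[OF F]] law_in_P2 Y L2_zero)
  also have "\<dots> \<le> \<bar>K\<bar> * (norm z + L2_norm M Y)"
    using W2_law_le[OF Y L2_zero] by (intro mult_left_mono) auto
  finally show ?thesis
    using norm_triangle_sub[of "F z (law M Y)" "F 0 (law M (\<lambda>_. 0))"] by (simp add: dist_norm)
qed

lemma lipschitz_law_L2:
  fixes F :: "'c::euclidean_space \<Rightarrow> 'b::euclidean_space measure \<Rightarrow> 'e::euclidean_space"
  assumes F: "W2_lipschitz K F" and Y: "Y \<in> L2 M" and Z: "Z \<in> L2 M"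
  shows "(\<lambda>\<omega>. F (Z \<omega>) (law M Y)) \<in> L2 M"
proof -
  let ?c = "norm (F 0 (law M (\<lambda>_. 0))) + \<bar>K\<bar> * L2_norm M Y"
  have "(\<lambda>\<omega>. ?c + \<bar>K\<bar> *\<^sub>R norm (Z \<omega>)) \<in> L2 M"
    using Z by (intro L2_add L2_scaleR L2_bounded[where X="\<lambda>_. ?c" and c="\<bar>?c\<bar>"]) (auto simp: L2_def)
  thus ?thesis
  proof (rule L2_norm_bound)
    show "(\<lambda>\<omega>. F (Z \<omega>) (law M Y)) \<in> borel_measurable M"
      using measurable_compose[OF L2_D(1)[OF Z] W2_lipschitz_measurable[OF F law_in_P2[OF Y]]] .
    fix \<omega>
    have "norm (F (Z \<omega>) (law M Y)) \<le> ?c + \<bar>K\<bar> *\<^sub>R norm (Z \<omega>)"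
      using lipschitz_law_bound[OF F Y, of "Z \<omega>"] by (simp add: algebra_simps)
    thus "norm (F (Z \<omega>) (law M Y)) \<le> norm (?c + \<bar>K\<bar> *\<^sub>R norm (Z \<omega>))" by simp
  qed
qed

end

context brownian_setting
begin

lemma L2_norm_in_time:
  fixes Y :: "real \<Rightarrow> 'w \<Rightarrow> 'v::euclidean_space"
  assumes "case_prod Y \<in> L2 PP"
  shows "(\<lambda>x. L2_norm M (Y (fst x))) \<in> L2 PP"
proof -
  have sq: "(L2_norm M (Y t))\<^sup>2 = (\<integral>\<omega>. (norm (case_prod Y (t, \<omega>)))\<^sup>2 \<partial>M)" for t by (simp add: L2_norm_sq)
  have i: "integrable TT (\<lambda>t. (L2_norm M (Y t))\<^sup>2)"
    unfolding sq by (rule integral_PP_swap(4)[OF L2_D(2)[OF assms]])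
  from borel_measurable_integrable[OF this] have "(\<lambda>t. sqrt ((L2_norm M (Y t))\<^sup>2)) \<in> borel_measurable TT"
    by measurable
  hence m: "(\<lambda>t. L2_norm M (Y t)) \<in> borel_measurable TT" by simp
  have "integrable (TT \<Otimes>\<^sub>M M) (\<lambda>x. (L2_norm M (Y (fst x)))\<^sup>2)"
  proof (rule Fubini_integrable)
    show "(\<lambda>x. (L2_norm M (Y (fst x)))\<^sup>2) \<in> borel_measurable (TT \<Otimes>\<^sub>M M)"
      using measurable_compose[OF measurable_fst m] by measurable
  qed (use i in \<open>auto simp: prob_space\<close>)
  thus ?thesis using measurable_compose[OF measurable_fst m] by (auto simp: L2_def PP_eq)
qed

lemma lipschitz_law_version:
  fixes F :: "'c::euclidean_space \<Rightarrow> 'b::euclidean_space measure \<Rightarrow> 'e::euclidean_space"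
  assumes F: "W2_lipschitz K F" and Y: "case_prod Y \<in> L2 PP" and Z: "case_prod Z \<in> L2 PP"
    and G: "G \<in> sets TT" "\<And>t. t \<in> G \<Longrightarrow> Y t \<in> L2 M"
  shows "(\<lambda>(t, \<omega>). if t \<in> G then F (Z t \<omega>) (law M (Y t)) else 0) \<in> L2 PP"
proof -
  let ?H = "\<lambda>(t, \<omega>). if t \<in> G then F (Z t \<omega>) (law M (Y t)) else 0"
  have "(\<lambda>(t, \<omega>). if t \<in> G then F (case_prod Z (t, \<omega>)) (law M (Y t)) else 0) \<in> borel_measurable PP"
    unfolding PP_eq
  proof (rule measurable_along_law_flow)
    show "case_prod Y \<in> borel_measurable (TT \<Otimes>\<^sub>M M)" "case_prod Z \<in> borel_measurable (TT \<Otimes>\<^sub>M M)"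
      using L2_D(1)[OF Y] L2_D(1)[OF Z] by (simp_all add: PP_eq)
    show "(\<lambda>z. F z m) \<in> borel_measurable borel" if "m \<in> P2" for m by (rule W2_lipschitz_measurable[OF F that])
    show "\<exists>d>0. \<forall>m'\<in>P2. W2 m m' < d \<longrightarrow> dist (F z m) (F z m') < e" if m: "m \<in> P2" and e: "e > 0" for z m e
    proof (intro exI conjI ballI impI)
      show "0 < e / (\<bar>K\<bar> + 1)" using e by simp
      fix m' assume m': "m' \<in> P2" "W2 m m' < e / (\<bar>K\<bar> + 1)"
      have "dist (F z m) (F z m') \<le> \<bar>K\<bar> * W2 m m'"
        using W2_lipschitz_D[OF W2_lipschitz_nonneg[OF F] m m'(1), of z z] by simp
      also have "\<dots> \<le> (\<bar>K\<bar> + 1) * W2 m m'" by (intro mult_right_mono W2_nonneg) auto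
      also have "\<dots> < e" using m'(2) by (simp add: field_simps)
      finally show "dist (F z m) (F z m') < e" .
    qed
  qed (use G in auto)
  hence Hm: "?H \<in> borel_measurable PP"
    by (rule measurable_cong[THEN iffD1, rotated]) auto
  let ?c = "norm (F 0 (law M (\<lambda>_. 0)))"
  have "(\<lambda>x. ?c + \<bar>K\<bar> *\<^sub>R (norm (case_prod Z x) + L2_norm M (Y (fst x)))) \<in> L2 PP"
    using Z by (intro L2_add L2_scaleR L2_norm_in_time Y PP.L2_bounded[where X="\<lambda>_. ?c" and c="?c"]) (auto simp: L2_def)
  thus ?thesis
  proof (rule L2_norm_bound[OF _ Hm])
    fix x :: "real \<times> 'w"
    obtain t \<omega> where x: "x = (t, \<omega>)" by (cases x)
    show "norm (?H x) \<le> norm (?c + \<bar>K\<bar> *\<^sub>R (norm (case_prod Z x) + L2_norm M (Y (fst x))))"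
    proof (cases "t \<in> G")
      case True
      have "norm (F (Z t \<omega>) (law M (Y t))) \<le> ?c + \<bar>K\<bar> *\<^sub>R (norm (Z t \<omega>) + L2_norm M (Y t))"
        using lipschitz_law_bound[OF F G(2)[OF True], of "Z t \<omega>"] by simp
      thus ?thesis using True by (simp add: x)
    qed (simp add: x)
  qed
qed

section \<open>Duality for the backward equation\<close>

lemma tail_integral_eq:
  fixes H :: "real \<Rightarrow> 'w \<Rightarrow> 'v::euclidean_space"
  assumes H: "(\<lambda>s. H s \<omega>) \<in> L2 TT" and t: "t \<in> {0..T}"
  shows "(\<integral>s. indicat_real {t..T} s *\<^sub>R H s \<omega> \<partial>TT) = primitive H T \<omega> - primitive H t \<omega>"
proof -
  have i: "integrable TT (\<lambda>s. indicat_real {a..b} s *\<^sub>R H s \<omega>)" for a b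
    by (rule integrable_TT_indicator[OF H]) simp
  have "AE s in lborel. s \<noteq> t" by (rule AE_lborel_singleton)
  hence ae: "AE s in TT. indicat_real {0..t} s *\<^sub>R H s \<omega> + indicat_real {t..T} s *\<^sub>R H s \<omega> = indicat_real {0..T} s *\<^sub>R H s \<omega>"
    unfolding AE_restrict_space_iff[of "{0..T}" lborel, simplified]
    by eventually_elim (use t in \<open>auto simp: indicator_def\<close>)
  have "primitive H T \<omega> = (\<integral>s. indicat_real {0..t} s *\<^sub>R H s \<omega> + indicat_real {t..T} s *\<^sub>R H s \<omega> \<partial>TT)"
    unfolding primitive_def using ae i
    by (intro integral_cong_AE borel_measurable_integrable Bochner_Integration.integrable_add)
       (auto elim!: eventually_mono)
  also have "\<dots> = primitive H t \<omega> + (\<integral>s. indicat_real {t..T} s *\<^sub>R H s \<omega> \<partial>TT)"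
    unfolding primitive_def by (rule Bochner_Integration.integral_add[OF i i])
  finally show ?thesis by simp
qed

text \<open>
Fubini's theorem on the triangle \<open>0 \<le> t \<le> s \<le> T\<close>.
\<close>

lemma pathwise_duality:
  fixes H \<beta> :: "real \<Rightarrow> 'w \<Rightarrow> 'v::euclidean_space"
  assumes H: "(\<lambda>s. H s \<omega>) \<in> L2 TT" and \<beta>: "(\<lambda>s. \<beta> s \<omega>) \<in> L2 TT"
  shows "(\<integral>t. (primitive H T \<omega> - primitive H t \<omega>) \<bullet> \<beta> t \<omega> \<partial>TT) = (\<integral>s. H s \<omega> \<bullet> primitive \<beta> s \<omega> \<partial>TT)"
proof -
  interpret D: pair_sigma_finite TT TT ..
  let ?f = "\<lambda>s t. indicat_real {0..s} t *\<^sub>R (H s \<omega> \<bullet> \<beta> t \<omega>)"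
  have id: "(\<lambda>x. x) \<in> borel_measurable TT" by (rule measurable_restrict_space1) simp
  have Hm: "(\<lambda>s. H s \<omega>) \<in> borel_measurable TT" and \<beta>m: "(\<lambda>s. \<beta> s \<omega>) \<in> borel_measurable TT"
    using H \<beta> by (auto dest: L2_D)
  have fm: "case_prod ?f \<in> borel_measurable (TT \<Otimes>\<^sub>M TT)"
  proof -
    note [measurable] = measurable_compose[OF measurable_fst Hm] measurable_compose[OF measurable_snd \<beta>m]
      measurable_compose[OF measurable_fst id] measurable_compose[OF measurable_snd id]
    have "(\<lambda>x. if 0 \<le> snd x \<and> snd x \<le> fst x then H (fst x) \<omega> \<bullet> \<beta> (snd x) \<omega> else 0) \<in> borel_measurable (TT \<Otimes>\<^sub>M TT)"
      by measurable
    also have "(\<lambda>x. if 0 \<le> snd x \<and> snd x \<le> fst x then H (fst x) \<omega> \<bullet> \<beta> (snd x) \<omega> else 0) = case_prod ?f"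
      by (auto simp: indicator_def)
    finally show ?thesis .
  qed
  have fi: "integrable (TT \<Otimes>\<^sub>M TT) (case_prod ?f)"
  proof (rule Bochner_Integration.integrable_bound[where f="\<lambda>x. norm (H (fst x) \<omega>) * norm (\<beta> (snd x) \<omega>)"])
    show "integrable (TT \<Otimes>\<^sub>M TT) (\<lambda>x. norm (H (fst x) \<omega>) * norm (\<beta> (snd x) \<omega>))"
    proof (rule D.Fubini_integrable)
      show "(\<lambda>x. norm (H (fst x) \<omega>) * norm (\<beta> (snd x) \<omega>)) \<in> borel_measurable (TT \<Otimes>\<^sub>M TT)"
        using measurable_compose[OF measurable_fst Hm] measurable_compose[OF measurable_snd \<beta>m] by measurable
    qed (use TT.L2_integrable_norm[OF H] TT.L2_integrable_norm[OF \<beta>] in \<open>auto simp: abs_mult\<close>)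
    show "AE x in TT \<Otimes>\<^sub>M TT. norm (case_prod ?f x) \<le> norm (norm (H (fst x) \<omega>) * norm (\<beta> (snd x) \<omega>))"
      by (intro AE_I2) (auto simp: indicator_def Cauchy_Schwarz_ineq2)
  qed (rule fm)
  have "(\<integral>s. H s \<omega> \<bullet> primitive \<beta> s \<omega> \<partial>TT) = (\<integral>s. (\<integral>t. ?f s t \<partial>TT) \<partial>TT)"
  proof (rule Bochner_Integration.integral_cong[OF refl])
    fix s
    have "H s \<omega> \<bullet> primitive \<beta> s \<omega> = (\<integral>t. H s \<omega> \<bullet> (indicat_real {0..s} t *\<^sub>R \<beta> t \<omega>) \<partial>TT)"
      unfolding primitive_def by (rule integral_inner_right[symmetric]) (rule integrable_TT_indicator[OF \<beta>], simp)
    thus "H s \<omega> \<bullet> primitive \<beta> s \<omega> = (\<integral>t. ?f s t \<partial>TT)" by simp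
  qed
  also have "\<dots> = (\<integral>t. (\<integral>s. ?f s t \<partial>TT) \<partial>TT)"
    by (rule D.Fubini_integral[OF fi, symmetric])
  also have "\<dots> = (\<integral>t. (primitive H T \<omega> - primitive H t \<omega>) \<bullet> \<beta> t \<omega> \<partial>TT)"
  proof (rule Bochner_Integration.integral_cong[OF refl])
    fix t assume "t \<in> space TT"
    hence t: "t \<in> {0..T}" by (simp add: space_TT)
    have "(\<integral>s. ?f s t \<partial>TT) = (\<integral>s. (indicat_real {t..T} s *\<^sub>R H s \<omega>) \<bullet> \<beta> t \<omega> \<partial>TT)"
      using t by (intro Bochner_Integration.integral_cong) (auto simp: space_TT indicator_def)
    also have "\<dots> = (\<integral>s. indicat_real {t..T} s *\<^sub>R H s \<omega> \<partial>TT) \<bullet> \<beta> t \<omega>"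
      by (rule integral_inner_left) (rule integrable_TT_indicator[OF H], simp)
    finally show "(\<integral>s. ?f s t \<partial>TT) = (primitive H T \<omega> - primitive H t \<omega>) \<bullet> \<beta> t \<omega>"
      by (simp only: tail_integral_eq[where H=H and \<omega>=\<omega>, OF H t])
  qed
  finally show ?thesis by simp
qed

text \<open>
At each time the martingale part of \<open>U\<close> is orthogonal to the adapted \<open>\<beta>\<close>, so \<open>U\<close> may be replaced by
the non-adapted process \<open>\<Gamma> + \<integral>\<^sub>t\<^sup>T H\<^sub>s ds\<close>. For this process the pairing is evaluated path by path.
\<close>

lemma backward_duality:
  fixes U \<beta> :: "real \<Rightarrow> 'w \<Rightarrow> real ^ 'd"
  assumes \<Gamma>: "\<Gamma> \<in> L2 M" and H: "case_prod H \<in> L2 PP"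
    and U: "case_prod U \<in> L2 PP" and \<beta>: "\<beta> \<in> HT M T \<FF>"
    and ito: "is_ito_integral M T \<FF> B Z I"
    and eq: "\<And>t. t \<in> {0..T} \<Longrightarrow> AE \<omega> in M. U t \<omega> = \<Gamma> \<omega> + (\<integral>s. indicat_real {t..T} s *\<^sub>R H s \<omega> \<partial>TT) - (I T \<omega> - I t \<omega>)"
  shows "L2_inner PP (case_prod U) (case_prod \<beta>) = L2_inner M \<Gamma> (primitive \<beta> T) + L2_inner PP (case_prod H) (case_prod (primitive \<beta>))"
proof -
  note \<beta>2 = HT_L2[OF \<beta>]
  have TT: "T \<in> {0..T}" using T_pos by simp
  let ?R = "\<lambda>t \<omega>. \<Gamma> \<omega> + (primitive H T \<omega> - primitive H t \<omega>)"
  have R: "case_prod ?R \<in> L2 PP"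
  proof -
    have "(\<lambda>x. \<Gamma> (snd x) + (primitive H T (snd x) - case_prod (primitive H) x)) \<in> L2 PP"
      by (intro L2_add L2_diff L2_const_in_time \<Gamma> primitive_L2 H TT)
    thus ?thesis by (simp add: case_prod_beta')
  qed
  have RU: "AE t in TT. (\<integral>\<omega>. U t \<omega> \<bullet> \<beta> t \<omega> \<partial>M) = (\<integral>\<omega>. ?R t \<omega> \<bullet> \<beta> t \<omega> \<partial>M)"
    using L2_PP_times[OF \<beta>2] L2_PP_times[OF U] L2_PP_times[OF R] AE_space[of TT]
  proof eventually_elim
    case (elim t)
    hence t: "t \<in> {0..T}" and \<beta>t: "\<beta> t \<in> L2 M" and Ut: "U t \<in> L2 M" and Rt: "?R t \<in> L2 M" by (auto simp: space_TT)
    have \<beta>a: "\<beta> t \<in> borel_measurable (\<FF> t)" using \<beta> t by (simp add: HT_def)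
    have I: "(\<lambda>\<omega>. I T \<omega> - I t \<omega>) \<in> L2 M" by (intro L2_diff ito_integral_L2[OF ito] TT t)
    have "AE \<omega> in M. U t \<omega> = ?R t \<omega> - (I T \<omega> - I t \<omega>)"
      using eq[OF t] L2_PP_paths[OF H] by eventually_elim (use t in \<open>simp add: tail_integral_eq\<close>)
    hence "L2_inner M (U t) (\<beta> t) = L2_inner M (\<lambda>\<omega>. ?R t \<omega> - (I T \<omega> - I t \<omega>)) (\<beta> t)"
      by (intro L2_inner_cong_AE L2_D(1) L2_diff[OF Rt I] Ut \<beta>t) auto
    also have "\<dots> = L2_inner M (?R t) (\<beta> t) - L2_inner M (\<lambda>\<omega>. I T \<omega> - I t \<omega>) (\<beta> t)"
      by (rule L2_inner_simps(2)[OF Rt I \<beta>t])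
    also have "L2_inner M (\<lambda>\<omega>. I T \<omega> - I t \<omega>) (\<beta> t) = 0"
      using ito_increment_orthogonal[OF ito t \<beta>a \<beta>t] by (subst L2_inner_commute)
    finally show ?case by (simp add: L2_inner_def)
  qed
  note iU = L2_integrable_inner[OF U \<beta>2] and iR = L2_integrable_inner[OF R \<beta>2]
  have "L2_inner PP (case_prod U) (case_prod \<beta>) = (\<integral>t. (\<integral>\<omega>. U t \<omega> \<bullet> \<beta> t \<omega> \<partial>M) \<partial>TT)"
    unfolding L2_inner_def using integral_PP_swap(2)[OF iU] by simp
  also have "\<dots> = (\<integral>t. (\<integral>\<omega>. ?R t \<omega> \<bullet> \<beta> t \<omega> \<partial>M) \<partial>TT)"
    using integral_PP_swap(4)[OF iU] integral_PP_swap(4)[OF iR] RU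
    by (intro integral_cong_AE) auto
  also have "\<dots> = integral\<^sup>L PP (\<lambda>x. case_prod ?R x \<bullet> case_prod \<beta> x)"
    using integral_PP_swap(2)[OF iR] by simp
  also have "\<dots> = (\<integral>\<omega>. (\<integral>t. ?R t \<omega> \<bullet> \<beta> t \<omega> \<partial>TT) \<partial>M)"
    using integral_PP_swap(1)[OF iR] by simp
  also have "\<dots> = (\<integral>\<omega>. \<Gamma> \<omega> \<bullet> primitive \<beta> T \<omega> + (\<integral>t. H t \<omega> \<bullet> primitive \<beta> t \<omega> \<partial>TT) \<partial>M)"
  proof (rule integral_cong_AE)
    have i1: "integrable M (\<lambda>\<omega>. \<Gamma> \<omega> \<bullet> primitive \<beta> T \<omega>)" by (intro L2_integrable_inner \<Gamma> primitive_L2 \<beta>2 TT)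
    have i2: "integrable M (\<lambda>\<omega>. \<integral>t. H t \<omega> \<bullet> primitive \<beta> t \<omega> \<partial>TT)"
      using integral_PP_swap(3)[OF L2_integrable_inner[OF H primitive_L2(2)[OF \<beta>2]]] by simp
    show "(\<lambda>\<omega>. \<Gamma> \<omega> \<bullet> primitive \<beta> T \<omega> + (\<integral>t. H t \<omega> \<bullet> primitive \<beta> t \<omega> \<partial>TT)) \<in> borel_measurable M"
      using i1 i2 by (intro borel_measurable_add borel_measurable_integrable)
    show "(\<lambda>\<omega>. \<integral>t. ?R t \<omega> \<bullet> \<beta> t \<omega> \<partial>TT) \<in> borel_measurable M"
      using borel_measurable_integrable[OF integral_PP_swap(3)[OF iR]] by simp
    from L2_PP_paths[OF H] L2_PP_paths[OF \<beta>2] L2_PP_paths[OF R]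
    show "AE \<omega> in M. (\<integral>t. ?R t \<omega> \<bullet> \<beta> t \<omega> \<partial>TT) = \<Gamma> \<omega> \<bullet> primitive \<beta> T \<omega> + (\<integral>t. H t \<omega> \<bullet> primitive \<beta> t \<omega> \<partial>TT)"
    proof eventually_elim
      case (elim \<omega>)
      hence Hw: "(\<lambda>t. H t \<omega>) \<in> L2 TT" and \<beta>w: "(\<lambda>t. \<beta> t \<omega>) \<in> L2 TT" and Rw: "(\<lambda>t. ?R t \<omega>) \<in> L2 TT" by auto
      have c: "(\<lambda>t. c :: real ^ 'd) \<in> L2 TT" for c by (rule TT.L2_bounded[where c="norm c"]) auto
      have D: "(\<lambda>t. primitive H T \<omega> - primitive H t \<omega>) \<in> L2 TT" using L2_diff[OF Rw c[of "\<Gamma> \<omega>"]] by simp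
      have "(\<integral>t. ?R t \<omega> \<bullet> \<beta> t \<omega> \<partial>TT) = (\<integral>t. \<Gamma> \<omega> \<bullet> \<beta> t \<omega> \<partial>TT) + (\<integral>t. (primitive H T \<omega> - primitive H t \<omega>) \<bullet> \<beta> t \<omega> \<partial>TT)"
        using L2_integrable_inner[OF c[of "\<Gamma> \<omega>"] \<beta>w] L2_integrable_inner[OF D \<beta>w] by (simp add: inner_add_left)
      also have "(\<integral>t. \<Gamma> \<omega> \<bullet> \<beta> t \<omega> \<partial>TT) = \<Gamma> \<omega> \<bullet> (\<integral>t. \<beta> t \<omega> \<partial>TT)"
        by (rule integral_inner_right[OF TT.L2_integrable[OF \<beta>w]])
      also have "(\<integral>t. \<beta> t \<omega> \<partial>TT) = primitive \<beta> T \<omega>"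
        unfolding primitive_def by (intro Bochner_Integration.integral_cong) (auto simp: space_TT)
      also note pathwise_duality[where H=H and \<beta>=\<beta>, OF Hw \<beta>w]
      finally show ?case .
    qed
  qed
  also have "\<dots> = L2_inner M \<Gamma> (primitive \<beta> T) + L2_inner PP (case_prod H) (case_prod (primitive \<beta>))"
  proof -
    note i = L2_integrable_inner[OF H primitive_L2(2)[OF \<beta>2]]
    have "(\<integral>\<omega>. \<Gamma> \<omega> \<bullet> primitive \<beta> T \<omega> + (\<integral>t. H t \<omega> \<bullet> primitive \<beta> t \<omega> \<partial>TT) \<partial>M)
      = (\<integral>\<omega>. \<Gamma> \<omega> \<bullet> primitive \<beta> T \<omega> \<partial>M) + (\<integral>\<omega>. (\<integral>t. H t \<omega> \<bullet> primitive \<beta> t \<omega> \<partial>TT) \<partial>M)"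
      using integral_PP_swap(3)[OF i] L2_integrable_inner[OF \<Gamma> primitive_L2(1)[OF \<beta>2 TT]]
      by (intro Bochner_Integration.integral_add) auto
    thus ?thesis using integral_PP_swap(1)[OF i] by (simp add: L2_inner_def)
  qed
  finally show ?thesis .
qed

end

section \<open>Strong monotonicity of the operator\<close>

lemma law_cong_AE:
  assumes "X \<in> borel_measurable M" "X' \<in> borel_measurable M" "AE \<omega> in M. X \<omega> = X' \<omega>"
  shows "law M X = law M X'"
  using assms by (intro distr_cong_AE) auto

locale mfg_setting = brownian_setting M T X0 B
  for M :: "'w measure" and T :: real and X0 :: "'w \<Rightarrow> real ^ 'd" and B :: "real \<Rightarrow> 'w \<Rightarrow> real ^ 'd" +
  fixes \<sigma> cL :: real
    and g :: "real ^ 'd \<Rightarrow> (real ^ 'd) measure \<Rightarrow> real"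
    and L :: "real ^ 'd \<Rightarrow> real ^ 'd \<Rightarrow> ((real ^ 'd) \<times> (real ^ 'd)) measure \<Rightarrow> real"
    and v :: "(real \<Rightarrow> 'w \<Rightarrow> real ^ 'd) \<Rightarrow> (real \<Rightarrow> 'w \<Rightarrow> real ^ 'd)"
  assumes Lip: "assm_Lip g L" and DM: "assm_DM M cL g L"
    and GaL_L2: "\<And>X A. X \<in> L2 M \<Longrightarrow> A \<in> L2 M \<Longrightarrow> GaL M L X A \<in> L2 M"
    and op: "is_mfg_operator M T \<sigma> X0 B g L v"
begin

abbreviation "\<X> \<equiv> state \<sigma> X0 B"

lemma Gxg_L2:
  assumes "X \<in> L2 M" shows "Gxg M g X \<in> L2 M"
proof -
  obtain K where "W2_lipschitz K (grad_x_g g)" using Lip by (auto simp: assm_Lip_def)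
  from lipschitz_law_L2[OF this assms assms] show ?thesis by (simp add: Gxg_def[abs_def])
qed

lemma GxL_L2:
  assumes "X \<in> L2 M" "A \<in> L2 M" shows "GxL M L X A \<in> L2 M"
proof -
  obtain K where K: "W2_lipschitz K (\<lambda>(x, a). grad_x_L L x a)" using Lip by (auto simp: assm_Lip_def)
  from lipschitz_law_L2[OF K L2_Pair[OF assms] L2_Pair[OF assms]] show ?thesis by (simp add: GxL_def[abs_def])
qed

lemma joint_law_version:
  assumes \<alpha>: "case_prod \<alpha> \<in> L2 PP"
    and Xeq: "AE \<omega> in M. \<forall>t\<in>{0..T}. X t \<omega> = \<X> \<alpha> t \<omega>"
    and t: "t \<in> {0..T}" and m: "(\<lambda>\<omega>. (X t \<omega>, \<alpha> t \<omega>)) \<in> L2 M"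
  shows "law M (\<lambda>\<omega>. (\<X> \<alpha> t \<omega>, \<alpha> t \<omega>)) = law M (\<lambda>\<omega>. (X t \<omega>, \<alpha> t \<omega>))"
proof (rule law_cong_AE)
  have \<alpha>t: "\<alpha> t \<in> borel_measurable M"
    using PP_section_measurable(2)[OF L2_D(1)[OF \<alpha>] t] by simp
  show "(\<lambda>\<omega>. (X t \<omega>, \<alpha> t \<omega>)) \<in> borel_measurable M" by (rule L2_D(1)[OF m])
  show "(\<lambda>\<omega>. (\<X> \<alpha> t \<omega>, \<alpha> t \<omega>)) \<in> borel_measurable M"
    by (intro borel_measurable_Pair \<alpha>t L2_D(1)[OF state_L2[OF \<alpha> t]])
  show "AE \<omega> in M. (\<X> \<alpha> t \<omega>, \<alpha> t \<omega>) = (X t \<omega>, \<alpha> t \<omega>)"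
    using Xeq by eventually_elim (use t in auto)
qed

text \<open>
Along a control the gradient \<open>\<nabla>\<^sub>x L\<close> has a jointly measurable square integrable representative. The
exceptional set is a null set of times together with a null set of paths, hence both iterated forms.
\<close>

lemma GxL_version:
  assumes \<alpha>: "case_prod \<alpha> \<in> L2 PP"
  obtains H where "case_prod H \<in> L2 PP"
    "AE \<omega> in M. AE t in TT. H t \<omega> = GxL M L (\<X> \<alpha> t) (\<alpha> t) \<omega>"
    "AE t in TT. AE \<omega> in M. H t \<omega> = GxL M L (\<X> \<alpha> t) (\<alpha> t) \<omega>"
proof -
  obtain X where X: "case_prod X \<in> L2 PP" and Xeq: "AE \<omega> in M. \<forall>t\<in>{0..T}. X t \<omega> = \<X> \<alpha> t \<omega>"
    by (rule state_version[OF \<alpha>])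
  let ?Y = "\<lambda>t \<omega>. (X t \<omega>, \<alpha> t \<omega>)"
  have Y: "case_prod ?Y \<in> L2 PP" using L2_Pair[OF X \<alpha>] by (simp add: case_prod_beta')
  obtain G where G: "G \<in> sets TT" "AE t in TT. t \<in> G" "\<And>t. t \<in> G \<Longrightarrow> ?Y t \<in> L2 M" "\<And>t. t \<in> G \<Longrightarrow> t \<in> {0..T}"
    using good_times[OF Y] by blast
  obtain K where K: "W2_lipschitz K (\<lambda>(x, a). grad_x_L L x a)" using Lip by (auto simp: assm_Lip_def)
  let ?H = "\<lambda>t \<omega>. if t \<in> G then (\<lambda>(x, a). grad_x_L L x a) (?Y t \<omega>) (law M (?Y t)) else 0"
  have H: "case_prod ?H \<in> L2 PP" using lipschitz_law_version[OF K Y Y G(1,3)] by simp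
  have law: "law M (?Y t) = law M (\<lambda>\<omega>. (\<X> \<alpha> t \<omega>, \<alpha> t \<omega>))" if t: "t \<in> G" for t
    by (rule joint_law_version[OF \<alpha> Xeq G(4)[OF t] G(3)[OF t], symmetric])
  have eq: "AE \<omega> in M. \<forall>t\<in>G. ?H t \<omega> = GxL M L (\<X> \<alpha> t) (\<alpha> t) \<omega>"
    using Xeq by eventually_elim (auto simp: GxL_def law dest: G(4))
  show thesis
  proof (rule that[OF H])
    show "AE \<omega> in M. AE t in TT. ?H t \<omega> = GxL M L (\<X> \<alpha> t) (\<alpha> t) \<omega>"
      using eq
    proof eventually_elim
      case (elim \<omega>)
      show ?case using G(2) by eventually_elim (use elim in blast)
    qed
    show "AE t in TT. AE \<omega> in M. ?H t \<omega> = GxL M L (\<X> \<alpha> t) (\<alpha> t) \<omega>"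
      using G(2)
    proof eventually_elim
      case (elim t)
      show ?case using eq by eventually_elim (use elim in blast)
    qed
  qed
qed

lemma operator_HT: "\<alpha> \<in> HT M T \<FF> \<Longrightarrow> v \<alpha> \<in> HT M T \<FF>"
  using op by (simp add: is_mfg_operator_def)

text \<open>
\<open>A\<close> and \<open>H\<close> represent \<open>\<nabla>\<^sub>\<alpha> L\<close> and \<open>\<nabla>\<^sub>x L\<close> along \<open>\<alpha>\<close>. For \<open>A\<close> no separate measurability argument is
needed: it is the sum of \<open>v(\<alpha>)\<close> and \<open>U\<close>.
\<close>

lemma operator_duality:
  assumes \<alpha>: "\<alpha> \<in> HT M T \<FF>"
  obtains A H where "case_prod A \<in> L2 PP" "case_prod H \<in> L2 PP"
    "AE t in TT. AE \<omega> in M. A t \<omega> = GaL M L (\<X> \<alpha> t) (\<alpha> t) \<omega>"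
    "AE t in TT. AE \<omega> in M. H t \<omega> = GxL M L (\<X> \<alpha> t) (\<alpha> t) \<omega>"
    "\<And>\<beta>. \<beta> \<in> HT M T \<FF> \<Longrightarrow> L2_inner PP (case_prod (v \<alpha>)) (case_prod \<beta>) =
       L2_inner PP (case_prod A) (case_prod \<beta>) - L2_inner PP (case_prod H) (case_prod (primitive \<beta>))
       - L2_inner M (Gxg M g (\<X> \<alpha> T)) (primitive \<beta> T)"
proof -
  note \<alpha>2 = HT_L2[OF \<alpha>]
  have TT: "T \<in> {0..T}" using T_pos by simp
  obtain U Z where bsde: "solves_bsde M T \<sigma> X0 B g L \<alpha> U Z"
    and vU: "AE (t, \<omega>) in PP. v \<alpha> t \<omega> = GaL M L (\<X> \<alpha> t) (\<alpha> t) \<omega> - U t \<omega>"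
    using op \<alpha> unfolding is_mfg_operator_def by blast
  obtain I where U: "U \<in> HT M T \<FF>" and ito: "is_ito_integral M T \<FF> B Z I"
    and Ueq: "\<And>t. t \<in> {0..T} \<Longrightarrow> AE \<omega> in M. U t \<omega> = Gxg M g (\<X> \<alpha> T) \<omega>
        + (LINT s:{t..T}|lebesgue. GxL M L (\<X> \<alpha> s) (\<alpha> s) \<omega>) - (I T \<omega> - I t \<omega>)"
    using bsde unfolding solves_bsde_def by blast
  obtain H where H: "case_prod H \<in> L2 PP"
    and Hp: "AE \<omega> in M. AE t in TT. H t \<omega> = GxL M L (\<X> \<alpha> t) (\<alpha> t) \<omega>"
    and Ht: "AE t in TT. AE \<omega> in M. H t \<omega> = GxL M L (\<X> \<alpha> t) (\<alpha> t) \<omega>"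
    by (rule GxL_version[OF \<alpha>2])
  note U2 = HT_L2[OF U] and v2 = HT_L2[OF operator_HT[OF \<alpha>]]
  let ?\<Gamma> = "Gxg M g (\<X> \<alpha> T)"
  have \<Gamma>: "?\<Gamma> \<in> L2 M" by (intro Gxg_L2 state_L2 \<alpha>2 TT)
  have U': "AE \<omega> in M. U t \<omega> = ?\<Gamma> \<omega> + (\<integral>s. indicat_real {t..T} s *\<^sub>R H s \<omega> \<partial>TT) - (I T \<omega> - I t \<omega>)"
    if t: "t \<in> {0..T}" for t
    using Ueq[OF t] Hp AE_space[of M]
  proof eventually_elim
    case (elim \<omega>)
    have "(\<lambda>s. H s \<omega>) \<in> borel_measurable TT"
      using PP_section_measurable(1)[OF L2_D(1)[OF H] elim(3)] by simp
    moreover have "AE s in TT. GxL M L (\<X> \<alpha> s) (\<alpha> s) \<omega> = H s \<omega>"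
      using elim(2) by eventually_elim simp
    ultimately have "(LINT s:{t..T}|lebesgue. GxL M L (\<X> \<alpha> s) (\<alpha> s) \<omega>) = (\<integral>s. indicat_real {t..T} s *\<^sub>R H s \<omega> \<partial>TT)"
      using t by (intro lebesgue_integral_eq_TT) auto
    thus ?case using elim(1) by simp
  qed
  let ?A = "\<lambda>t \<omega>. v \<alpha> t \<omega> + U t \<omega>"
  have A: "case_prod ?A \<in> L2 PP" using L2_add[OF v2 U2] by (simp add: case_prod_beta')
  have At: "AE t in TT. AE \<omega> in M. ?A t \<omega> = GaL M L (\<X> \<alpha> t) (\<alpha> t) \<omega>"
    using AE_PP_fst[OF vU] by (auto elim!: eventually_mono)
  show thesis
  proof (rule that[OF A H At Ht])
    fix \<beta> :: "real \<Rightarrow> 'w \<Rightarrow> real ^ 'd" assume \<beta>: "\<beta> \<in> HT M T \<FF>"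
    have "L2_inner PP (\<lambda>x. case_prod (v \<alpha>) x + case_prod U x) (case_prod \<beta>) = L2_inner PP (case_prod (v \<alpha>)) (case_prod \<beta>) + L2_inner PP (case_prod U) (case_prod \<beta>)"
      by (rule L2_inner_simps(1)[OF v2 U2 HT_L2[OF \<beta>]])
    moreover have "(\<lambda>x. case_prod (v \<alpha>) x + case_prod U x) = case_prod ?A" by auto
    ultimately show "L2_inner PP (case_prod (v \<alpha>)) (case_prod \<beta>) =
       L2_inner PP (case_prod ?A) (case_prod \<beta>) - L2_inner PP (case_prod H) (case_prod (primitive \<beta>)) - L2_inner M ?\<Gamma> (primitive \<beta> T)"
      using backward_duality[OF \<Gamma> H U2 \<beta> ito U'] by simp
  qed
qed

text \<open>
In the difference of the two duality formulas, \<open>- \<integral>\<^sub>0\<^sup>t \<delta>\<^sub>s ds\<close> is the difference of the two states. The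
running terms are then bounded below at almost every time by the monotonicity of the Lagrangian, and
the terminal term is nonnegative by the monotonicity of \<open>\<nabla>\<^sub>x g\<close>.
\<close>

lemma operator_strongly_monotone:
  assumes \<alpha>: "\<alpha> \<in> HT M T \<FF>" and \<beta>: "\<beta> \<in> HT M T \<FF>"
  shows "cL * (L2_norm PP (\<lambda>x. case_prod \<alpha> x - case_prod \<beta> x))\<^sup>2
     \<le> L2_inner PP (\<lambda>x. case_prod (v \<alpha>) x - case_prod (v \<beta>) x) (\<lambda>x. case_prod \<alpha> x - case_prod \<beta> x)"
proof -
  note \<alpha>2 = HT_L2[OF \<alpha>] and \<beta>2 = HT_L2[OF \<beta>]
  have TT: "T \<in> {0..T}" using T_pos by simp
  define \<delta> where "\<delta> = (\<lambda>t \<omega>. \<alpha> t \<omega> - \<beta> t \<omega>)"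
  have \<delta>: "\<delta> \<in> HT M T \<FF>" unfolding \<delta>_def by (rule HT_diff[OF \<alpha> \<beta>])
  note \<delta>2 = HT_L2[OF \<delta>]
  have d: "(\<lambda>x. case_prod \<alpha> x - case_prod \<beta> x) = case_prod \<delta>" by (auto simp: \<delta>_def)
  have p2: "case_prod (primitive \<delta>) \<in> L2 PP" and pT: "\<And>t. t \<in> {0..T} \<Longrightarrow> primitive \<delta> t \<in> L2 M"
    using primitive_L2[OF \<delta>2] by auto
  obtain A H where A: "case_prod A \<in> L2 PP" and H: "case_prod H \<in> L2 PP"
    and At: "AE t in TT. AE \<omega> in M. A t \<omega> = GaL M L (\<X> \<alpha> t) (\<alpha> t) \<omega>"
    and Ht: "AE t in TT. AE \<omega> in M. H t \<omega> = GxL M L (\<X> \<alpha> t) (\<alpha> t) \<omega>"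
    and dual: "\<And>\<delta>. \<delta> \<in> HT M T \<FF> \<Longrightarrow> L2_inner PP (case_prod (v \<alpha>)) (case_prod \<delta>) =
       L2_inner PP (case_prod A) (case_prod \<delta>) - L2_inner PP (case_prod H) (case_prod (primitive \<delta>))
       - L2_inner M (Gxg M g (\<X> \<alpha> T)) (primitive \<delta> T)"
    by (rule operator_duality[OF \<alpha>]) blast
  obtain A' H' where A': "case_prod A' \<in> L2 PP" and H': "case_prod H' \<in> L2 PP"
    and At': "AE t in TT. AE \<omega> in M. A' t \<omega> = GaL M L (\<X> \<beta> t) (\<beta> t) \<omega>"
    and Ht': "AE t in TT. AE \<omega> in M. H' t \<omega> = GxL M L (\<X> \<beta> t) (\<beta> t) \<omega>"
    and dual': "\<And>\<delta>. \<delta> \<in> HT M T \<FF> \<Longrightarrow> L2_inner PP (case_prod (v \<beta>)) (case_prod \<delta>) =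
       L2_inner PP (case_prod A') (case_prod \<delta>) - L2_inner PP (case_prod H') (case_prod (primitive \<delta>))
       - L2_inner M (Gxg M g (\<X> \<beta> T)) (primitive \<delta> T)"
    by (rule operator_duality[OF \<beta>]) blast
  have "(\<lambda>t \<omega>. \<beta> t \<omega> + 1 *\<^sub>R \<delta> t \<omega>) = \<alpha>" by (simp add: \<delta>_def)
  with state_perturb[OF \<beta>2 \<delta>2, of \<sigma> 1]
  have st: "AE \<omega> in M. \<forall>t\<in>{0..T}. \<X> \<alpha> t \<omega> - \<X> \<beta> t \<omega> = - primitive \<delta> t \<omega>"
    by (auto elim!: eventually_mono)
  have st': "AE \<omega> in M. \<X> \<alpha> t \<omega> - \<X> \<beta> t \<omega> = - primitive \<delta> t \<omega>" if "t \<in> {0..T}" for t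
    using st that by (auto elim!: eventually_mono)
  let ?f = "\<lambda>x. (case_prod A x - case_prod A' x) \<bullet> case_prod \<delta> x - (case_prod H x - case_prod H' x) \<bullet> case_prod (primitive \<delta>) x"
  note iA = L2_integrable_inner[OF L2_diff[OF A A'] \<delta>2] and iH = L2_integrable_inner[OF L2_diff[OF H H'] p2]
  have fi: "integrable PP ?f" by (rule Bochner_Integration.integrable_diff[OF iA iH])
  have gi: "integrable PP (\<lambda>x. cL * (norm (case_prod \<delta> x))\<^sup>2)" using L2_D(2)[OF \<delta>2] by simp
  have "AE t in TT. (\<integral>\<omega>. cL * (norm (case_prod \<delta> (t, \<omega>)))\<^sup>2 \<partial>M) \<le> (\<integral>\<omega>. ?f (t, \<omega>) \<partial>M)"
    using L2_PP_times[OF \<alpha>2] L2_PP_times[OF \<beta>2] L2_PP_times[OF A] L2_PP_times[OF H]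
      L2_PP_times[OF A'] L2_PP_times[OF H'] At Ht At' Ht' AE_space[of TT]
  proof eventually_elim
    case (elim t)
    hence t: "t \<in> {0..T}" and \<alpha>t: "\<alpha> t \<in> L2 M" and \<beta>t: "\<beta> t \<in> L2 M"
      and L2t: "A t \<in> L2 M" "H t \<in> L2 M" "A' t \<in> L2 M" "H' t \<in> L2 M" by (auto simp: space_TT)
    have \<delta>t: "\<delta> t \<in> L2 M" unfolding \<delta>_def by (rule L2_diff[OF \<alpha>t \<beta>t])
    note X = state_L2[OF \<alpha>2 t] and Y = state_L2[OF \<beta>2 t]
    have "cL * (L2_norm M (\<lambda>\<omega>. \<alpha> t \<omega> - \<beta> t \<omega>))\<^sup>2
        \<le> L2_inner M (\<lambda>\<omega>. GxL M L (\<X> \<alpha> t) (\<alpha> t) \<omega> - GxL M L (\<X> \<beta> t) (\<beta> t) \<omega>) (\<lambda>\<omega>. \<X> \<alpha> t \<omega> - \<X> \<beta> t \<omega>)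
          + L2_inner M (\<lambda>\<omega>. GaL M L (\<X> \<alpha> t) (\<alpha> t) \<omega> - GaL M L (\<X> \<beta> t) (\<beta> t) \<omega>) (\<lambda>\<omega>. \<alpha> t \<omega> - \<beta> t \<omega>)"
      using DM X Y \<alpha>t \<beta>t unfolding assm_DM_def by blast
    also have "L2_inner M (\<lambda>\<omega>. GxL M L (\<X> \<alpha> t) (\<alpha> t) \<omega> - GxL M L (\<X> \<beta> t) (\<beta> t) \<omega>) (\<lambda>\<omega>. \<X> \<alpha> t \<omega> - \<X> \<beta> t \<omega>)
       = L2_inner M (\<lambda>\<omega>. H t \<omega> - H' t \<omega>) (\<lambda>\<omega>. - primitive \<delta> t \<omega>)"
    proof (rule L2_inner_cong_AE)
      show "AE \<omega> in M. GxL M L (\<X> \<alpha> t) (\<alpha> t) \<omega> - GxL M L (\<X> \<beta> t) (\<beta> t) \<omega> = H t \<omega> - H' t \<omega>"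
        using elim(8,10) by eventually_elim simp
    qed (intro L2_D(1) L2_diff L2_minus GxL_L2 X Y \<alpha>t \<beta>t L2t pT t st'[OF t])+
    also have "L2_inner M (\<lambda>\<omega>. GaL M L (\<X> \<alpha> t) (\<alpha> t) \<omega> - GaL M L (\<X> \<beta> t) (\<beta> t) \<omega>) (\<lambda>\<omega>. \<alpha> t \<omega> - \<beta> t \<omega>)
       = L2_inner M (\<lambda>\<omega>. A t \<omega> - A' t \<omega>) (\<delta> t)"
    proof (rule L2_inner_cong_AE)
      show "AE \<omega> in M. GaL M L (\<X> \<alpha> t) (\<alpha> t) \<omega> - GaL M L (\<X> \<beta> t) (\<beta> t) \<omega> = A t \<omega> - A' t \<omega>"
        using elim(7,9) by eventually_elim simp
      show "AE \<omega> in M. \<alpha> t \<omega> - \<beta> t \<omega> = \<delta> t \<omega>" by (simp add: \<delta>_def)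
    qed (intro L2_D(1) L2_diff GaL_L2 X Y \<alpha>t \<beta>t L2t \<delta>t)+
    also have "L2_inner M (\<lambda>\<omega>. H t \<omega> - H' t \<omega>) (\<lambda>\<omega>. - primitive \<delta> t \<omega>) + L2_inner M (\<lambda>\<omega>. A t \<omega> - A' t \<omega>) (\<delta> t)
      = (\<integral>\<omega>. ?f (t, \<omega>) \<partial>M)"
      using L2_integrable_inner[OF L2_diff[OF L2t(1,3)] \<delta>t] L2_integrable_inner[OF L2_diff[OF L2t(2,4)] pT[OF t]]
      by (simp add: L2_inner_def)
    finally show ?case by (simp add: L2_norm_sq \<delta>_def)
  qed
  hence "(\<integral>t. (\<integral>\<omega>. cL * (norm (case_prod \<delta> (t, \<omega>)))\<^sup>2 \<partial>M) \<partial>TT) \<le> (\<integral>t. (\<integral>\<omega>. ?f (t, \<omega>) \<partial>M) \<partial>TT)"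
    by (rule integral_mono_AE[OF integral_PP_swap(4)[OF gi] integral_PP_swap(4)[OF fi]])
  hence "integral\<^sup>L PP (\<lambda>x. cL * (norm (case_prod \<delta> x))\<^sup>2) \<le> integral\<^sup>L PP ?f"
    unfolding integral_PP_swap(2)[OF gi] integral_PP_swap(2)[OF fi] .
  moreover have "integral\<^sup>L PP ?f = (L2_inner PP (case_prod A) (case_prod \<delta>) - L2_inner PP (case_prod A') (case_prod \<delta>))
      - (L2_inner PP (case_prod H) (case_prod (primitive \<delta>)) - L2_inner PP (case_prod H') (case_prod (primitive \<delta>)))"
    using Bochner_Integration.integral_diff[OF iA iH] L2_inner_simps(2)[OF A A' \<delta>2] L2_inner_simps(2)[OF H H' p2]
    by (simp add: L2_inner_def)
  moreover have "0 \<le> - (L2_inner M (Gxg M g (\<X> \<alpha> T)) (primitive \<delta> T) - L2_inner M (Gxg M g (\<X> \<beta> T)) (primitive \<delta> T))"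
  proof -
    note X = state_L2[OF \<alpha>2 TT] and Y = state_L2[OF \<beta>2 TT]
    have "0 \<le> L2_inner M (\<lambda>\<omega>. Gxg M g (\<X> \<alpha> T) \<omega> - Gxg M g (\<X> \<beta> T) \<omega>) (\<lambda>\<omega>. \<X> \<alpha> T \<omega> - \<X> \<beta> T \<omega>)"
      using DM X Y unfolding assm_DM_def by blast
    also have "\<dots> = L2_inner M (\<lambda>\<omega>. Gxg M g (\<X> \<alpha> T) \<omega> - Gxg M g (\<X> \<beta> T) \<omega>) (\<lambda>\<omega>. (-1) *\<^sub>R primitive \<delta> T \<omega>)"
      using st'[OF TT] by (intro L2_inner_cong_AE L2_D(1) L2_diff L2_scaleR Gxg_L2 X Y pT TT) auto
    also have "\<dots> = - (L2_inner M (Gxg M g (\<X> \<alpha> T)) (primitive \<delta> T) - L2_inner M (Gxg M g (\<X> \<beta> T)) (primitive \<delta> T))"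
      unfolding L2_inner_scaleR L2_inner_simps(2)[OF Gxg_L2[OF X] Gxg_L2[OF Y] pT[OF TT]] by simp
    finally show ?thesis .
  qed
  moreover have "L2_inner PP (\<lambda>x. case_prod (v \<alpha>) x - case_prod (v \<beta>) x) (case_prod \<delta>)
      = L2_inner PP (case_prod (v \<alpha>)) (case_prod \<delta>) - L2_inner PP (case_prod (v \<beta>)) (case_prod \<delta>)"
    by (rule L2_inner_simps(2)[OF HT_L2[OF operator_HT[OF \<alpha>]] HT_L2[OF operator_HT[OF \<beta>]] \<delta>2])
  ultimately show ?thesis unfolding d using dual[OF \<delta>] dual'[OF \<delta>] by (simp add: L2_norm_sq)
qed

end

section \<open>Differentiability of the data\<close>

lemma GDERIV_unique:
  fixes f :: "'a::euclidean_space \<Rightarrow> real"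
  assumes "GDERIV f x :> D" "GDERIV f x :> D'" shows "D = D'"
proof -
  have "(\<lambda>h. h \<bullet> D) = (\<lambda>h. h \<bullet> D')"
    using assms unfolding gderiv_def by (rule has_derivative_unique)
  from fun_cong[OF this, of "D - D'"] have "(D - D') \<bullet> (D - D') = 0" by (simp add: inner_diff_right)
  thus ?thesis by simp
qed

lemma has_grad_GDERIV:
  assumes "has_grad f x" shows "GDERIV f x :> grad f x"
proof -
  obtain D where D: "GDERIV f x :> D" using assms by (auto simp: has_grad_def)
  hence "grad f x = D" unfolding grad_def by (intro the_equality GDERIV_unique[OF _ D])
  thus ?thesis using D by simp
qed

lemma W2_continuous_at_fixed_measure:
  assumes F: "W2_continuous F" and m: "m \<in> P2"
  shows "isCont (\<lambda>z. F z m) x"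
  unfolding continuous_at_eps_delta
proof (intro allI impI)
  fix e :: real assume "0 < e"
  then obtain d where "d > 0" "\<And>y. dist x y < d \<Longrightarrow> dist (F x m) (F y m) < e"
    using F m unfolding W2_continuous_def by (metis W2_refl[OF m])
  thus "\<exists>d>0. \<forall>x'. dist x' x < d \<longrightarrow> dist (F x' m) (F x m) < e" by (metis dist_commute)
qed

locale lipschitz_data =
  fixes g :: "'a::euclidean_space \<Rightarrow> 'a measure \<Rightarrow> real"
    and L :: "'a \<Rightarrow> 'a \<Rightarrow> ('a \<times> 'a) measure \<Rightarrow> real"
  assumes Lip: "assm_Lip g L"
begin

lemma g_gradient: "\<mu> \<in> P2 \<Longrightarrow> GDERIV (\<lambda>y. g y \<mu>) x :> grad_x_g g x \<mu>"
  unfolding grad_x_g_def using Lip by (intro has_grad_GDERIV) (auto simp: assm_Lip_def)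

lemma L_gradient_x: "m \<in> P2 \<Longrightarrow> GDERIV (\<lambda>y. L y a m) x :> grad_x_L L x a m"
  unfolding grad_x_L_def using Lip by (intro has_grad_GDERIV) (auto simp: assm_Lip_def)

lemma L_gradient_a: "m \<in> P2 \<Longrightarrow> GDERIV (\<lambda>b. L x b m) a :> grad_a_L L x a m"
  unfolding grad_a_L_def using Lip by (intro has_grad_GDERIV) (auto simp: assm_Lip_def)

text \<open>
Partial gradients, one of which is jointly continuous, give total differentiability.
\<close>

lemma L_has_derivative:
  assumes m: "m \<in> P2"
  shows "((\<lambda>(x, a). L x a m) has_derivative (\<lambda>(h, b). h \<bullet> grad_x_L L x a m + b \<bullet> grad_a_L L x a m)) (at (x, a))"
proof -
  have "((\<lambda>(x, a). L x a m) has_derivative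
      (\<lambda>(h, b). (\<lambda>h. h \<bullet> grad_x_L L x a m) h + blinfun_inner_left (grad_a_L L x a m) b)) (at (x, a) within UNIV \<times> UNIV)"
  proof (rule has_derivative_partialsI)
    show "((\<lambda>x. L x a m) has_derivative (\<lambda>h. h \<bullet> grad_x_L L x a m)) (at x within UNIV)"
      using L_gradient_x[OF m] by (simp add: gderiv_def)
    show "((\<lambda>b. L y b m) has_derivative blinfun_apply (blinfun_inner_left (grad_a_L L y c m))) (at c within UNIV)" for y c
      using L_gradient_a[OF m] by (simp add: gderiv_def blinfun_inner_left.rep_eq)
    have "isCont (\<lambda>z. (\<lambda>(x, a). grad_a_L L x a) z m) (x, a)"
      using Lip m by (intro W2_continuous_at_fixed_measure) (auto simp: assm_Lip_def)
    hence "isCont (\<lambda>z. blinfun_inner_left ((\<lambda>(x, a). grad_a_L L x a) z m)) (x, a)"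
      by (rule bounded_linear.isCont[OF bounded_linear_blinfun_inner_left])
    thus "continuous (at (x, a) within UNIV \<times> UNIV) (\<lambda>(x, y). blinfun_inner_left (grad_a_L L x y m))"
      by (simp add: case_prod_beta')
  qed auto
  thus ?thesis by (simp add: blinfun_inner_left.rep_eq)
qed

lemma L_continuous: "m \<in> P2 \<Longrightarrow> continuous_on UNIV (\<lambda>(x, a). L x a m)"
  by (intro continuous_at_imp_continuous_on ballI)
     (use has_derivative_continuous[OF L_has_derivative] in auto)

lemma L_along_segment:
  assumes m: "m \<in> P2"
  shows "DERIV (\<lambda>s. L (x + s *\<^sub>R y) (a + s *\<^sub>R b) m) s :>
    y \<bullet> grad_x_L L (x + s *\<^sub>R y) (a + s *\<^sub>R b) m + b \<bullet> grad_a_L L (x + s *\<^sub>R y) (a + s *\<^sub>R b) m"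
proof -
  have 1: "((\<lambda>s. (x + s *\<^sub>R y, a + s *\<^sub>R b)) has_derivative (\<lambda>h. (h *\<^sub>R y, h *\<^sub>R b))) (at s)"
    by (auto intro!: derivative_eq_intros)
  have "((\<lambda>s. (\<lambda>(x, a). L x a m) (x + s *\<^sub>R y, a + s *\<^sub>R b)) has_derivative
     (\<lambda>h. (\<lambda>(h, c). h \<bullet> grad_x_L L (x + s *\<^sub>R y) (a + s *\<^sub>R b) m + c \<bullet> grad_a_L L (x + s *\<^sub>R y) (a + s *\<^sub>R b) m) (h *\<^sub>R y, h *\<^sub>R b))) (at s)"
    by (rule has_derivative_compose[OF 1 L_has_derivative[OF m]])
  thus ?thesis unfolding has_field_derivative_def prod.case
    by (rule has_derivative_eq_rhs) (simp add: fun_eq_iff algebra_simps)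
qed

lemma g_along_segment:
  assumes m: "\<mu> \<in> P2"
  shows "DERIV (\<lambda>s. g (x + s *\<^sub>R y) \<mu>) s :> y \<bullet> grad_x_g g (x + s *\<^sub>R y) \<mu>"
proof -
  have 1: "((\<lambda>s. x + s *\<^sub>R y) has_derivative (\<lambda>h. h *\<^sub>R y)) (at s)"
    by (auto intro!: derivative_eq_intros)
  have "((\<lambda>s. g (x + s *\<^sub>R y) \<mu>) has_derivative (\<lambda>h. (h *\<^sub>R y) \<bullet> grad_x_g g (x + s *\<^sub>R y) \<mu>)) (at s)"
    by (rule has_derivative_compose[OF 1 g_gradient[OF m, unfolded gderiv_def]])
  thus ?thesis unfolding has_field_derivative_def
    by (rule has_derivative_eq_rhs) (simp add: fun_eq_iff algebra_simps)
qed

lemma L_increment_mvt: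
  assumes m: "m \<in> P2" and e: "0 < e"
  obtains s where "0 < s" "s < e" "L (x + e *\<^sub>R y) (a + e *\<^sub>R b) m - L x a m =
    e * (y \<bullet> grad_x_L L (x + s *\<^sub>R y) (a + s *\<^sub>R b) m + b \<bullet> grad_a_L L (x + s *\<^sub>R y) (a + s *\<^sub>R b) m)"
  using MVT2[OF e L_along_segment[OF m, of x y a b]] by auto

lemma g_increment_mvt:
  assumes m: "\<mu> \<in> P2" and e: "0 < e"
  obtains s where "0 < s" "s < e" "g (x + e *\<^sub>R y) \<mu> - g x \<mu> = e * (y \<bullet> grad_x_g g (x + s *\<^sub>R y) \<mu>)"
  using MVT2[OF e g_along_segment[OF m, of x y]] by auto

text \<open>
The assumptions control only the gradients of \<open>L\<close>, so \<open>L\<close> itself may depend on the measure in any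
way; its increments in \<open>(x, a)\<close> are Lipschitz in the measure. This makes differences of
running costs measurable in time, although the costs themselves are not known to be.
\<close>

lemma L_increment_W2_lipschitz:
  obtains K where "\<And>m m' x y a b. m \<in> P2 \<Longrightarrow> m' \<in> P2 \<Longrightarrow>
    \<bar>(L (x + y) (a + b) m - L x a m) - (L (x + y) (a + b) m' - L x a m')\<bar> \<le> K * W2 m m' * (norm y + norm b)"
    "0 \<le> K"
proof -
  obtain K1 K2 where K1: "W2_lipschitz K1 (\<lambda>(x, a). grad_x_L L x a)" and K2: "\<And>a. W2_lipschitz K2 (\<lambda>x m. grad_a_L L x a m)"
    using Lip unfolding assm_Lip_def by blast
  have "\<bar>(L (x + y) (a + b) m - L x a m) - (L (x + y) (a + b) m' - L x a m')\<bar> \<le> (\<bar>K1\<bar> + \<bar>K2\<bar>) * W2 m m' * (norm y + norm b)"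
    if m: "m \<in> P2" and m': "m' \<in> P2" for m m' x y a b
  proof -
    let ?gx = "\<lambda>m s. grad_x_L L (x + s *\<^sub>R y) (a + s *\<^sub>R b) m" and ?ga = "\<lambda>m s. grad_a_L L (x + s *\<^sub>R y) (a + s *\<^sub>R b) m"
    have "DERIV (\<lambda>s. L (x + s *\<^sub>R y) (a + s *\<^sub>R b) m - L (x + s *\<^sub>R y) (a + s *\<^sub>R b) m') s :>
        (y \<bullet> ?gx m s + b \<bullet> ?ga m s) - (y \<bullet> ?gx m' s + b \<bullet> ?ga m' s)" for s
      by (intro DERIV_diff L_along_segment m m')
    from MVT2[of 0 1, OF _ this] obtain s where
      s: "(L (x + y) (a + b) m - L (x + y) (a + b) m') - (L x a m - L x a m')
          = (y \<bullet> ?gx m s + b \<bullet> ?ga m s) - (y \<bullet> ?gx m' s + b \<bullet> ?ga m' s)" by auto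
    have 1: "norm (?gx m s - ?gx m' s) \<le> \<bar>K1\<bar> * W2 m m'"
      using W2_lipschitz_D[OF W2_lipschitz_nonneg[OF K1] m m', of "(x + s *\<^sub>R y, a + s *\<^sub>R b)" "(x + s *\<^sub>R y, a + s *\<^sub>R b)"]
      by (simp add: dist_norm)
    have 2: "norm (?ga m s - ?ga m' s) \<le> \<bar>K2\<bar> * W2 m m'"
      using W2_lipschitz_D[OF W2_lipschitz_nonneg[OF K2] m m', of "x + s *\<^sub>R y" "a + s *\<^sub>R b" "x + s *\<^sub>R y"]
      by (simp add: dist_norm)
    have "\<bar>(L (x + y) (a + b) m - L x a m) - (L (x + y) (a + b) m' - L x a m')\<bar>
        = \<bar>y \<bullet> (?gx m s - ?gx m' s) + b \<bullet> (?ga m s - ?ga m' s)\<bar>"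
      using s by (simp add: inner_diff_right algebra_simps)
    also have "\<dots> \<le> norm y * norm (?gx m s - ?gx m' s) + norm b * norm (?ga m s - ?ga m' s)"
      using Cauchy_Schwarz_ineq2[of y "?gx m s - ?gx m' s"] Cauchy_Schwarz_ineq2[of b "?ga m s - ?ga m' s"] by linarith
    also have "\<dots> \<le> norm y * (\<bar>K1\<bar> * W2 m m') + norm b * (\<bar>K2\<bar> * W2 m m')"
      by (intro add_mono mult_left_mono 1 2) auto
    also have "\<dots> \<le> norm y * ((\<bar>K1\<bar> + \<bar>K2\<bar>) * W2 m m') + norm b * ((\<bar>K1\<bar> + \<bar>K2\<bar>) * W2 m m')"
      by (intro add_mono mult_left_mono mult_right_mono W2_nonneg) auto
    finally show ?thesis by (simp add: algebra_simps)
  qed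
  thus thesis by (rule that) auto
qed

end

lemma difference_quotient_tendsto:
  fixes \<phi> :: "real \<Rightarrow> real"
  assumes "DERIV \<phi> 0 :> D"
  shows "(\<lambda>n. (\<phi> (1 / real (Suc n)) - \<phi> 0) / (1 / real (Suc n))) \<longlonglongrightarrow> D"
proof -
  have "((\<lambda>h. (\<phi> (0 + h) - \<phi> 0) / h) \<longlongrightarrow> D) (at 0)" using assms by (simp add: DERIV_def)
  moreover have "filterlim (\<lambda>n. 1 / real (Suc n)) (at 0) sequentially"
    by (intro filterlim_atI LIMSEQ_Suc[OF lim_1_over_n]) auto
  ultimately have "(\<lambda>n. (\<phi> (0 + 1 / real (Suc n)) - \<phi> 0) / (1 / real (Suc n))) \<longlonglongrightarrow> D"
    by (rule filterlim_compose)
  thus ?thesis by simp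
qed

section \<open>First variation of the cost\<close>

sublocale mfg_setting \<subseteq> lipschitz_data g L by unfold_locales (rule Lip)

context mfg_setting
begin

text \<open>
A measurable representative of the running cost computes the cost, and its integrability is enough for the
cost to be well defined: measurability of the original integrand is a consequence of completeness.
\<close>

lemma cost_version:
  fixes m :: "real \<Rightarrow> ((real ^ 'd) \<times> (real ^ 'd)) measure"
  assumes gi: "integrable M (\<lambda>\<omega>. g (\<X> \<alpha> T \<omega>) (distr (m T) borel fst))"
    and f': "integrable PP f'"
    and ae: "AE x in PP. f' x = L (\<X> \<alpha> (fst x) (snd x)) (\<alpha> (fst x) (snd x)) (m (fst x))"
  shows "cost_defined M T \<sigma> X0 B g L \<alpha> m"
    and "cost M T \<sigma> X0 B g L \<alpha> m = expectation (\<lambda>\<omega>. g (\<X> \<alpha> T \<omega>) (distr (m T) borel fst)) + integral\<^sup>L PP f'"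
proof -
  let ?f = "\<lambda>x. L (\<X> \<alpha> (fst x) (snd x)) (\<alpha> (fst x) (snd x)) (m (fst x))"
  have f'm: "f' \<in> borel_measurable (completion PP)" using f' by (intro measurable_completion) auto
  have ae': "AE x in completion PP. f' x = ?f x" using ae by (rule AE_completion)
  have fm: "?f \<in> borel_measurable (completion PP)"
    by (rule completion.borel_measurable_cong_AE_complete[OF f'm ae'])
  have "integrable (completion PP) f'" using f' by (subst integrable_completion) auto
  hence "integrable (completion PP) ?f" using integrable_cong_AE[OF f'm fm ae'] by simp
  thus "cost_defined M T \<sigma> X0 B g L \<alpha> m" using gi by (simp add: cost_defined_def case_prod_beta')
  let ?I = "\<lambda>\<omega>. LINT t:{0..T}|lebesgue. L (\<X> \<alpha> t \<omega>) (\<alpha> t \<omega>) (m t)"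
  have I: "AE \<omega> in M. (\<integral>t. f' (t, \<omega>) \<partial>TT) = ?I \<omega>"
    using AE_PP_snd[OF ae] AE_space
  proof eventually_elim
    case (elim \<omega>)
    have "?I \<omega> = (\<integral>t. indicat_real {0..T} t *\<^sub>R f' (t, \<omega>) \<partial>TT)"
      using elim(1) PP_section_measurable(1)[OF borel_measurable_integrable[OF f'] elim(2)]
      by (intro lebesgue_integral_eq_TT) (auto elim!: eventually_mono)
    also have "\<dots> = (\<integral>t. f' (t, \<omega>) \<partial>TT)"
      by (intro Bochner_Integration.integral_cong) (auto simp: space_TT)
    finally show ?case by simp
  qed
  have Im: "?I \<in> borel_measurable M"
    by (rule complete_measure.borel_measurable_cong_AE_complete[OF compl borel_measurable_integrable[OF integral_PP_swap(3)[OF f']] I])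
  have "cost M T \<sigma> X0 B g L \<alpha> m = (\<integral>\<omega>. g (\<X> \<alpha> T \<omega>) (distr (m T) borel fst) + ?I \<omega> \<partial>M)"
    by (simp add: cost_def)
  also have "\<dots> = (\<integral>\<omega>. g (\<X> \<alpha> T \<omega>) (distr (m T) borel fst) + (\<integral>t. f' (t, \<omega>) \<partial>TT) \<partial>M)"
    using I gi Im borel_measurable_integrable[OF integral_PP_swap(3)[OF f']]
    by (intro integral_cong_AE borel_measurable_add borel_measurable_integrable[OF gi]) (auto elim!: eventually_mono)
  also have "\<dots> = expectation (\<lambda>\<omega>. g (\<X> \<alpha> T \<omega>) (distr (m T) borel fst)) + integral\<^sup>L PP f'"
    using Bochner_Integration.integral_add[OF gi integral_PP_swap(3)[OF f']] integral_PP_swap(1)[OF f'] by simp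
  finally show "cost M T \<sigma> X0 B g L \<alpha> m = expectation (\<lambda>\<omega>. g (\<X> \<alpha> T \<omega>) (distr (m T) borel fst)) + integral\<^sup>L PP f'" .
qed

lemma g_measurable:
  assumes "\<mu> \<in> P2" "Z \<in> borel_measurable M" shows "(\<lambda>\<omega>. g (Z \<omega>) \<mu>) \<in> borel_measurable M"
proof (rule borel_measurable_continuous_on[OF _ assms(2)])
  show "continuous_on UNIV (\<lambda>x. g x \<mu>)"
    by (intro continuous_at_imp_continuous_on ballI)
       (use has_derivative_continuous[OF g_gradient[OF assms(1), unfolded gderiv_def]] in auto)
qed

text \<open>
The difference quotients are values of the directional derivative at intermediate points, by the mean
value theorem; linear growth of \<open>\<nabla>\<^sub>x g\<close> dominates them because \<open>Y\<close> is bounded.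
\<close>

lemma terminal_variation:
  assumes X: "X \<in> L2 M" and Y: "Y \<in> L2 M" and C: "\<And>\<omega>. norm (Y \<omega>) \<le> C"
  defines "e \<equiv> \<lambda>n. 1 / real (Suc n)" and "\<mu> \<equiv> law M X"
  shows "integrable M (\<lambda>\<omega>. g (X \<omega> + e n *\<^sub>R Y \<omega>) \<mu> - g (X \<omega>) \<mu>)"
    and "(\<lambda>n. expectation (\<lambda>\<omega>. g (X \<omega> + e n *\<^sub>R Y \<omega>) \<mu> - g (X \<omega>) \<mu>) / e n) \<longlonglongrightarrow> L2_inner M (Gxg M g X) Y"
proof -
  have e: "0 < e n" "e n \<le> 1" for n by (auto simp: e_def)
  have C0: "0 \<le> C" using order_trans[OF norm_ge_zero C] .
  have \<mu>: "\<mu> \<in> P2" unfolding \<mu>_def by (rule law_in_P2[OF X])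
  obtain K where K: "W2_lipschitz K (grad_x_g g)" using Lip by (auto simp: assm_Lip_def)
  let ?c = "norm (grad_x_g g 0 (law M (\<lambda>_. 0)))"
  let ?w = "\<lambda>\<omega>. C * (?c + \<bar>K\<bar> * (norm (X \<omega>) + C + L2_norm M X))"
  let ?q = "\<lambda>n \<omega>. (g (X \<omega> + e n *\<^sub>R Y \<omega>) \<mu> - g (X \<omega>) \<mu>) / e n"
  have wi: "integrable M ?w" using L2_integrable_norm[OF X] by simp
  note Xm = L2_D(1)[OF X] and Ym = L2_D(1)[OF Y]
  have qm: "?q n \<in> borel_measurable M" for n
    by (intro borel_measurable_divide borel_measurable_diff g_measurable[OF \<mu>] borel_measurable_add borel_measurable_scaleR Xm Ym) auto
  have bd: "norm (?q n \<omega>) \<le> ?w \<omega>" for n \<omega>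
  proof -
    obtain s where s: "0 < s" "s < e n" "g (X \<omega> + e n *\<^sub>R Y \<omega>) \<mu> - g (X \<omega>) \<mu> = e n * (Y \<omega> \<bullet> grad_x_g g (X \<omega> + s *\<^sub>R Y \<omega>) \<mu>)"
      by (rule g_increment_mvt[OF \<mu> e(1)])
    have "norm (s *\<^sub>R Y \<omega>) \<le> 1 * C" using s e(2)[of n] C[of \<omega>] unfolding norm_scaleR by (intro mult_mono) auto
    hence "norm (X \<omega> + s *\<^sub>R Y \<omega>) \<le> norm (X \<omega>) + C" using norm_triangle_ineq[of "X \<omega>" "s *\<^sub>R Y \<omega>"] by linarith
    hence b: "\<bar>K\<bar> * (norm (X \<omega> + s *\<^sub>R Y \<omega>) + L2_norm M X) \<le> \<bar>K\<bar> * (norm (X \<omega>) + C + L2_norm M X)"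
      by (intro mult_left_mono) auto
    have "\<bar>?q n \<omega>\<bar> = \<bar>Y \<omega> \<bullet> grad_x_g g (X \<omega> + s *\<^sub>R Y \<omega>) \<mu>\<bar>" using s(3) e(1)[of n] by simp
    also have "\<dots> \<le> norm (Y \<omega>) * norm (grad_x_g g (X \<omega> + s *\<^sub>R Y \<omega>) \<mu>)" by (rule Cauchy_Schwarz_ineq2)
    also have "\<dots> \<le> C * (?c + \<bar>K\<bar> * (norm (X \<omega>) + C + L2_norm M X))"
      using lipschitz_law_bound[OF K X, of "X \<omega> + s *\<^sub>R Y \<omega>"] b C C0 unfolding \<mu>_def by (intro mult_mono) auto
    finally show ?thesis by simp
  qed
  have qi: "integrable M (?q n)" for n
    by (rule Bochner_Integration.integrable_bound[OF wi qm]) (use bd order_trans[OF _ abs_ge_self] in fastforce)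
  show "integrable M (\<lambda>\<omega>. g (X \<omega> + e n *\<^sub>R Y \<omega>) \<mu> - g (X \<omega>) \<mu>)"
    using integrable_mult_left[of "e n" M "?q n"] qi[of n] e(1)[of n] by simp
  have "(\<lambda>n. expectation (?q n)) \<longlonglongrightarrow> expectation (\<lambda>\<omega>. Y \<omega> \<bullet> grad_x_g g (X \<omega>) \<mu>)"
  proof (rule integral_dominated_convergence[OF _ qm wi])
    show "(\<lambda>\<omega>. Y \<omega> \<bullet> grad_x_g g (X \<omega>) \<mu>) \<in> borel_measurable M"
      using L2_D(1)[OF Gxg_L2[OF X]] Ym by (simp add: Gxg_def[abs_def] \<mu>_def)
    have "(\<lambda>n. ?q n \<omega>) \<longlonglongrightarrow> Y \<omega> \<bullet> grad_x_g g (X \<omega>) \<mu>" for \<omega>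
      using difference_quotient_tendsto[OF g_along_segment[OF \<mu>, of "X \<omega>" "Y \<omega>" 0, unfolded scaleR_zero_left add_0_right]]
      by (simp add: e_def)
    thus "AE \<omega> in M. (\<lambda>n. ?q n \<omega>) \<longlonglongrightarrow> Y \<omega> \<bullet> grad_x_g g (X \<omega>) \<mu>" by simp
    show "AE \<omega> in M. norm (?q n \<omega>) \<le> ?w \<omega>" for n using bd by (intro AE_I2)
  qed
  thus "(\<lambda>n. expectation (\<lambda>\<omega>. g (X \<omega> + e n *\<^sub>R Y \<omega>) \<mu> - g (X \<omega>) \<mu>) / e n) \<longlonglongrightarrow> L2_inner M (Gxg M g X) Y"
    by (simp add: L2_inner_def Gxg_def \<mu>_def inner_commute)
qed

text \<open>
As for the terminal cost, with one more ingredient for \<open>\<nabla>\<^sub>\<alpha> L\<close>, which is Lipschitz in the state and the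
law but only continuous in the control. Where \<open>\<beta> \<noteq> 0\<close>, the perturbed control stays in the ball of
radius \<open>2k\<close>; there \<open>\<nabla>\<^sub>\<alpha> L\<close> at state zero and the Dirac mass is bounded by compactness, and the Lipschitz condition does the rest.
\<close>

lemma running_variation:
  assumes X: "case_prod X \<in> L2 PP" and \<alpha>: "case_prod \<alpha> \<in> L2 PP"
    and Y: "case_prod Y \<in> L2 PP" and \<beta>: "case_prod \<beta> \<in> L2 PP"
    and C: "\<And>t \<omega>. norm (Y t \<omega>) \<le> C" and k: "\<And>t \<omega>. norm (\<beta> t \<omega>) \<le> k"
    and supp: "\<And>t \<omega>. \<beta> t \<omega> \<noteq> 0 \<Longrightarrow> norm (\<alpha> t \<omega>) \<le> k"
    and G: "G \<in> sets TT" "\<And>t. t \<in> G \<Longrightarrow> (\<lambda>\<omega>. (X t \<omega>, \<alpha> t \<omega>)) \<in> L2 M"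
  defines "e \<equiv> \<lambda>n. 1 / real (Suc n)" and "\<mu> \<equiv> \<lambda>t. law M (\<lambda>\<omega>. (X t \<omega>, \<alpha> t \<omega>))"
  defines "D \<equiv> \<lambda>n x. if fst x \<in> G then
      L (case_prod X x + e n *\<^sub>R case_prod Y x) (case_prod \<alpha> x + e n *\<^sub>R case_prod \<beta> x) (\<mu> (fst x))
      - L (case_prod X x) (case_prod \<alpha> x) (\<mu> (fst x)) else 0"
  defines "D' \<equiv> \<lambda>x. if fst x \<in> G then
      case_prod Y x \<bullet> grad_x_L L (case_prod X x) (case_prod \<alpha> x) (\<mu> (fst x))
      + case_prod \<beta> x \<bullet> grad_a_L L (case_prod X x) (case_prod \<alpha> x) (\<mu> (fst x)) else 0"
  shows "integrable PP (D n)" "integrable PP D'" "(\<lambda>n. integral\<^sup>L PP (D n) / e n) \<longlonglongrightarrow> integral\<^sup>L PP D'"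
proof -
  have e: "0 < e n" "e n \<le> 1" for n by (auto simp: e_def)
  have C0: "0 \<le> C" and k0: "0 \<le> k" using order_trans[OF norm_ge_zero C] order_trans[OF norm_ge_zero k] by auto
  let ?Z = "\<lambda>t \<omega>. (X t \<omega>, \<alpha> t \<omega>)"
  have Z: "case_prod ?Z \<in> L2 PP" using L2_Pair[OF X \<alpha>] by (simp add: case_prod_beta')
  have W: "(\<lambda>x. ((case_prod X x, case_prod \<alpha> x), (case_prod Y x, case_prod \<beta> x))) \<in> L2 PP"
    by (intro L2_Pair X \<alpha> Y \<beta>)
  have \<mu>P: "\<mu> t \<in> P2" if "t \<in> G" for t unfolding \<mu>_def by (rule law_in_P2[OF G(2)[OF that]])
  obtain K1 K2 where K1: "W2_lipschitz K1 (\<lambda>(x, a). grad_x_L L x a)" and K2: "\<And>a. W2_lipschitz K2 (\<lambda>x m. grad_a_L L x a m)"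
    using Lip unfolding assm_Lip_def by blast
  obtain K where KL: "\<And>m m' x y a b. m \<in> P2 \<Longrightarrow> m' \<in> P2 \<Longrightarrow>
    \<bar>(L (x + y) (a + b) m - L x a m) - (L (x + y) (a + b) m' - L x a m')\<bar> \<le> K * W2 m m' * (norm y + norm b)" "0 \<le> K"
    by (rule L_increment_W2_lipschitz) blast
  let ?F = "\<lambda>n ((x, a), (y, b)) m. L (x + e n *\<^sub>R y) (a + e n *\<^sub>R b) m - L x a m"
  have Dm: "D n \<in> borel_measurable PP" for n
  proof -
    have "(\<lambda>(t, \<omega>). if t \<in> G then ?F n ((\<lambda>x. ((case_prod X x, case_prod \<alpha> x), (case_prod Y x, case_prod \<beta> x))) (t, \<omega>)) (law M (?Z t)) else 0) \<in> borel_measurable (TT \<Otimes>\<^sub>M M)"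
    proof (rule measurable_along_law_flow)
      show "case_prod ?Z \<in> borel_measurable (TT \<Otimes>\<^sub>M M)" using L2_D(1)[OF Z] by (simp add: PP_eq)
      show "(\<lambda>x. ((case_prod X x, case_prod \<alpha> x), (case_prod Y x, case_prod \<beta> x))) \<in> borel_measurable (TT \<Otimes>\<^sub>M M)"
        using L2_D(1)[OF W] by (simp add: PP_eq)
      fix m :: "((real ^ 'd) \<times> (real ^ 'd)) measure" assume m: "m \<in> P2"
      have L1: "continuous_on UNIV (\<lambda>z :: ((real ^ 'd) \<times> (real ^ 'd)) \<times> ((real ^ 'd) \<times> (real ^ 'd)).
          (\<lambda>(x, a). L x a m) (fst (fst z) + e n *\<^sub>R fst (snd z), snd (fst z) + e n *\<^sub>R snd (snd z)))"
        by (rule continuous_on_compose2[OF L_continuous[OF m]]) (auto intro!: continuous_intros)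
      have L2: "continuous_on UNIV (\<lambda>z :: ((real ^ 'd) \<times> (real ^ 'd)) \<times> ((real ^ 'd) \<times> (real ^ 'd)).
          (\<lambda>(x, a). L x a m) (fst (fst z), snd (fst z)))"
        by (rule continuous_on_compose2[OF L_continuous[OF m]]) (auto intro!: continuous_intros)
      have "continuous_on UNIV (\<lambda>z. ?F n z m)"
        using continuous_on_diff[OF L1 L2] by (simp add: case_prod_beta')
      thus "(\<lambda>z. ?F n z m) \<in> borel_measurable borel" by (rule borel_measurable_continuous_onI)
    next
      fix z :: "((real ^ 'd) \<times> (real ^ 'd)) \<times> ((real ^ 'd) \<times> (real ^ 'd))"
        and m :: "((real ^ 'd) \<times> (real ^ 'd)) measure" and r :: real
      assume m: "m \<in> P2" and r: "0 < r"
      obtain x a y b where z: "z = ((x, a), (y, b))" by (metis surj_pair)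
      let ?N = "norm (e n *\<^sub>R y) + norm (e n *\<^sub>R b)"
      have p: "0 < K * ?N + 1" using KL(2) by (intro add_nonneg_pos mult_nonneg_nonneg) auto
      show "\<exists>d>0. \<forall>m'\<in>P2. W2 m m' < d \<longrightarrow> dist (?F n z m) (?F n z m') < r"
      proof (intro exI conjI ballI impI)
        show "0 < r / (K * ?N + 1)" using p r by simp
        fix m' :: "((real ^ 'd) \<times> (real ^ 'd)) measure" assume m': "m' \<in> P2" "W2 m m' < r / (K * ?N + 1)"
        have "dist (?F n z m) (?F n z m') \<le> K * W2 m m' * ?N"
          using KL(1)[OF m m'(1), of x "e n *\<^sub>R y" a "e n *\<^sub>R b"] by (simp add: z dist_real_def)
        also have "\<dots> = W2 m m' * (K * ?N)" by simp
        also have "\<dots> \<le> W2 m m' * (K * ?N + 1)" by (intro mult_left_mono W2_nonneg) auto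
        also have "\<dots> < r" using m'(2) p by (simp only: pos_less_divide_eq)
        finally show "dist (?F n z m) (?F n z m') < r" .
      qed
    qed (use G in auto)
    thus ?thesis unfolding PP_eq D_def \<mu>_def
      by (rule measurable_cong[THEN iffD1, rotated]) auto
  qed
  let ?\<delta> = "law M (\<lambda>_. 0 :: (real ^ 'd) \<times> (real ^ 'd))"
  let ?l = "\<lambda>t. L2_norm M (?Z t)"
  let ?c1 = "norm (grad_x_L L 0 0 ?\<delta>)"
  obtain c2 where c2: "\<And>a. norm a \<le> 2 * k \<Longrightarrow> norm (grad_a_L L 0 a ?\<delta>) \<le> c2" and c20: "0 \<le> c2"
  proof -
    have "isCont (\<lambda>z. (\<lambda>(x, a). grad_a_L L x a) z ?\<delta>) z" for z
      using Lip by (intro W2_continuous_at_fixed_measure law_in_P2 L2_zero) (auto simp: assm_Lip_def)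
    hence "continuous_on UNIV (\<lambda>z. (\<lambda>(x, a). grad_a_L L x a) z ?\<delta>)"
      by (intro continuous_at_imp_continuous_on) auto
    hence "continuous_on (cball 0 (2 * k)) (\<lambda>a. (\<lambda>(x, a). grad_a_L L x a) (0, a) ?\<delta>)"
      by (rule continuous_on_compose2) (auto intro!: continuous_intros)
    hence "compact ((\<lambda>a. grad_a_L L 0 a ?\<delta>) ` cball 0 (2 * k))"
      by (intro compact_continuous_image) auto
    hence "bounded ((\<lambda>a. grad_a_L L 0 a ?\<delta>) ` cball 0 (2 * k))" by (rule compact_imp_bounded)
    then obtain c where c': "\<And>y. y \<in> (\<lambda>a. grad_a_L L 0 a ?\<delta>) ` cball 0 (2 * k) \<Longrightarrow> norm y \<le> c"
      unfolding bounded_iff by blast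
    have c: "norm (grad_a_L L 0 a ?\<delta>) \<le> c" if "norm a \<le> 2 * k" for a
    proof (rule c', rule imageI)
      show "a \<in> cball 0 (2 * k)" using that by simp
    qed
    show thesis
    proof (rule that)
      show "norm (grad_a_L L 0 a ?\<delta>) \<le> \<bar>c\<bar>" if "norm a \<le> 2 * k" for a using c[OF that] by linarith
    qed auto
  qed
  let ?w = "\<lambda>x. C * (?c1 + \<bar>K1\<bar> * ((norm (case_prod X x) + C + (norm (case_prod \<alpha> x) + k)) + ?l (fst x)))
      + k * (c2 + \<bar>K2\<bar> * ((norm (case_prod X x) + C) + ?l (fst x)))"
  have li: "integrable PP (\<lambda>x. ?l (fst x))" by (rule PP.L2_integrable[OF L2_norm_in_time[OF Z]])
  have wi: "integrable PP ?w"
    using PP.L2_integrable_norm[OF X] PP.L2_integrable_norm[OF \<alpha>] li by simp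
  have w0: "0 \<le> ?w x" for x
    using C0 k0 c20 by (intro add_nonneg_nonneg mult_nonneg_nonneg) auto
  let ?q = "\<lambda>n x. D n x / e n"
  have qm: "?q n \<in> borel_measurable PP" for n using Dm[of n] by simp
  have bd: "norm (?q n x) \<le> ?w x" for n x
  proof (cases "fst x \<in> G")
    case True
    obtain t \<omega> where x: "x = (t, \<omega>)" by (cases x)
    have t: "t \<in> G" using True x by simp
    obtain s where s: "0 < s" "s < e n" and eq: "L (X t \<omega> + e n *\<^sub>R Y t \<omega>) (\<alpha> t \<omega> + e n *\<^sub>R \<beta> t \<omega>) (\<mu> t) - L (X t \<omega>) (\<alpha> t \<omega>) (\<mu> t) =
      e n * (Y t \<omega> \<bullet> grad_x_L L (X t \<omega> + s *\<^sub>R Y t \<omega>) (\<alpha> t \<omega> + s *\<^sub>R \<beta> t \<omega>) (\<mu> t) + \<beta> t \<omega> \<bullet> grad_a_L L (X t \<omega> + s *\<^sub>R Y t \<omega>) (\<alpha> t \<omega> + s *\<^sub>R \<beta> t \<omega>) (\<mu> t))"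
      by (rule L_increment_mvt[OF \<mu>P[OF t] e(1)])
    let ?x = "X t \<omega> + s *\<^sub>R Y t \<omega>" and ?a = "\<alpha> t \<omega> + s *\<^sub>R \<beta> t \<omega>"
    have s1: "\<bar>s\<bar> \<le> 1" using s e(2)[of n] by linarith
    have sY: "norm (s *\<^sub>R Y t \<omega>) \<le> 1 * C" using s1 C[of t \<omega>] unfolding norm_scaleR by (intro mult_mono) auto
    have sb: "norm (s *\<^sub>R \<beta> t \<omega>) \<le> 1 * k" using s1 k[of t \<omega>] unfolding norm_scaleR by (intro mult_mono) auto
    have nx: "norm ?x \<le> norm (X t \<omega>) + C" using norm_triangle_ineq[of "X t \<omega>" "s *\<^sub>R Y t \<omega>"] sY by linarith
    have na: "norm ?a \<le> norm (\<alpha> t \<omega>) + k" using norm_triangle_ineq[of "\<alpha> t \<omega>" "s *\<^sub>R \<beta> t \<omega>"] sb by linarith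
    have nz: "norm (?x, ?a) \<le> norm (X t \<omega>) + C + (norm (\<alpha> t \<omega>) + k)"
      using norm_Pair_le[of ?x ?a] nx na by linarith
    have "norm (grad_x_L L ?x ?a (\<mu> t)) \<le> ?c1 + \<bar>K1\<bar> * (norm (?x, ?a) + ?l t)"
      using lipschitz_law_bound[OF K1 G(2)[OF t], of "(?x, ?a)"] by (simp add: \<mu>_def zero_prod_def)
    also have "\<dots> \<le> ?c1 + \<bar>K1\<bar> * ((norm (X t \<omega>) + C + (norm (\<alpha> t \<omega>) + k)) + ?l t)"
      using nz by (intro add_left_mono mult_left_mono add_right_mono) auto
    finally have B1: "norm (grad_x_L L ?x ?a (\<mu> t)) \<le> ?c1 + \<bar>K1\<bar> * ((norm (X t \<omega>) + C + (norm (\<alpha> t \<omega>) + k)) + ?l t)" .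
    have b1: "\<bar>Y t \<omega> \<bullet> grad_x_L L ?x ?a (\<mu> t)\<bar> \<le> C * (?c1 + \<bar>K1\<bar> * ((norm (X t \<omega>) + C + (norm (\<alpha> t \<omega>) + k)) + ?l t))"
      using B1 C[of t \<omega>] C0 by (intro order_trans[OF Cauchy_Schwarz_ineq2] mult_mono) auto
    have b2: "\<bar>\<beta> t \<omega> \<bullet> grad_a_L L ?x ?a (\<mu> t)\<bar> \<le> k * (c2 + \<bar>K2\<bar> * ((norm (X t \<omega>) + C) + ?l t))"
    proof (cases "\<beta> t \<omega> = 0")
      case True
      thus ?thesis using C0 k0 c20 by (auto intro!: mult_nonneg_nonneg add_nonneg_nonneg)
    next
      case False
      have "norm ?a \<le> 2 * k" using na supp[OF False] by linarith
      have "norm (grad_a_L L ?x ?a (\<mu> t)) \<le> norm (grad_a_L L 0 ?a ?\<delta>) + \<bar>K2\<bar> * (norm ?x + ?l t)"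
        using lipschitz_law_bound[OF K2 G(2)[OF t], of ?x ?a] by (simp add: \<mu>_def)
      also have "\<dots> \<le> c2 + \<bar>K2\<bar> * ((norm (X t \<omega>) + C) + ?l t)"
        using nx c2[OF \<open>norm ?a \<le> 2 * k\<close>] by (intro add_mono mult_left_mono add_right_mono) auto
      finally show ?thesis
        using k[of t \<omega>] k0 by (intro order_trans[OF Cauchy_Schwarz_ineq2] mult_mono) auto
    qed
    have "?q n x = Y t \<omega> \<bullet> grad_x_L L ?x ?a (\<mu> t) + \<beta> t \<omega> \<bullet> grad_a_L L ?x ?a (\<mu> t)"
      using eq e(1)[of n] t by (simp add: D_def x)
    hence "norm (?q n x) \<le> \<bar>Y t \<omega> \<bullet> grad_x_L L ?x ?a (\<mu> t)\<bar> + \<bar>\<beta> t \<omega> \<bullet> grad_a_L L ?x ?a (\<mu> t)\<bar>"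
      by (simp add: abs_triangle_ineq)
    also have "\<dots> \<le> ?w x" using add_mono[OF b1 b2] by (simp add: x)
    finally show ?thesis .
  qed (use w0 in \<open>auto simp: D_def\<close>)
  have lim: "(\<lambda>n. ?q n x) \<longlonglongrightarrow> D' x" for x
  proof (cases "fst x \<in> G")
    case True
    from difference_quotient_tendsto[OF L_along_segment[OF \<mu>P[OF True], of "case_prod X x" "case_prod Y x" "case_prod \<alpha> x" "case_prod \<beta> x" 0, unfolded scaleR_zero_left add_0_right]]
    show ?thesis using True by (simp add: D_def D'_def e_def)
  qed (simp add: D_def D'_def)
  have D'm: "D' \<in> borel_measurable PP"
    using lim by (intro borel_measurable_LIMSEQ_metric[OF qm]) auto
  have qi: "integrable PP (?q n)" for n
    by (rule Bochner_Integration.integrable_bound[OF wi qm]) (use bd w0 in auto)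
  show "integrable PP (D n)"
    using integrable_mult_left[of "e n" PP "?q n"] qi[of n] e(1)[of n] by simp
  have bd': "norm (D' x) \<le> ?w x" for x
    by (rule LIMSEQ_le_const2[OF tendsto_norm[OF lim[of x]]]) (use bd in blast)
  show "integrable PP D'"
    by (rule Bochner_Integration.integrable_bound[OF wi D'm]) (use bd' w0 in auto)
  have "(\<lambda>n. integral\<^sup>L PP (?q n)) \<longlonglongrightarrow> integral\<^sup>L PP D'"
    by (rule integral_dominated_convergence[OF D'm qm wi]) (use lim bd in auto)
  thus "(\<lambda>n. integral\<^sup>L PP (D n) / e n) \<longlonglongrightarrow> integral\<^sup>L PP D'" by simp
qed

lemma primitive_norm_le:
  assumes "\<And>t \<omega>. norm (\<beta> t \<omega>) \<le> k"
  shows "norm (primitive \<beta> t \<omega>) \<le> k * T"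
proof -
  have "norm (primitive \<beta> t \<omega>) \<le> (\<integral>s. norm (indicat_real {0..t} s *\<^sub>R \<beta> s \<omega>) \<partial>TT)"
    unfolding primitive_def by (rule integral_norm_bound)
  also have "\<dots> \<le> (\<integral>s. k \<partial>TT)"
  proof (rule integral_mono')
    show "norm (indicat_real {0..t} s *\<^sub>R \<beta> s \<omega>) \<le> k" for s
      using assms[of s \<omega>] order_trans[OF norm_ge_zero assms[of s \<omega>]] by (auto simp: indicator_def)
  qed (use order_trans[OF norm_ge_zero assms] in auto)
  finally show ?thesis using measure_TT by (simp add: mult.commute)
qed

section \<open>The first-order condition at the equilibrium\<close>

text \<open>
Compare the costs of \<open>\<alpha>\<close> and \<open>\<alpha> + \<epsilon>\<beta>\<close> for the frozen flow, divide by \<open>\<epsilon>\<close> and let \<open>\<epsilon> = 1/(n+1)\<close> tend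
to zero. The cost of the perturbed control is obtained by adding the measurable increment \<open>D\<close> to a
representative \<open>f'\<close> of the running cost of \<open>\<alpha>\<close>, which exists because the cost of \<open>\<alpha>\<close> is defined.
\<close>

lemma first_order_condition_truncated:
  assumes sol: "solves_mfg M T \<sigma> X0 B g L \<alpha>" and \<beta>: "\<beta> \<in> HT M T \<FF>"
    and k: "\<And>t \<omega>. norm (\<beta> t \<omega>) \<le> k"
    and supp: "\<And>t \<omega>. \<beta> t \<omega> \<noteq> 0 \<Longrightarrow> norm (\<alpha> t \<omega>) \<le> k"
  shows "0 \<le> L2_inner PP (case_prod (v \<alpha>)) (case_prod \<beta>)"
proof -
  have TT: "T \<in> {0..T}" using T_pos by simp
  define m where "m = law_flow M \<sigma> X0 B \<alpha>"
  define e where "e n = 1 / real (Suc n)" for n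
  define Y where "Y = (\<lambda>t \<omega>. - primitive \<beta> t \<omega>)"
  have \<alpha>: "\<alpha> \<in> HT M T \<FF>" and cd: "cost_defined M T \<sigma> X0 B g L \<alpha> m"
    and opt: "\<And>\<alpha>'. \<alpha>' \<in> HT M T \<FF> \<Longrightarrow> cost_defined M T \<sigma> X0 B g L \<alpha>' m \<Longrightarrow>
        cost M T \<sigma> X0 B g L \<alpha> m \<le> cost M T \<sigma> X0 B g L \<alpha>' m"
    using sol unfolding solves_mfg_def m_def by blast+
  note \<alpha>2 = HT_L2[OF \<alpha>] and \<beta>2 = HT_L2[OF \<beta>]
  note p2 = primitive_L2(2)[OF \<beta>2] and pt = primitive_L2(1)[OF \<beta>2]
  have Y2: "case_prod Y \<in> L2 PP" using L2_minus[OF p2] by (simp add: Y_def case_prod_beta')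
  have Yt: "Y t \<in> L2 M" if "t \<in> {0..T}" for t unfolding Y_def by (rule L2_minus[OF pt[OF that]])
  have YC: "norm (Y t \<omega>) \<le> k * T" for t \<omega> using primitive_norm_le[OF k] by (simp add: Y_def)
  obtain X where X: "case_prod X \<in> L2 PP" and Xeq: "AE \<omega> in M. \<forall>t\<in>{0..T}. X t \<omega> = \<X> \<alpha> t \<omega>"
    by (rule state_version[OF \<alpha>2])
  let ?Z = "\<lambda>t \<omega>. (X t \<omega>, \<alpha> t \<omega>)"
  have Z: "case_prod ?Z \<in> L2 PP" using L2_Pair[OF X \<alpha>2] by (simp add: case_prod_beta')
  obtain G where G: "G \<in> sets TT" "AE t in TT. t \<in> G" "\<And>t. t \<in> G \<Longrightarrow> ?Z t \<in> L2 M" "\<And>t. t \<in> G \<Longrightarrow> t \<in> {0..T}"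
    using good_times[OF Z] by blast
  have mG: "m t = law M (?Z t)" if "t \<in> G" for t
    unfolding m_def law_flow_def by (rule joint_law_version[OF \<alpha>2 Xeq G(4)[OF that] G(3)[OF that]])
  note XT = state_L2[OF \<alpha>2 TT, of \<sigma>]
  define \<mu>T where "\<mu>T = law M (\<X> \<alpha> T)"
  have mT: "distr (m T) borel fst = \<mu>T"
  proof -
    have \<alpha>T: "\<alpha> T \<in> borel_measurable M"
      using PP_section_measurable(2)[OF L2_D(1)[OF \<alpha>2] TT] by simp
    have "(\<lambda>\<omega>. (\<X> \<alpha> T \<omega>, \<alpha> T \<omega>)) \<in> borel_measurable M"
      by (intro borel_measurable_Pair \<alpha>T L2_D(1)[OF XT])
    moreover have "(fst :: (real ^ 'd) \<times> (real ^ 'd) \<Rightarrow> real ^ 'd) \<in> borel_measurable borel"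
      by (simp add: borel_prod[symmetric])
    ultimately show ?thesis unfolding m_def law_flow_def \<mu>T_def by (simp add: distr_distr comp_def)
  qed
  have \<mu>TP: "\<mu>T \<in> P2" unfolding \<mu>T_def by (rule law_in_P2[OF XT])
  have g0: "integrable M (\<lambda>\<omega>. g (\<X> \<alpha> T \<omega>) \<mu>T)"
    using cd unfolding cost_defined_def mT by blast
  let ?f0 = "\<lambda>x. L (\<X> \<alpha> (fst x) (snd x)) (\<alpha> (fst x) (snd x)) (m (fst x))"
  have f0: "integrable (completion PP) ?f0"
    using cd unfolding cost_defined_def by (simp add: case_prod_beta')
  obtain f' where f'm: "f' \<in> borel_measurable PP" and f'eq: "AE x in PP. ?f0 x = f' x"
    using completion_ex_borel_measurable_real[OF borel_measurable_integrable[OF f0]] by blast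
  have "integrable (completion PP) f'"
    using integrable_cong_AE[OF borel_measurable_integrable[OF f0] measurable_completion[OF f'm] AE_completion[OF f'eq]] f0 by blast
  hence f'i: "integrable PP f'" using integrable_completion[OF f'm] by blast
  have f'eq': "AE x in PP. f' x = ?f0 x" using f'eq by eventually_elim simp
  have cost0: "cost M T \<sigma> X0 B g L \<alpha> m = expectation (\<lambda>\<omega>. g (\<X> \<alpha> T \<omega>) \<mu>T) + integral\<^sup>L PP f'"
    using cost_version(2)[of \<alpha> m f'] g0 f'i f'eq' unfolding mT by blast
  define D where "D n x = (if fst x \<in> G then
      L (case_prod X x + e n *\<^sub>R case_prod Y x) (case_prod \<alpha> x + e n *\<^sub>R case_prod \<beta> x) (law M (?Z (fst x)))
      - L (case_prod X x) (case_prod \<alpha> x) (law M (?Z (fst x))) else 0)" for n x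
  define D' where "D' x = (if fst x \<in> G then
      case_prod Y x \<bullet> grad_x_L L (case_prod X x) (case_prod \<alpha> x) (law M (?Z (fst x)))
      + case_prod \<beta> x \<bullet> grad_a_L L (case_prod X x) (case_prod \<alpha> x) (law M (?Z (fst x))) else 0)" for x
  have rv: "integrable PP (D n)" "integrable PP D'" "(\<lambda>n. integral\<^sup>L PP (D n) / e n) \<longlonglongrightarrow> integral\<^sup>L PP D'" for n
    unfolding D_def[abs_def] D'_def[abs_def] e_def[abs_def]
    by (rule running_variation[OF X \<alpha>2 Y2 \<beta>2 YC k _ G(1)]; use supp G(3) in blast)+
  note tv = terminal_variation[OF XT Yt[OF TT] YC, folded e_def \<mu>T_def]
  have e: "0 < e n" for n by (simp add: e_def)
  have ineq: "0 \<le> expectation (\<lambda>\<omega>. g (\<X> \<alpha> T \<omega> + e n *\<^sub>R Y T \<omega>) \<mu>T - g (\<X> \<alpha> T \<omega>) \<mu>T) / e n + integral\<^sup>L PP (D n) / e n" for n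
  proof -
    define \<alpha>n where "\<alpha>n = (\<lambda>t \<omega>. \<alpha> t \<omega> + e n *\<^sub>R \<beta> t \<omega>)"
    have \<alpha>n: "\<alpha>n \<in> HT M T \<FF>" unfolding \<alpha>n_def by (intro HT_add HT_scaleR \<alpha> \<beta>)
    have st: "AE \<omega> in M. \<forall>t\<in>{0..T}. \<X> \<alpha>n t \<omega> = \<X> \<alpha> t \<omega> + e n *\<^sub>R Y t \<omega>"
      using state_perturb[OF \<alpha>2 \<beta>2, of \<sigma> "e n"] by eventually_elim (simp add: \<alpha>n_def Y_def)
    have XTn: "\<X> \<alpha>n T \<in> L2 M" by (rule state_L2[OF HT_L2[OF \<alpha>n] TT])
    let ?dg = "\<lambda>\<omega>. g (\<X> \<alpha> T \<omega> + e n *\<^sub>R Y T \<omega>) \<mu>T - g (\<X> \<alpha> T \<omega>) \<mu>T"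
    note gm = g_measurable[OF \<mu>TP L2_D(1)[OF XTn]]
    have gs: "integrable M (\<lambda>\<omega>. g (\<X> \<alpha> T \<omega>) \<mu>T + ?dg \<omega>)"
      by (rule Bochner_Integration.integrable_add[OF g0 tv(1)])
    have gae: "AE \<omega> in M. g (\<X> \<alpha> T \<omega>) \<mu>T + ?dg \<omega> = g (\<X> \<alpha>n T \<omega>) \<mu>T"
      using st by eventually_elim (use TT in simp)
    have gn: "integrable M (\<lambda>\<omega>. g (\<X> \<alpha>n T \<omega>) \<mu>T)"
      using integrable_cong_AE[OF borel_measurable_integrable[OF gs] gm gae] gs by blast
    have gE: "expectation (\<lambda>\<omega>. g (\<X> \<alpha>n T \<omega>) \<mu>T) = expectation (\<lambda>\<omega>. g (\<X> \<alpha> T \<omega>) \<mu>T) + expectation ?dg"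
      using integral_cong_AE[OF borel_measurable_integrable[OF gs] gm gae]
        Bochner_Integration.integral_add[OF g0 tv(1)] by simp
    have fi: "integrable PP (\<lambda>x. f' x + D n x)" by (rule Bochner_Integration.integrable_add[OF f'i rv(1)])
    have paths: "AE \<omega> in M. \<forall>t\<in>G. L (\<X> \<alpha>n t \<omega>) (\<alpha>n t \<omega>) (m t) = L (\<X> \<alpha> t \<omega>) (\<alpha> t \<omega>) (m t) + D n (t, \<omega>)"
      using st Xeq
    proof eventually_elim
      case (elim \<omega>)
      show ?case
      proof
        fix t assume t: "t \<in> G"
        show "L (\<X> \<alpha>n t \<omega>) (\<alpha>n t \<omega>) (m t) = L (\<X> \<alpha> t \<omega>) (\<alpha> t \<omega>) (m t) + D n (t, \<omega>)"
          using elim G(4)[OF t] t by (simp add: D_def mG \<alpha>n_def)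
      qed
    qed
    have fae: "AE x in PP. f' x + D n x = L (\<X> \<alpha>n (fst x) (snd x)) (\<alpha>n (fst x) (snd x)) (m (fst x))"
      using f'eq' AE_PP_of_paths[OF G(1,2) paths] by eventually_elim simp
    have cdn: "cost_defined M T \<sigma> X0 B g L \<alpha>n m"
      and costn: "cost M T \<sigma> X0 B g L \<alpha>n m = expectation (\<lambda>\<omega>. g (\<X> \<alpha>n T \<omega>) \<mu>T) + integral\<^sup>L PP (\<lambda>x. f' x + D n x)"
      using cost_version[of \<alpha>n m "\<lambda>x. f' x + D n x"] gn fi fae unfolding mT by blast+
    have "0 \<le> expectation ?dg + integral\<^sup>L PP (D n)"
      using opt[OF \<alpha>n cdn] cost0 costn gE Bochner_Integration.integral_add[OF f'i rv(1)] by simp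
    hence "0 \<le> (expectation ?dg + integral\<^sup>L PP (D n)) / e n" using e[of n] by simp
    thus ?thesis by (simp add: add_divide_distrib)
  qed
  have "0 \<le> L2_inner M (Gxg M g (\<X> \<alpha> T)) (Y T) + integral\<^sup>L PP D'"
    using tendsto_add[OF tv(2) rv(3)] ineq by (intro LIMSEQ_le_const) auto
  moreover obtain A H where A: "case_prod A \<in> L2 PP" and H: "case_prod H \<in> L2 PP"
    and At: "AE t in TT. AE \<omega> in M. A t \<omega> = GaL M L (\<X> \<alpha> t) (\<alpha> t) \<omega>"
    and Ht: "AE t in TT. AE \<omega> in M. H t \<omega> = GxL M L (\<X> \<alpha> t) (\<alpha> t) \<omega>"
    and dual: "\<And>\<beta>. \<beta> \<in> HT M T \<FF> \<Longrightarrow> L2_inner PP (case_prod (v \<alpha>)) (case_prod \<beta>) =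
       L2_inner PP (case_prod A) (case_prod \<beta>) - L2_inner PP (case_prod H) (case_prod (primitive \<beta>))
       - L2_inner M (Gxg M g (\<X> \<alpha> T)) (primitive \<beta> T)"
    by (rule operator_duality[OF \<alpha>]) blast
  moreover have "integral\<^sup>L PP D' = L2_inner PP (case_prod A) (case_prod \<beta>) - L2_inner PP (case_prod H) (case_prod (primitive \<beta>))"
  proof -
    note iA = L2_integrable_inner[OF A \<beta>2] and iH = L2_integrable_inner[OF H p2]
    note iD' = rv(2)
    let ?E = "\<lambda>x. case_prod A x \<bullet> case_prod \<beta> x - case_prod H x \<bullet> case_prod (primitive \<beta>) x"
    have iE: "integrable PP ?E" by (rule Bochner_Integration.integrable_diff[OF iA iH])
    have "AE t in TT. (\<integral>\<omega>. D' (t, \<omega>) \<partial>M) = (\<integral>\<omega>. ?E (t, \<omega>) \<partial>M)"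
      using G(2) At Ht
    proof eventually_elim
      case (elim t)
      note t = G(4)[OF elim(1)]
      have "AE \<omega> in M. D' (t, \<omega>) = ?E (t, \<omega>)"
        using elim(2,3) Xeq
      proof eventually_elim
        case (elim \<omega>)
        have 1: "\<X> \<alpha> t \<omega> = X t \<omega>" using elim(3) t by simp
        have 2: "law M (\<lambda>\<omega>. (\<X> \<alpha> t \<omega>, \<alpha> t \<omega>)) = law M (?Z t)"
          using mG[OF \<open>t \<in> G\<close>] by (simp add: m_def law_flow_def)
        show ?case using elim(1,2) \<open>t \<in> G\<close>
          by (simp add: D'_def GaL_def GxL_def 1 2 Y_def inner_commute)
      qed
      moreover have "(\<lambda>\<omega>. D' (t, \<omega>)) \<in> borel_measurable M" "(\<lambda>\<omega>. ?E (t, \<omega>)) \<in> borel_measurable M"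
        using PP_section_measurable(2)[OF borel_measurable_integrable[OF iD'] t]
          PP_section_measurable(2)[OF borel_measurable_integrable[OF iE] t] by auto
      ultimately show ?case by (intro integral_cong_AE)
    qed
    hence "(\<integral>t. (\<integral>\<omega>. D' (t, \<omega>) \<partial>M) \<partial>TT) = (\<integral>t. (\<integral>\<omega>. ?E (t, \<omega>) \<partial>M) \<partial>TT)"
      by (intro integral_cong_AE borel_measurable_integrable integral_PP_swap(4) iD' iE)
    hence "integral\<^sup>L PP D' = integral\<^sup>L PP ?E"
      using integral_PP_swap(2)[OF iD'] integral_PP_swap(2)[OF iE] by (simp only:)
    thus ?thesis using Bochner_Integration.integral_diff[OF iA iH] by (simp add: L2_inner_def)
  qed
  moreover have "L2_inner M (Gxg M g (\<X> \<alpha> T)) (Y T) = - L2_inner M (Gxg M g (\<X> \<alpha> T)) (primitive \<beta> T)"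
    using L2_inner_scaleR(2)[of M "Gxg M g (\<X> \<alpha> T)" "-1" "primitive \<beta> T"] by (simp add: Y_def)
  ultimately show ?thesis using dual[OF \<beta>] by linarith
qed

lemma first_order_condition:
  assumes sol: "solves_mfg M T \<sigma> X0 B g L \<alpha>" and \<beta>: "\<beta> \<in> HT M T \<FF>"
  shows "0 \<le> L2_inner PP (case_prod (v \<alpha>)) (case_prod \<beta>)"
proof -
  have \<alpha>: "\<alpha> \<in> HT M T \<FF>" using sol by (simp add: solves_mfg_def)
  note v2 = HT_L2[OF operator_HT[OF \<alpha>]] and \<beta>2 = HT_L2[OF \<beta>] and \<alpha>2 = HT_L2[OF \<alpha>]
  define b where "b n = (\<lambda>t \<omega>. if norm (\<beta> t \<omega>) \<le> real n \<and> norm (\<alpha> t \<omega>) \<le> real n then \<beta> t \<omega> else 0)" for n :: nat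
  have b2: "case_prod (b n) \<in> L2 PP" for n
  proof (rule L2_norm_bound[OF \<beta>2])
    have "(\<lambda>x. if norm (case_prod \<beta> x) \<le> real n \<and> norm (case_prod \<alpha> x) \<le> real n then case_prod \<beta> x else 0) \<in> borel_measurable PP"
      using L2_D(1)[OF \<beta>2] L2_D(1)[OF \<alpha>2] by measurable
    thus "case_prod (b n) \<in> borel_measurable PP" by (rule measurable_cong[THEN iffD1, rotated]) (auto simp: b_def)
  qed (auto simp: b_def)
  have bHT: "b n \<in> HT M T \<FF>" for n
  proof -
    have "b n t \<in> borel_measurable (\<FF> t)" if "t \<in> {0..T}" for t
    proof -
      have [measurable]: "\<beta> t \<in> borel_measurable (\<FF> t)" "\<alpha> t \<in> borel_measurable (\<FF> t)"
        using \<alpha> \<beta> that by (auto simp: HT_def)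
      show ?thesis unfolding b_def by measurable
    qed
    thus ?thesis using b2[of n] by (auto simp: HT_def L2_def case_prod_beta')
  qed
  have pos: "0 \<le> L2_inner PP (case_prod (v \<alpha>)) (case_prod (b n))" for n
    by (rule first_order_condition_truncated[OF sol bHT, where k="real n"]) (auto simp: b_def split: if_splits)
  have "(\<lambda>n. \<integral>x. case_prod (v \<alpha>) x \<bullet> case_prod (b n) x \<partial>PP) \<longlonglongrightarrow> (\<integral>x. case_prod (v \<alpha>) x \<bullet> case_prod \<beta> x \<partial>PP)"
  proof (rule integral_dominated_convergence[where w="\<lambda>x. \<bar>case_prod (v \<alpha>) x \<bullet> case_prod \<beta> x\<bar>"])
    show "integrable PP (\<lambda>x. \<bar>case_prod (v \<alpha>) x \<bullet> case_prod \<beta> x\<bar>)"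
      using L2_integrable_inner[OF v2 \<beta>2] by (rule integrable_abs)
    show "AE x in PP. norm (case_prod (v \<alpha>) x \<bullet> case_prod (b n) x) \<le> \<bar>case_prod (v \<alpha>) x \<bullet> case_prod \<beta> x\<bar>" for n
      by (intro AE_I2) (auto simp: b_def)
    show "AE x in PP. (\<lambda>n. case_prod (v \<alpha>) x \<bullet> case_prod (b n) x) \<longlonglongrightarrow> case_prod (v \<alpha>) x \<bullet> case_prod \<beta> x"
    proof (intro AE_I2 tendsto_eventually)
      fix x :: "real \<times> 'w"
      obtain N :: nat where N: "max (norm (case_prod \<beta> x)) (norm (case_prod \<alpha> x)) \<le> real N"
        using real_arch_simple by blast
      show "\<forall>\<^sub>F n in sequentially. case_prod (v \<alpha>) x \<bullet> case_prod (b n) x = case_prod (v \<alpha>) x \<bullet> case_prod \<beta> x"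
      proof (rule eventually_sequentiallyI[of N])
        fix n assume "N \<le> n"
        hence "real N \<le> real n" by simp
        thus "case_prod (v \<alpha>) x \<bullet> case_prod (b n) x = case_prod (v \<alpha>) x \<bullet> case_prod \<beta> x"
          using N by (auto simp: b_def case_prod_beta')
      qed
    qed
  qed (use borel_measurable_integrable[OF L2_integrable_inner[OF v2 \<beta>2]] borel_measurable_integrable[OF L2_integrable_inner[OF v2 b2]] in auto)
  hence "(\<lambda>n. L2_inner PP (case_prod (v \<alpha>)) (case_prod (b n))) \<longlonglongrightarrow> L2_inner PP (case_prod (v \<alpha>)) (case_prod \<beta>)"
    by (simp add: L2_inner_def)
  thus ?thesis using pos by (intro LIMSEQ_le_const) auto
qed

section \<open>The Lipschitz estimate\<close>

text \<open>
The supremum defining the Lipschitz norm omits pairs of controls at distance zero, and such pairs need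
not be equal as functions. For them the estimate follows by passing through a third control at a small
positive distance.
\<close>

lemma operator_lipschitz:
  assumes \<gamma>: "0 < \<gamma>" "ennreal \<gamma> \<le> 1 / lip_norm M T \<FF> v"
    and \<alpha>: "\<alpha> \<in> HT M T \<FF>" and \<beta>: "\<beta> \<in> HT M T \<FF>"
  shows "\<gamma> * L2_norm PP (\<lambda>x. case_prod (v \<alpha>) x - case_prod (v \<beta>) x) \<le> L2_norm PP (\<lambda>x. case_prod \<alpha> x - case_prod \<beta> x)"
proof -
  define dv where "dv = (\<lambda>\<alpha> \<beta>. L2_norm PP (\<lambda>x. case_prod (v \<alpha>) x - case_prod (v \<beta>) x))"
  define d where "d = (\<lambda>\<alpha> \<beta> :: real \<Rightarrow> 'w \<Rightarrow> real ^ 'd. L2_norm PP (\<lambda>x. case_prod \<alpha> x - case_prod \<beta> x))"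
  have nT: "normT M T (\<lambda>t \<omega>. \<alpha> t \<omega> - \<beta> t \<omega>) = d \<alpha> \<beta>" if "\<alpha> \<in> HT M T \<FF>" "\<beta> \<in> HT M T \<FF>" for \<alpha> \<beta> :: "real \<Rightarrow> 'w \<Rightarrow> real ^ 'd"
    using normT_eq[OF HT_L2[OF HT_diff[OF that]]] by (simp add: d_def case_prod_beta')
  have main: "\<gamma> * dv \<alpha> \<beta> \<le> d \<alpha> \<beta>" if H: "\<alpha> \<in> HT M T \<FF>" "\<beta> \<in> HT M T \<FF>" and nz: "d \<alpha> \<beta> \<noteq> 0" for \<alpha> \<beta>
  proof -
    let ?q = "dv \<alpha> \<beta> / d \<alpha> \<beta>" and ?l = "lip_norm M T \<FF> v"
    have vq: "normT M T (\<lambda>t \<omega>. v \<alpha> t \<omega> - v \<beta> t \<omega>) = dv \<alpha> \<beta>"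
      using nT[OF operator_HT[OF H(1)] operator_HT[OF H(2)]] by (simp add: d_def dv_def)
    have "ennreal (normT M T (\<lambda>t \<omega>. v \<alpha> t \<omega> - v \<beta> t \<omega>) / normT M T (\<lambda>t \<omega>. \<alpha> t \<omega> - \<beta> t \<omega>)) \<le> ?l"
      unfolding lip_norm_def
      by (rule SUP_upper2[of "(\<alpha>, \<beta>)"]) (use H nz nT[OF H] in auto)
    hence ql: "ennreal ?q \<le> ?l" by (simp add: vq nT[OF H])
    have dp: "0 < d \<alpha> \<beta>" using nz by (simp add: d_def less_le)
    have q0: "0 \<le> ?q" using dp by (simp add: dv_def)
    have "\<gamma> * ?q \<le> 1"
    proof (cases ?l)
      case (real r)
      show ?thesis
      proof (cases "r = 0")
        case True
        hence "ennreal ?q = 0" using ql real by simp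
        hence "?q \<le> 0" by (rule ennreal_eq_0_iff[THEN iffD1])
        hence "?q = 0" using q0 by simp
        thus ?thesis by (simp only: mult_zero_right)
      next
        case False
        hence r: "0 < r" using real by simp
        have "ennreal \<gamma> \<le> ennreal (1 / r)"
          using \<gamma>(2) r unfolding real(2) by (simp add: divide_ennreal[symmetric])
        hence "\<gamma> \<le> 1 / r" using r by (subst (asm) ennreal_le_iff) auto
        moreover have "?q \<le> r" using ql real by simp
        ultimately have "\<gamma> * ?q \<le> (1 / r) * r" using \<gamma>(1) q0 r by (intro mult_mono) auto
        thus ?thesis using r by simp
      qed
    next
      case top
      thus ?thesis using \<gamma> by (simp add: ennreal_eq_0_iff)
    qed
    thus ?thesis using dp by (simp add: field_simps)
  qed
  show ?thesis
  proof (cases "d \<alpha> \<beta> = 0")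
    case False
    thus ?thesis using main[OF \<alpha> \<beta>] by (simp add: d_def dv_def)
  next
    case True
    have tri: "d \<alpha> \<beta> \<le> d \<alpha> \<eta> + d \<eta> \<beta>" if "\<alpha> \<in> HT M T \<FF>" "\<beta> \<in> HT M T \<FF>" "\<eta> \<in> HT M T \<FF>" for \<alpha> \<beta> \<eta>
      unfolding d_def by (intro L2_norm_triangle_via HT_L2[of _ M T \<FF>] that)
    have "\<gamma> * dv \<alpha> \<beta> \<le> 0 + r" if r: "0 < r" for r
    proof -
      define c :: "real ^ 'd" where "c = 1"
      have c: "norm c > 0" by (simp add: c_def)
      \<comment> \<open>chosen so that the constant control \<open>w\<close> has norm \<open>r / 2\<close>\<close>
      define \<delta> where "\<delta> = r / (2 * sqrt T * norm c)"
      have \<delta>: "\<delta> > 0" using r T_pos c by (simp add: \<delta>_def)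
      define w :: "real \<Rightarrow> 'w \<Rightarrow> real ^ 'd" where "w = (\<lambda>t \<omega>. \<delta> *\<^sub>R c)"
      have w: "w \<in> HT M T \<FF>" by (auto simp: HT_def w_def case_prod_beta')
      have PPs: "measure PP (space PP) = T"
      proof -
        have "sigma_finite_measure M" by unfold_locales
        hence "emeasure PP (space PP) = emeasure TT (space TT) * emeasure M (space M)"
          unfolding PP_eq space_pair_measure by (rule sigma_finite_measure.emeasure_pair_measure_Times[OF _ sets.top sets.top])
        thus ?thesis using measure_TT by (simp add: measure_def emeasure_space_1)
      qed
      have nw: "L2_norm PP (case_prod w) = r / 2"
      proof -
        have "(L2_norm PP (case_prod w))\<^sup>2 = T * (\<delta> * norm c)\<^sup>2"
          unfolding L2_norm_sq using \<delta> PPs by (simp add: w_def case_prod_beta' power_mult_distrib)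
        also have "\<dots> = (sqrt T * (\<delta> * norm c))\<^sup>2" using T_pos by (simp add: power_mult_distrib)
        finally have "L2_norm PP (case_prod w) = sqrt T * (\<delta> * norm c)"
          using \<delta> c T_pos by (simp add: power2_eq_iff_nonneg)
        thus ?thesis using c T_pos by (simp add: \<delta>_def)
      qed
      define \<eta> where "\<eta> = (\<lambda>t \<omega>. \<alpha> t \<omega> + w t \<omega>)"
      have \<eta>: "\<eta> \<in> HT M T \<FF>" unfolding \<eta>_def by (rule HT_add[OF \<alpha> w])
      have d1: "d \<eta> \<alpha> = r / 2" using nw by (simp add: d_def \<eta>_def case_prod_beta')
      have sym: "d \<alpha> \<eta> = d \<eta> \<alpha>" "d \<eta> \<beta> = d \<beta> \<eta>" "d \<beta> \<alpha> = d \<alpha> \<beta>" unfolding d_def by (rule L2_norm_minus_commute)+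
      have d2: "d \<eta> \<beta> \<le> r / 2" using tri[OF \<eta> \<beta> \<alpha>] d1 True by simp
      have d3: "d \<eta> \<beta> \<noteq> 0" using tri[OF \<eta> \<alpha> \<beta>] d1 True r sym by auto
      have "dv \<alpha> \<beta> \<le> dv \<alpha> \<eta> + dv \<eta> \<beta>"
        unfolding dv_def by (intro L2_norm_triangle_via HT_L2[of _ M T \<FF>] operator_HT \<alpha> \<beta> \<eta>)
      hence "\<gamma> * dv \<alpha> \<beta> \<le> \<gamma> * dv \<alpha> \<eta> + \<gamma> * dv \<eta> \<beta>"
        using \<gamma>(1) by (simp add: distrib_left[symmetric])
      also have "\<dots> \<le> d \<alpha> \<eta> + d \<eta> \<beta>"
        using d1 sym r by (intro add_mono main \<alpha> \<beta> \<eta> d3) auto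
      also have "\<dots> \<le> 0 + r" using d1 d2 sym by simp
      finally show ?thesis .
    qed
    hence "\<gamma> * dv \<alpha> \<beta> \<le> 0" by (rule field_le_epsilon)
    thus ?thesis using True by (simp add: d_def dv_def)
  qed
qed

end

section \<open>The extragradient method\<close>

text \<open>
In the iteration, \<open>v1\<close> and \<open>v2\<close> are the values of the operator at \<open>z\<close> and at the half step \<open>h = z - \<gamma> v1\<close>, and
\<open>h - z = - \<gamma> v1\<close> turns the Lipschitz bound with \<open>\<gamma> \<le> 1/Lip\<close> into \<open>\<parallel>v2 - v1\<parallel> \<le> \<parallel>v1\<parallel>\<close>, that is,
\<open>\<parallel>v2\<parallel>\<^sup>2 \<le> 2 \<langle>v1, v2\<rangle>\<close>. This replaces the quadratic term in the expansion of \<open>\<parallel>z - \<gamma> v2 - zs\<parallel>\<^sup>2\<close>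
by exactly the one that completes \<open>\<langle>v2, z - zs\<rangle>\<close> to \<open>\<langle>v2, h - zs\<rangle>\<close>.
\<close>

lemma extragradient_step:
  fixes z zs v1 v2 :: "'w \<Rightarrow> 'a::euclidean_space"
  assumes L: "z \<in> L2 N" "zs \<in> L2 N" "v1 \<in> L2 N" "v2 \<in> L2 N"
    and \<gamma>: "0 < \<gamma>"
    and lip: "L2_norm N (\<lambda>x. v2 x - v1 x) \<le> L2_norm N v1"
    and mono: "c * (L2_norm N (\<lambda>x. z x - \<gamma> *\<^sub>R v1 x - zs x))\<^sup>2 \<le> L2_inner N v2 (\<lambda>x. z x - \<gamma> *\<^sub>R v1 x - zs x)"
  shows "(L2_norm N (\<lambda>x. z x - \<gamma> *\<^sub>R v2 x - zs x))\<^sup>2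
     \<le> (L2_norm N (\<lambda>x. z x - zs x))\<^sup>2 - 2 * \<gamma> * c * (L2_norm N (\<lambda>x. z x - \<gamma> *\<^sub>R v1 x - zs x))\<^sup>2"
proof -
  have sq: "(L2_norm N Z)\<^sup>2 = L2_inner N Z Z" for Z :: "'w \<Rightarrow> 'a"
    unfolding L2_norm_def by (simp add: L2_inner_def)
  define a where "a = (\<lambda>x. z x - zs x)"
  have a: "a \<in> L2 N" unfolding a_def by (intro L2_diff L)
  note s1 = L2_scaleR[OF L(3), of \<gamma>] and s2 = L2_scaleR[OF L(4), of \<gamma>]
  have e1: "(\<lambda>x. z x - \<gamma> *\<^sub>R v1 x - zs x) = (\<lambda>x. a x - \<gamma> *\<^sub>R v1 x)"
    and e2: "(\<lambda>x. z x - \<gamma> *\<^sub>R v2 x - zs x) = (\<lambda>x. a x - \<gamma> *\<^sub>R v2 x)"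
    by (auto simp: a_def algebra_simps)
  have "(L2_norm N (\<lambda>x. v2 x - v1 x))\<^sup>2 \<le> (L2_norm N v1)\<^sup>2" using lip by (intro power_mono) auto
  moreover have "(L2_norm N (\<lambda>x. v2 x - v1 x))\<^sup>2 = L2_inner N v2 v2 - 2 * L2_inner N v1 v2 + L2_inner N v1 v1"
    unfolding sq using L2_inner_commute[of N v2 v1] by (simp add: L2_inner_simps L2_diff L)
  ultimately have key: "L2_inner N v2 v2 \<le> 2 * L2_inner N v1 v2" by (simp add: sq)
  have "(L2_norm N (\<lambda>x. a x - \<gamma> *\<^sub>R v2 x))\<^sup>2 = L2_inner N a a - 2 * \<gamma> * L2_inner N v2 a + \<gamma>\<^sup>2 * L2_inner N v2 v2"
    unfolding sq using L2_inner_commute[of N a v2]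
    by (simp add: L2_inner_simps L2_inner_scaleR L2_diff a L s2 power2_eq_square algebra_simps)
  also have "\<dots> \<le> L2_inner N a a - 2 * \<gamma> * L2_inner N v2 a + \<gamma>\<^sup>2 * (2 * L2_inner N v1 v2)"
    using key by (intro add_left_mono mult_left_mono) auto
  also have "\<dots> = L2_inner N a a - 2 * \<gamma> * L2_inner N v2 (\<lambda>x. a x - \<gamma> *\<^sub>R v1 x)"
    using L2_inner_commute[of N v1 v2]
    by (simp add: L2_inner_simps L2_inner_scaleR a L s1 power2_eq_square algebra_simps)
  also have "\<dots> \<le> L2_inner N a a - 2 * \<gamma> * (c * (L2_norm N (\<lambda>x. a x - \<gamma> *\<^sub>R v1 x))\<^sup>2)"
    using mono \<gamma> unfolding e1 by (intro diff_left_mono mult_left_mono) auto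
  finally show ?thesis unfolding e1 e2 a_def[symmetric] by (simp add: sq mult.assoc)
qed

lemma L2_norm_sum_le:
  fixes X :: "'i \<Rightarrow> 'w \<Rightarrow> 'a::euclidean_space"
  assumes "\<And>i. i \<in> I \<Longrightarrow> X i \<in> L2 N"
  shows "L2_norm N (\<lambda>x. \<Sum>i\<in>I. X i x) \<le> (\<Sum>i\<in>I. L2_norm N (X i))"
  using assms
proof (induction I rule: infinite_finite_induct)
  case (insert i I)
  have "L2_norm N (\<lambda>x. X i x + (\<Sum>i\<in>I. X i x)) \<le> L2_norm N (X i) + L2_norm N (\<lambda>x. \<Sum>i\<in>I. X i x)"
    using insert.prems by (intro L2_norm_triangle L2_sum) auto
  also have "\<dots> \<le> L2_norm N (X i) + (\<Sum>i\<in>I. L2_norm N (X i))" using insert by auto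
  finally show ?case using insert.hyps by simp
qed (auto simp: L2_norm_def L2_inner_def)

lemma L2_norm_mean_sq_le:
  fixes X :: "nat \<Rightarrow> 'w \<Rightarrow> 'a::euclidean_space"
  assumes X: "\<And>i. i \<in> {1..n} \<Longrightarrow> X i \<in> L2 N" and n: "1 \<le> n" and z: "z \<in> L2 N"
  shows "(L2_norm N (\<lambda>x. z x - (1 / real n) *\<^sub>R (\<Sum>i=1..n. X i x)))\<^sup>2
      \<le> (1 / real n) * (\<Sum>i=1..n. (L2_norm N (\<lambda>x. X i x - z x))\<^sup>2)"
proof -
  have eq: "z x - (1 / real n) *\<^sub>R (\<Sum>i=1..n. X i x) = - (1 / real n) *\<^sub>R (\<Sum>i=1..n. X i x - z x)" for x
    using n by (simp add: sum_subtractf scaleR_diff_right sum_constant_scaleR)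
  have "L2_norm N (\<lambda>x. z x - (1 / real n) *\<^sub>R (\<Sum>i=1..n. X i x)) = (1 / real n) * L2_norm N (\<lambda>x. \<Sum>i=1..n. X i x - z x)"
    unfolding eq L2_norm_scaleR by simp
  also have "\<dots> \<le> (1 / real n) * (\<Sum>i=1..n. L2_norm N (\<lambda>x. X i x - z x))"
    by (intro mult_left_mono L2_norm_sum_le L2_diff X z) auto
  finally have "(L2_norm N (\<lambda>x. z x - (1 / real n) *\<^sub>R (\<Sum>i=1..n. X i x)))\<^sup>2
      \<le> ((1 / real n) * (\<Sum>i=1..n. L2_norm N (\<lambda>x. X i x - z x)))\<^sup>2" by (intro power_mono) auto
  also have "\<dots> = (1 / real n)\<^sup>2 * (\<Sum>i=1..n. L2_norm N (\<lambda>x. X i x - z x))\<^sup>2" by (rule power_mult_distrib)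
  also have "\<dots> \<le> (1 / real n)\<^sup>2 * ((\<Sum>i=1..n. (L2_norm N (\<lambda>x. X i x - z x))\<^sup>2) * real n)"
    using sum_squared_le_sum_of_squares[of "\<lambda>i. L2_norm N (\<lambda>x. X i x - z x)" "{1..n}"]
    by (intro mult_left_mono) auto
  also have "\<dots> = (1 / real n) * (\<Sum>i=1..n. (L2_norm N (\<lambda>x. X i x - z x))\<^sup>2)"
    using n by (simp add: power2_eq_square)
  finally show ?thesis .
qed

theorem theorem2p9:
  fixes M :: "'w measure" and T \<sigma> cL \<gamma> :: real
    and X0 :: "'w \<Rightarrow> real ^ 'd" and B :: "real \<Rightarrow> 'w \<Rightarrow> real ^ 'd"
    and g :: "real ^ 'd \<Rightarrow> (real ^ 'd) measure \<Rightarrow> real"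
    and L :: "real ^ 'd \<Rightarrow> real ^ 'd \<Rightarrow> ((real ^ 'd) \<times> (real ^ 'd)) measure \<Rightarrow> real"
    and v :: "(real \<Rightarrow> 'w \<Rightarrow> real ^ 'd) \<Rightarrow> (real \<Rightarrow> 'w \<Rightarrow> real ^ 'd)"
    and \<alpha>s :: "real \<Rightarrow> 'w \<Rightarrow> real ^ 'd"
    and \<alpha> \<alpha>h :: "nat \<Rightarrow> real \<Rightarrow> 'w \<Rightarrow> real ^ 'd"
  assumes "prob_space M" and "complete_measure M"
    and "0 < T" and "0 \<le> \<sigma>"
    and "brownian_motion M T B"
    and "X0 \<in> L2 M"
    and "prob_space.indep_set M
           (sigma_sets (space M) (generated M {X0}))
           (sigma_sets (space M) (generated M (B ` {0..T})))"
    and "assm_Lip g L"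
    and "0 < cL" and "assm_DM M cL g L"
    and "\<forall>X\<in>L2 M. \<forall>A\<in>L2 M. GaL M L X A \<in> L2 M"
    and "is_mfg_operator M T \<sigma> X0 B g L v"
    and "solves_mfg M T \<sigma> X0 B g L \<alpha>s"
    and "\<alpha> 1 \<in> HT M T (aug_filtration M X0 B)"
    and "0 < \<gamma>" and "ennreal \<gamma> \<le> 1 / lip_norm M T (aug_filtration M X0 B) v"
    and "\<forall>n\<ge>1. \<alpha>h n = (\<lambda>t \<omega>. \<alpha> n t \<omega> - \<gamma> *\<^sub>R v (\<alpha> n) t \<omega>)"
    and "\<forall>n\<ge>1. \<alpha> (n + 1) = (\<lambda>t \<omega>. \<alpha> n t \<omega> - \<gamma> *\<^sub>R v (\<alpha>h n) t \<omega>)"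
  shows "\<forall>n\<ge>1.
     (normT M T (\<lambda>t \<omega>. \<alpha>s t \<omega> - (1 / real n) *\<^sub>R (\<Sum>i=1..n. \<alpha>h i t \<omega>)))\<^sup>2
       \<le> (normT M T (\<lambda>t \<omega>. \<alpha>s t \<omega> - \<alpha> 1 t \<omega>))\<^sup>2 / (2 * \<gamma> * cL * real n)"
proof -
  interpret prob_space M by (rule assms)
  interpret complete_measure M by (rule assms)
  interpret mfg_setting M T X0 B \<sigma> cL g L v
  proof unfold_locales
    fix X A :: "'w \<Rightarrow> real ^ 'd" assume "X \<in> L2 M" "A \<in> L2 M"
    with assms(11) show "GaL M L X A \<in> L2 M" by simp
  qed (fact assms)+
  note \<gamma> = assms(15,16)
  note sol = assms(13)
  have s: "\<alpha>s \<in> HT M T \<FF>" using sol by (simp add: solves_mfg_def)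
  note s2 = HT_L2[OF s]
  have h: "\<alpha>h n = (\<lambda>t \<omega>. \<alpha> n t \<omega> - \<gamma> *\<^sub>R v (\<alpha> n) t \<omega>)" if "1 \<le> n" for n using assms(17) that by blast
  have upd: "\<alpha> (Suc n) = (\<lambda>t \<omega>. \<alpha> n t \<omega> - \<gamma> *\<^sub>R v (\<alpha>h n) t \<omega>)" if "1 \<le> n" for n using assms(18) that by simp
  have hHT: "\<alpha>h n \<in> HT M T \<FF>" if "1 \<le> n" "\<alpha> n \<in> HT M T \<FF>" for n
    unfolding h[OF that(1)] by (intro HT_diff HT_scaleR operator_HT that)
  have aHT: "\<alpha> n \<in> HT M T \<FF>" if "1 \<le> n" for n
    using that
  proof (induction n rule: dec_induct)
    case base
    show ?case by (rule assms(14))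
  next
    case (step n)
    thus ?case unfolding upd[OF step.hyps(1)]
      by (intro HT_diff HT_scaleR operator_HT hHT)
  qed
  define dist2 where "dist2 = (\<lambda>\<beta>. (L2_norm PP (\<lambda>x. case_prod \<beta> x - case_prod \<alpha>s x))\<^sup>2)"
  have dec: "dist2 (\<alpha> (Suc n)) \<le> dist2 (\<alpha> n) - 2 * \<gamma> * cL * dist2 (\<alpha>h n)" if n: "1 \<le> n" for n
  proof -
    note a = aHT[OF n] and hn = hHT[OF n aHT[OF n]]
    note a2 = HT_L2[OF a] and h2 = HT_L2[OF hn] and va2 = HT_L2[OF operator_HT[OF a]] and vh2 = HT_L2[OF operator_HT[OF hn]]
    note vs2 = HT_L2[OF operator_HT[OF s]]
    have hc: "case_prod (\<alpha>h n) x = case_prod (\<alpha> n) x - \<gamma> *\<^sub>R case_prod (v (\<alpha> n)) x" for x by (simp add: h[OF n] case_prod_beta')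
    have ac: "case_prod (\<alpha> (Suc n)) x = case_prod (\<alpha> n) x - \<gamma> *\<^sub>R case_prod (v (\<alpha>h n)) x" for x by (simp add: upd[OF n] case_prod_beta')
    have lip: "L2_norm PP (\<lambda>x. case_prod (v (\<alpha>h n)) x - case_prod (v (\<alpha> n)) x) \<le> L2_norm PP (case_prod (v (\<alpha> n)))"
    proof -
      have "\<gamma> * L2_norm PP (\<lambda>x. case_prod (v (\<alpha>h n)) x - case_prod (v (\<alpha> n)) x) \<le> L2_norm PP (\<lambda>x. case_prod (\<alpha>h n) x - case_prod (\<alpha> n) x)"
        by (rule operator_lipschitz[OF \<gamma> hn a])
      also have "(\<lambda>x. case_prod (\<alpha>h n) x - case_prod (\<alpha> n) x) = (\<lambda>x. (- \<gamma>) *\<^sub>R case_prod (v (\<alpha> n)) x)" by (simp add: hc)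
      also have "L2_norm PP \<dots> = \<gamma> * L2_norm PP (case_prod (v (\<alpha> n)))" unfolding L2_norm_scaleR using \<gamma>(1) by simp
      finally show ?thesis using \<gamma>(1) by simp
    qed
    have mono: "cL * dist2 (\<alpha>h n) \<le> L2_inner PP (case_prod (v (\<alpha>h n))) (\<lambda>x. case_prod (\<alpha>h n) x - case_prod \<alpha>s x)"
    proof -
      have eq: "case_prod (\<lambda>t \<omega>. \<alpha>h n t \<omega> - \<alpha>s t \<omega>) = (\<lambda>x. case_prod (\<alpha>h n) x - case_prod \<alpha>s x)" by auto
      have "0 \<le> L2_inner PP (case_prod (v \<alpha>s)) (\<lambda>x. case_prod (\<alpha>h n) x - case_prod \<alpha>s x)"
        using first_order_condition[OF sol HT_diff[OF hn s]] unfolding eq .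
      thus ?thesis using operator_strongly_monotone[OF hn s]
        unfolding L2_inner_simps(2)[OF vh2 vs2 L2_diff[OF h2 s2]] by (simp add: dist2_def)
    qed
    show ?thesis
      using extragradient_step[OF a2 s2 va2 vh2 \<gamma>(1) lip, of cL] mono unfolding dist2_def ac hc by blast
  qed
  have tele: "2 * \<gamma> * cL * (\<Sum>i=1..n. dist2 (\<alpha>h i)) \<le> dist2 (\<alpha> 1) - dist2 (\<alpha> (Suc n))" for n
  proof (induction n)
    case (Suc n)
    show ?case using Suc dec[of "Suc n"] by (simp add: distrib_left)
  qed simp
  show ?thesis
  proof (intro allI impI)
    fix n :: nat assume n: "1 \<le> n"
    have iHT: "\<alpha>h i \<in> HT M T \<FF>" if "i \<in> {1..n}" for i using that hHT aHT by simp
    have "(\<lambda>t \<omega>. \<alpha>s t \<omega> - (1 / real n) *\<^sub>R (\<Sum>i=1..n. \<alpha>h i t \<omega>)) \<in> HT M T \<FF>"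
      by (intro HT_diff HT_scaleR HT_sum iHT s)
    from normT_eq[OF HT_L2[OF this]]
    have n1: "normT M T (\<lambda>t \<omega>. \<alpha>s t \<omega> - (1 / real n) *\<^sub>R (\<Sum>i=1..n. \<alpha>h i t \<omega>))
      = L2_norm PP (\<lambda>x. case_prod \<alpha>s x - (1 / real n) *\<^sub>R (\<Sum>i=1..n. case_prod (\<alpha>h i) x))"
      by (simp add: case_prod_beta')
    have n2: "(normT M T (\<lambda>t \<omega>. \<alpha>s t \<omega> - \<alpha> 1 t \<omega>))\<^sup>2 = dist2 (\<alpha> 1)"
      unfolding normT_eq[OF HT_L2[OF HT_diff[OF s aHT[OF order_refl]]]] dist2_def
      using L2_norm_minus_commute[of PP "case_prod \<alpha>s" "case_prod (\<alpha> 1)"] by (simp add: case_prod_beta')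
    have "(normT M T (\<lambda>t \<omega>. \<alpha>s t \<omega> - (1 / real n) *\<^sub>R (\<Sum>i=1..n. \<alpha>h i t \<omega>)))\<^sup>2
        \<le> (1 / real n) * (\<Sum>i=1..n. dist2 (\<alpha>h i))"
      unfolding n1 dist2_def by (rule L2_norm_mean_sq_le[OF HT_L2[OF iHT] n s2])
    also have "\<dots> = 2 * \<gamma> * cL * (\<Sum>i=1..n. dist2 (\<alpha>h i)) / (2 * \<gamma> * cL * real n)"
      using \<gamma>(1) assms(9) by simp
    also have "\<dots> \<le> dist2 (\<alpha> 1) / (2 * \<gamma> * cL * real n)"
    proof (rule divide_right_mono)
      have "0 \<le> dist2 (\<alpha> (Suc n))" by (simp add: dist2_def)
      thus "2 * \<gamma> * cL * (\<Sum>i=1..n. dist2 (\<alpha>h i)) \<le> dist2 (\<alpha> 1)" using tele[of n] by linarith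
      show "0 \<le> 2 * \<gamma> * cL * real n" using \<gamma>(1) assms(9) by simp
    qed
    finally show "(normT M T (\<lambda>t \<omega>. \<alpha>s t \<omega> - (1 / real n) *\<^sub>R (\<Sum>i=1..n. \<alpha>h i t \<omega>)))\<^sup>2
       \<le> (normT M T (\<lambda>t \<omega>. \<alpha>s t \<omega> - \<alpha> 1 t \<omega>))\<^sup>2 / (2 * \<gamma> * cL * real n)" unfolding n2 .
  qed
qed

end
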